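(* Let $A$ be a nonempty finite set. The partition poset complex $\Delta(A)$ is homeomorphic to $B(\underline{S^0})(A)$, the bar construction on the operad $\underline{S^0}$ in based spaces evaluated at $A$.
   Context: **Partition poset complex.** $K(A)$ is the poset of partitions (equivalence relations) of $A$, $\lambda\le\mu$ if $\lambda$ is finer than $\mu$, with least element $\widehat0$ and greatest element $\widehat1$; $K_0(A)=K(A)\setminus\{\widehat0\}$, $K_1(A)=K(A)\setminus\{\widehat1\}$. $\Delta(A)$ is the geometric realization of the pointed simplicial set $N_\bullet K(A)/(N_\bullet K_0(A)\cup N_\bullet K_1(A))$, where $N_\bullet$ is the nerve (the quotient by the empty set adds a disjoint basepoint). **The operad.** $\underline{S^0}$ is the operad in compactly generated based spaces $\mathcal T$ (under $\wedge$) with $\underline{S^0}(A)=S^0$ for all nonempty finite sets $A$ and all composition maps the identity of $S^0$. **Bar construction.** A tree is a finite poset $T$ with: (1) at least two elements, a minimal element $r$ (root) and $b\neq r$ with $b\le t$ for all $t\ne r$; (2) if $u\le t$ and $v\le t$ then $u\le v$ or $v\le u$; (3) for $t<u$, $t\neq r$, there is $v$ with $t<v$, $u\not\le v$. Edges are covering relations $t<u$ (incoming edges of $t$); leaves are maximal elements; vertices are other elements except the root; $i(v)$ is the set of incoming edges of $v$; the root edge is incident to $r$, leaf edges to leaves, others are internal. $\mathsf T(A)$ is the poset of isomorphism classes of trees with leaves labelled bijectively by $A$, $T\le T'$ if $T$ is obtained from $T'$ by collapsing internal edges. $w(T)$ is the space of assignments of nonnegative lengths to the edges with all root-leaf distances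 $1$; $\overline w(T)$ is its quotient by weightings with the root edge or a leaf edge of length zero (quotient by the empty set adds a disjoint basepoint); giving collapsed edges length $0$ makes $\overline w$ a functor $\mathsf T(A)\to\mathcal T$. For a reduced operad $P$ in $\mathcal T$ (i.e. with unit $S^0\to P(1)$ an isomorphism), $P_A(T)=\bigwedge_{\text{vertices }v}P(i(v))$ is a functor $\mathsf T(A)^{op}\to\mathcal T$ via operad composition, and $B(P)(A)=\int^{T\in\mathsf T(A)}\overline w(T)\wedge P_A(T)$. *)

theory Defs
  imports "HOL-Analysis.Analysis" "HOL-Homology.Simplices"
begin

section \<open>Based spaces and quotients\<close>

type_synonym 'x based_space = "'x topology \<times> 'x"

definition based_homeomorphic :: "'x based_space \<Rightarrow> 'y based_space \<Rightarrow> bool" where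
  "based_homeomorphic X Y \<longleftrightarrow> (\<exists>f. homeomorphic_map (fst X) (fst Y) f \<and> f (snd X) = snd Y)"

definition final_topology :: "'x topology \<Rightarrow> ('x \<Rightarrow> 'y) \<Rightarrow> 'y set \<Rightarrow> 'y topology" where
  "final_topology X q Y = topology (\<lambda>U. U \<subseteq> Y \<and> openin X {x \<in> topspace X. q x \<in> U})"

lemma openin_final_topology:
  "openin (final_topology X q Y) U \<longleftrightarrow> U \<subseteq> Y \<and> openin X {x \<in> topspace X. q x \<in> U}"
proof -
  have "istopology (\<lambda>U. U \<subseteq> Y \<and> openin X {x \<in> topspace X. q x \<in> U})"
    unfolding istopology_def
  proof (intro conjI allI impI; (elim conjE)?)
    fix S T
    assume "openin X {x \<in> topspace X. q x \<in> S}" "openin X {x \<in> topspace X. q x \<in> T}"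
    then have "openin X ({x \<in> topspace X. q x \<in> S} \<inter> {x \<in> topspace X. q x \<in> T})"
      by blast
    then show "openin X {x \<in> topspace X. q x \<in> S \<inter> T}"
      by (rule back_subst[of "openin X"]) blast
  next
    fix \<K>
    assume "\<forall>K\<in>\<K>. K \<subseteq> Y \<and> openin X {x \<in> topspace X. q x \<in> K}"
    then have "openin X (\<Union>K\<in>\<K>. {x \<in> topspace X. q x \<in> K})"
      by blast
    then show "openin X {x \<in> topspace X. q x \<in> \<Union>\<K>}"
      by (rule back_subst[of "openin X"]) blast
  qed blast+
  then show ?thesis
    by (simp add: final_topology_def topology_inverse')
qed

definition gen_equiv :: "'x set \<Rightarrow> ('x \<times> 'x) set \<Rightarrow> ('x \<times> 'x) set" where
  "gen_equiv S r = (r \<union> r\<inverse>)\<^sup>* \<inter> (S \<times> S)"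

definition quotient_space :: "'x topology \<Rightarrow> ('x \<times> 'x) set \<Rightarrow> 'x set topology" where
  "quotient_space X r =
     final_topology X (\<lambda>x. gen_equiv (topspace X) r `` {x}) (topspace X // gen_equiv (topspace X) r)"

text \<open>The based quotient \<open>X/S\<close>: the basepoint is \<open>None\<close> and \<open>Some x\<close> is the class of \<open>x \<notin> S\<close>.
  If \<open>S\<close> is empty, \<open>None\<close> is a disjoint basepoint.\<close>

definition collapse_proj :: "'x set \<Rightarrow> 'x \<Rightarrow> 'x option" where
  "collapse_proj S x = (if x \<in> S then None else Some x)"

definition collapse_space :: "'x topology \<Rightarrow> 'x set \<Rightarrow> 'x option based_space" where
  "collapse_space X S =
     (final_topology X (collapse_proj S) (insert None (Some ` (topspace X - S))), None)"

text \<open>The map \<open>X/R \<rightarrow> Y/S\<close> induced by \<open>f\<close> (where \<open>f ` R \<subseteq> S\<close>).\<close>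

definition collapse_map :: "'y set \<Rightarrow> ('x \<Rightarrow> 'y) \<Rightarrow> 'x option \<Rightarrow> 'y option" where
  "collapse_map S f z = (case z of None \<Rightarrow> None | Some x \<Rightarrow> collapse_proj S (f x))"

text \<open>Compactly generated spaces are Hausdorff k-spaces; products of them carry the k-ification of
  the product topology.\<close>

definition cg_space :: "'x topology \<Rightarrow> bool" where
  "cg_space X \<longleftrightarrow> Hausdorff_space X \<and> k_space X"

definition kification :: "'x topology \<Rightarrow> 'x topology" where
  "kification X = topology (\<lambda>U. U \<subseteq> topspace X \<and>
     (\<forall>K. compactin X K \<longrightarrow> openin (subtopology X K) (K \<inter> U)))"

lemma openin_kification:
  "openin (kification X) U \<longleftrightarrow>
     U \<subseteq> topspace X \<and> (\<forall>K. compactin X K \<longrightarrow> openin (subtopology X K) (K \<inter> U))"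
proof -
  have "istopology (\<lambda>U. U \<subseteq> topspace X \<and>
      (\<forall>K. compactin X K \<longrightarrow> openin (subtopology X K) (K \<inter> U)))"
    unfolding istopology_def
  proof (intro conjI allI impI; (elim conjE)?)
    fix S T K
    assume K: "compactin X K"
      and "\<forall>K. compactin X K \<longrightarrow> openin (subtopology X K) (K \<inter> S)"
      and "\<forall>K. compactin X K \<longrightarrow> openin (subtopology X K) (K \<inter> T)"
    then have "openin (subtopology X K) ((K \<inter> S) \<inter> (K \<inter> T))"
      by blast
    then show "openin (subtopology X K) (K \<inter> (S \<inter> T))"
      by (rule back_subst[of "openin (subtopology X K)"]) blast
  next
    fix \<K> K
    assume K: "compactin X K"
      and "\<forall>S\<in>\<K>. S \<subseteq> topspace X \<and>
        (\<forall>K. compactin X K \<longrightarrow> openin (subtopology X K) (K \<inter> S))"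
    then have "openin (subtopology X K) (\<Union>S\<in>\<K>. K \<inter> S)"
      by blast
    then show "openin (subtopology X K) (K \<inter> \<Union>\<K>)"
      by (rule back_subst[of "openin (subtopology X K)"]) blast
  qed blast+
  then show ?thesis
    by (simp add: kification_def topology_inverse')
qed

definition smash :: "'x based_space \<Rightarrow> 'y based_space \<Rightarrow> ('x \<times> 'y) option based_space" where
  "smash X Y = collapse_space (kification (prod_topology (fst X) (fst Y)))
     {(x, y). x = snd X \<or> y = snd Y}"

definition fat_wedge :: "'i set \<Rightarrow> ('i \<Rightarrow> 'x based_space) \<Rightarrow> ('i \<Rightarrow> 'x) set" where
  "fat_wedge I X = {x. \<exists>i\<in>I. x i = snd (X i)}"

text \<open>For \<open>I = {}\<close> the product is a point and the fat wedge is empty, so that the smash product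
  is \<open>S\<^sup>0\<close>.\<close>

definition Smash :: "'i set \<Rightarrow> ('i \<Rightarrow> 'x based_space) \<Rightarrow> ('i \<Rightarrow> 'x) option based_space" where
  "Smash I X = collapse_space (kification (product_topology (\<lambda>i. fst (X i)) I)) (fat_wedge I X)"


section \<open>The partition poset complex\<close>

text \<open>\<open>action X m \<theta> x\<close> is \<open>\<theta>\<^sup>* x\<close> for \<open>\<theta> : [m] \<rightarrow> [n]\<close> monotone and \<open>x\<close> an \<open>n\<close>-simplex.\<close>

record 's sset =
  simplices :: "nat \<Rightarrow> 's set"
  action :: "nat \<Rightarrow> (nat \<Rightarrow> nat) \<Rightarrow> 's \<Rightarrow> 's"

definition simplex_op :: "nat \<Rightarrow> nat \<Rightarrow> (nat \<Rightarrow> nat) \<Rightarrow> bool" where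
  "simplex_op m n \<theta> \<longleftrightarrow> \<theta> ` {..m} \<subseteq> {..n} \<and> mono_on {..m} \<theta>"

definition nerve :: "'b::order set \<Rightarrow> 'b list sset" where
  "nerve C = \<lparr>
     simplices = (\<lambda>n. {xs. length xs = Suc n \<and> set xs \<subseteq> C \<and> sorted_wrt (\<le>) xs}),
     action = (\<lambda>m \<theta> xs. map (\<lambda>i. xs ! \<theta> i) [0..<Suc m])\<rparr>"

text \<open>The quotient of \<open>X\<close> by the simplicial subset with \<open>n\<close>-simplices \<open>S n\<close>, pointed by \<open>None\<close>.\<close>

definition sset_quotient :: "'s sset \<Rightarrow> (nat \<Rightarrow> 's set) \<Rightarrow> 's option sset" where
  "sset_quotient X S = \<lparr>
     simplices = (\<lambda>n. insert None (Some ` (simplices X n - S n))),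
     action = (\<lambda>m \<theta>. collapse_map (S m) (action X m \<theta>))\<rparr>"

definition simplex_push :: "nat \<Rightarrow> (nat \<Rightarrow> nat) \<Rightarrow> (nat \<Rightarrow> real) \<Rightarrow> nat \<Rightarrow> real" where
  "simplex_push m \<theta> t = (\<lambda>j. \<Sum>i | i \<le> m \<and> \<theta> i = j. t i)"

definition simplex_sum :: "'s sset \<Rightarrow> (nat \<times> 's \<times> (nat \<Rightarrow> real)) topology" where
  "simplex_sum X = sum_topology
     (\<lambda>n. prod_topology (discrete_topology (simplices X n))
            (subtopology (powertop_real UNIV) (standard_simplex n))) UNIV"

definition realization_rel ::
    "'s sset \<Rightarrow> ((nat \<times> 's \<times> (nat \<Rightarrow> real)) \<times> (nat \<times> 's \<times> (nat \<Rightarrow> real))) set" where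
  "realization_rel X =
     {((m, action X m \<theta> x, t), (n, x, simplex_push m \<theta> t)) | m n \<theta> x t.
        simplex_op m n \<theta> \<and> x \<in> simplices X n \<and> t \<in> standard_simplex m}"

definition pointed_realization ::
    "'s option sset \<Rightarrow> (nat \<times> 's option \<times> (nat \<Rightarrow> real)) set based_space" where
  "pointed_realization X =
     (quotient_space (simplex_sum X) (realization_rel X),
      gen_equiv (topspace (simplex_sum X)) (realization_rel X) ``
        {(n, None, t) | n t. t \<in> standard_simplex n})"

text \<open>Finer partitions are smaller relations, so the order is inclusion, with least element
  \<open>Id_on A\<close> and greatest element \<open>A \<times> A\<close>.\<close>

definition partitions :: "'a set \<Rightarrow> 'a rel set" where
  "partitions A = {r. equiv A r}"

definition partition_complex ::
    "'a set \<Rightarrow> (nat \<times> 'a rel list option \<times> (nat \<Rightarrow> real)) set based_space" where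
  "partition_complex A = pointed_realization
     (sset_quotient (nerve (partitions A))
        (\<lambda>n. simplices (nerve (partitions A - {Id_on A})) n
           \<union> simplices (nerve (partitions A - {A \<times> A})) n))"


section \<open>Operads in based spaces\<close>

text \<open>An operad is given by partial compositions
  \<open>P(A) \<and> P(B) \<rightarrow> P(A \<union>\<^sub>a B)\<close> with \<open>A \<union>\<^sub>a B = (A - {a}) \<union> B\<close>, for \<open>a \<in> A\<close> and \<open>B\<close> disjoint from
  \<open>A - {a}\<close>. Here \<open>relabel P A \<sigma>\<close> is the map \<open>P(A) \<rightarrow> P(\<sigma> ` A)\<close> for \<open>\<sigma>\<close> injective on \<open>A\<close>, and
  \<open>op_unit P a\<close> is the image of the non-basepoint under the unit \<open>S\<^sup>0 \<rightarrow> P({a})\<close>. The maps out of smash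
  products are written as maps out of products that take the wedge to the basepoint.\<close>

record ('e, 'x) operad =
  space_of :: "'e set \<Rightarrow> 'x based_space"
  relabel :: "'e set \<Rightarrow> ('e \<Rightarrow> 'e) \<Rightarrow> 'x \<Rightarrow> 'x"
  ocomp :: "'e set \<Rightarrow> 'e \<Rightarrow> 'e set \<Rightarrow> 'x \<Rightarrow> 'x \<Rightarrow> 'x"
  op_unit :: "'e \<Rightarrow> 'x"

definition composable :: "'e set \<Rightarrow> 'e \<Rightarrow> 'e set \<Rightarrow> bool" where
  "composable A a B \<longleftrightarrow> finite A \<and> a \<in> A \<and> finite B \<and> B \<noteq> {} \<and> (A - {a}) \<inter> B = {}"

locale reduced_operad =
  fixes P :: "('e, 'x) operad"
  assumes cg: "finite A \<Longrightarrow> A \<noteq> {} \<Longrightarrow> cg_space (fst (space_of P A))"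
    and base_mem: "finite A \<Longrightarrow> A \<noteq> {} \<Longrightarrow> snd (space_of P A) \<in> topspace (fst (space_of P A))"
    and relabel_cont: "finite A \<Longrightarrow> A \<noteq> {} \<Longrightarrow> inj_on \<sigma> A \<Longrightarrow>
      continuous_map (fst (space_of P A)) (fst (space_of P (\<sigma> ` A))) (relabel P A \<sigma>)"
    and relabel_base: "finite A \<Longrightarrow> A \<noteq> {} \<Longrightarrow> inj_on \<sigma> A \<Longrightarrow>
      relabel P A \<sigma> (snd (space_of P A)) = snd (space_of P (\<sigma> ` A))"
    and relabel_ident: "finite A \<Longrightarrow> A \<noteq> {} \<Longrightarrow> (\<And>e. e \<in> A \<Longrightarrow> \<sigma> e = e) \<Longrightarrow>
      x \<in> topspace (fst (space_of P A)) \<Longrightarrow> relabel P A \<sigma> x = x"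
    and relabel_comp: "finite A \<Longrightarrow> A \<noteq> {} \<Longrightarrow> inj_on \<sigma> A \<Longrightarrow> inj_on \<tau> (\<sigma> ` A) \<Longrightarrow>
      x \<in> topspace (fst (space_of P A)) \<Longrightarrow>
      relabel P (\<sigma> ` A) \<tau> (relabel P A \<sigma> x) = relabel P A (\<tau> \<circ> \<sigma>) x"
    and ocomp_cont: "composable A a B \<Longrightarrow>
      continuous_map (kification (prod_topology (fst (space_of P A)) (fst (space_of P B))))
        (fst (space_of P (A - {a} \<union> B))) (\<lambda>(x, y). ocomp P A a B x y)"
    and ocomp_base: "composable A a B \<Longrightarrow>
      x \<in> topspace (fst (space_of P A)) \<Longrightarrow> y \<in> topspace (fst (space_of P B)) \<Longrightarrow>
      x = snd (space_of P A) \<or> y = snd (space_of P B) \<Longrightarrow>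
      ocomp P A a B x y = snd (space_of P (A - {a} \<union> B))"
    and ocomp_relabel: "composable A a B \<Longrightarrow> inj_on \<sigma> A \<Longrightarrow> inj_on \<rho> B \<Longrightarrow>
      composable (\<sigma> ` A) (\<sigma> a) (\<rho> ` B) \<Longrightarrow>
      x \<in> topspace (fst (space_of P A)) \<Longrightarrow> y \<in> topspace (fst (space_of P B)) \<Longrightarrow>
      ocomp P (\<sigma> ` A) (\<sigma> a) (\<rho> ` B) (relabel P A \<sigma> x) (relabel P B \<rho> y) =
      relabel P (A - {a} \<union> B) (\<lambda>e. if e \<in> B then \<rho> e else \<sigma> e) (ocomp P A a B x y)"
    and ocomp_sequential: "composable A a B \<Longrightarrow> composable B b C \<Longrightarrow> (A - {a}) \<inter> C = {} \<Longrightarrow>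
      x \<in> topspace (fst (space_of P A)) \<Longrightarrow> y \<in> topspace (fst (space_of P B)) \<Longrightarrow>
      z \<in> topspace (fst (space_of P C)) \<Longrightarrow>
      ocomp P (A - {a} \<union> B) b C (ocomp P A a B x y) z =
      ocomp P A a (B - {b} \<union> C) x (ocomp P B b C y z)"
    and ocomp_parallel: "composable A a B \<Longrightarrow> composable A a' C \<Longrightarrow> a \<noteq> a' \<Longrightarrow> B \<inter> C = {} \<Longrightarrow>
      x \<in> topspace (fst (space_of P A)) \<Longrightarrow> y \<in> topspace (fst (space_of P B)) \<Longrightarrow>
      z \<in> topspace (fst (space_of P C)) \<Longrightarrow>
      ocomp P (A - {a} \<union> B) a' C (ocomp P A a B x y) z =
      ocomp P (A - {a'} \<union> C) a B (ocomp P A a' C x z) y"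
    and relabel_unit: "relabel P {a} \<sigma> (op_unit P a) = op_unit P (\<sigma> a)"
    and ocomp_unit_left: "finite B \<Longrightarrow> B \<noteq> {} \<Longrightarrow> y \<in> topspace (fst (space_of P B)) \<Longrightarrow>
      ocomp P {a} a B (op_unit P a) y = y"
    and ocomp_unit_right: "composable A a {b} \<Longrightarrow> x \<in> topspace (fst (space_of P A)) \<Longrightarrow>
      ocomp P A a {b} x (op_unit P b) = relabel P A (\<lambda>e. if e = a then b else e) x"
    and reduced: "op_unit P a \<noteq> snd (space_of P {a})"
      "fst (space_of P {a}) = discrete_topology {snd (space_of P {a}), op_unit P a}"

definition sphere0 :: "bool based_space" where
  "sphere0 = (discrete_topology UNIV, False)"

text \<open>Under the identification \<open>S\<^sup>0 \<and> S\<^sup>0 = S\<^sup>0\<close>, conjunction is the identity.\<close>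

definition S0_operad :: "('e, bool) operad" where
  "S0_operad = \<lparr>space_of = (\<lambda>_. sphere0), relabel = (\<lambda>_ _ x. x),
     ocomp = (\<lambda>_ _ _ x y. x \<and> y), op_unit = (\<lambda>_. True)\<rparr>"

lemma kification_discrete: "kification (discrete_topology U) = discrete_topology U"
  by (auto simp: topology_eq openin_kification subtopology_discrete_topology)

lemma reduced_operad_S0: "reduced_operad (S0_operad :: ('e, bool) operad)"
proof -
  have "k_space (discrete_topology (UNIV :: bool set))"
    by (simp add: locally_compact_imp_k_space locally_compact_space_discrete_topology)
  moreover have "prod_topology (discrete_topology (UNIV :: bool set)) (discrete_topology (UNIV :: bool set))
      = discrete_topology UNIV"
    by (simp flip: prod_topology_discrete_topology)
  ultimately show ?thesis
    by unfold_locales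
      (auto simp: S0_operad_def sphere0_def cg_space_def kification_discrete UNIV_bool)
qed


section \<open>Trees\<close>

definition strict_in :: "('v \<times> 'v) set \<Rightarrow> 'v \<Rightarrow> 'v \<Rightarrow> bool" where
  "strict_in R s t \<longleftrightarrow> (s, t) \<in> R \<and> s \<noteq> t"

definition is_root :: "'v set \<Rightarrow> ('v \<times> 'v) set \<Rightarrow> 'v \<Rightarrow> bool" where
  "is_root V R r \<longleftrightarrow> r \<in> V \<and> (\<forall>t\<in>V. (r, t) \<in> R)"

definition tree_poset :: "'v set \<Rightarrow> ('v \<times> 'v) set \<Rightarrow> bool" where
  "tree_poset V R \<longleftrightarrow> finite V \<and> partial_order_on V R \<and>
     (\<exists>r. is_root V R r \<and>
        (\<exists>b\<in>V. b \<noteq> r \<and> (\<forall>t\<in>V. t \<noteq> r \<longrightarrow> (b, t) \<in> R)) \<and>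
        (\<forall>t u v. (u, t) \<in> R \<and> (v, t) \<in> R \<longrightarrow> (u, v) \<in> R \<or> (v, u) \<in> R) \<and>
        (\<forall>t u. strict_in R t u \<and> t \<noteq> r \<longrightarrow> (\<exists>v. strict_in R t v \<and> (u, v) \<notin> R)))"

text \<open>Trees with leaves labelled by a subset of \<open>'a\<close>. Every finite poset has an isomorphic copy on
  a set of natural numbers.\<close>

record 'a ltree =
  elems :: "nat set"
  tree_le :: "(nat \<times> nat) set"
  label :: "'a \<Rightarrow> nat"

type_synonym edge = "nat \<times> nat"

definition tree_root :: "'a ltree \<Rightarrow> nat" where
  "tree_root T = (THE r. is_root (elems T) (tree_le T) r)"

definition edges :: "'a ltree \<Rightarrow> edge set" where
  "edges T = {(t, u). strict_in (tree_le T) t u \<and>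
     \<not> (\<exists>s. strict_in (tree_le T) t s \<and> strict_in (tree_le T) s u)}"

definition leaves :: "'a ltree \<Rightarrow> nat set" where
  "leaves T = {t \<in> elems T. \<not> (\<exists>u. strict_in (tree_le T) t u)}"

definition verts :: "'a ltree \<Rightarrow> nat set" where
  "verts T = elems T - leaves T - {tree_root T}"

definition incoming :: "'a ltree \<Rightarrow> nat \<Rightarrow> edge set" where
  "incoming T v = {e \<in> edges T. fst e = v}"

definition outer_edges :: "'a ltree \<Rightarrow> edge set" where
  "outer_edges T = {e \<in> edges T. fst e = tree_root T \<or> snd e \<in> leaves T}"

definition internal_edges :: "'a ltree \<Rightarrow> edge set" where
  "internal_edges T = edges T - outer_edges T"

definition edge_below :: "'a ltree \<Rightarrow> nat \<Rightarrow> edge" where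
  "edge_below T u = (THE e. e \<in> edges T \<and> snd e = u)"

definition labelled_trees :: "'a set \<Rightarrow> 'a ltree set" where
  "labelled_trees A = {T. tree_poset (elems T) (tree_le T) \<and> bij_betw (label T) A (leaves T)}"

definition tree_iso :: "'a set \<Rightarrow> 'a ltree \<Rightarrow> 'a ltree \<Rightarrow> (nat \<Rightarrow> nat) \<Rightarrow> bool" where
  "tree_iso A T T' h \<longleftrightarrow> bij_betw h (elems T) (elems T') \<and>
     (\<forall>s\<in>elems T. \<forall>t\<in>elems T. (s, t) \<in> tree_le T \<longleftrightarrow> (h s, h t) \<in> tree_le T') \<and>
     (\<forall>a\<in>A. h (label T a) = label T' a)"

definition tree_classes :: "'a set \<Rightarrow> 'a ltree set set" where
  "tree_classes A = labelled_trees A //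
     {(T, T'). T \<in> labelled_trees A \<and> T' \<in> labelled_trees A \<and> (\<exists>h. tree_iso A T T' h)}"

text \<open>Only the identity automorphism of a tree fixes all leaves, so the choice of representatives
  is immaterial.\<close>

definition rep :: "'a ltree set \<Rightarrow> 'a ltree" where
  "rep c = (SOME T. T \<in> c)"

text \<open>Collapsing a set \<open>F\<close> of internal edges: the elements joined by collapsed edges are identified,
  and each resulting element is represented by the least element of its class. What disappears are
  thus the upper ends of the edges in \<open>F\<close>.\<close>

definition collapse :: "'a ltree \<Rightarrow> edge set \<Rightarrow> 'a ltree" where
  "collapse T F = T\<lparr>elems := elems T - snd ` F, tree_le := Restr (tree_le T) (elems T - snd ` F)\<rparr>"

text \<open>\<open>T \<R> T'\<close> in \<open>\<T>(A)\<close> means that \<open>collapses A T' T F h\<close> for some \<open>F\<close> and \<open>h\<close>, and these are then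
  unique.\<close>

definition collapses ::
    "'a set \<Rightarrow> 'a ltree \<Rightarrow> 'a ltree \<Rightarrow> edge set \<Rightarrow> (nat \<Rightarrow> nat) \<Rightarrow> bool" where
  "collapses A T' T F h \<longleftrightarrow> F \<subseteq> internal_edges T' \<and> tree_iso A (collapse T' F) T h"


section \<open>The bar construction\<close>

definition weightings :: "'a ltree \<Rightarrow> (edge \<Rightarrow> real) set" where
  "weightings T = {w \<in> edges T \<rightarrow>\<^sub>E {0..}.
     \<forall>l\<in>leaves T. (\<Sum>e | e \<in> edges T \<and> (snd e, l) \<in> tree_le T. w e) = 1}"

definition weight_space :: "'a ltree \<Rightarrow> (edge \<Rightarrow> real) topology" where
  "weight_space T = subtopology (powertop_real (edges T)) (weightings T)"

definition degenerate :: "'a ltree \<Rightarrow> (edge \<Rightarrow> real) set" where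
  "degenerate T = {w. \<exists>e\<in>outer_edges T. w e = 0}"

definition wbar :: "'a ltree \<Rightarrow> (edge \<Rightarrow> real) option based_space" where
  "wbar T = collapse_space (weight_space T) (degenerate T)"

text \<open>The functoriality of \<open>wbar\<close>: a remaining edge of \<open>T'\<close> corresponds to the edge of \<open>T\<close> with the
  same upper end.\<close>

definition weight_map ::
    "'a ltree \<Rightarrow> 'a ltree \<Rightarrow> edge set \<Rightarrow> (nat \<Rightarrow> nat) \<Rightarrow> (edge \<Rightarrow> real) \<Rightarrow> edge \<Rightarrow> real" where
  "weight_map T T' F h w =
     (\<lambda>e\<in>edges T'. if e \<in> F then 0 else w (edge_below T (h (snd e))))"

definition wbar_map ::
    "'a ltree \<Rightarrow> 'a ltree \<Rightarrow> edge set \<Rightarrow> (nat \<Rightarrow> nat) \<Rightarrow>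
     (edge \<Rightarrow> real) option \<Rightarrow> (edge \<Rightarrow> real) option" where
  "wbar_map T T' F h = collapse_map (degenerate T') (weight_map T T' F h)"

definition tree_smash ::
    "(edge, 'x) operad \<Rightarrow> 'a ltree \<Rightarrow> (nat \<Rightarrow> 'x) option based_space" where
  "tree_smash P T = Smash (verts T) (\<lambda>v. space_of P (incoming T v))"

definition to_tree_smash ::
    "(edge, 'x) operad \<Rightarrow> 'a ltree \<Rightarrow> ('y \<Rightarrow> nat \<Rightarrow> 'x) \<Rightarrow> 'y option \<Rightarrow> (nat \<Rightarrow> 'x) option" where
  "to_tree_smash P T = collapse_map (fat_wedge (verts T) (\<lambda>v. space_of P (incoming T v)))"

text \<open>Contracting a single internal edge \<open>(u, v)\<close> composes the label of \<open>v\<close> into the label of \<open>u\<close>. In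
  the collapsed tree the former incoming edges \<open>(v, t)\<close> of \<open>v\<close> become \<open>(u, t)\<close>.\<close>

definition contract_edge ::
    "(edge, 'x) operad \<Rightarrow> 'a ltree \<Rightarrow> edge \<Rightarrow> (nat \<Rightarrow> 'x) \<Rightarrow> nat \<Rightarrow> 'x" where
  "contract_edge P T e x = (case e of (u, v) \<Rightarrow>
     (\<lambda>w\<in>verts (collapse T {e}).
        if w = u then
          relabel P (incoming T u - {e} \<union> incoming T v) (\<lambda>(s, t). (u, t))
            (ocomp P (incoming T u) e (incoming T v) (x u) (x v))
        else x w))"

text \<open>Contracting the edges in \<open>F\<close> one at a time. By the associativity of an operad the result does
  not depend on the order.\<close>

inductive contracts ::
    "(edge, 'x) operad \<Rightarrow> 'a ltree \<Rightarrow> edge set \<Rightarrow>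
     (nat \<Rightarrow> 'x) option \<Rightarrow> (nat \<Rightarrow> 'x) option \<Rightarrow> bool"
  for P :: "(edge, 'x) operad" and T :: "'a ltree" where
  none: "contracts P T {} x x"
| step: "contracts P T F x y \<Longrightarrow> e \<in> internal_edges T - F \<Longrightarrow>
    contracts P T (insert e F) x
      (to_tree_smash P (collapse T (insert e F))
         (contract_edge P (collapse T F) (edge_below (collapse T F) (snd e))) y)"

definition transport ::
    "(edge, 'x) operad \<Rightarrow> 'a ltree \<Rightarrow> 'a ltree \<Rightarrow> (nat \<Rightarrow> nat) \<Rightarrow> (nat \<Rightarrow> 'x) \<Rightarrow> nat \<Rightarrow> 'x" where
  "transport P T T' h x = (\<lambda>v\<in>verts T'.
     let u = inv_into (elems T) h v in relabel P (incoming T u) (map_prod h h) (x u))"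

text \<open>\<open>tree_smash_map P T' T F h x y\<close>: the map \<open>P\<^sub>A(T') \<rightarrow> P\<^sub>A(T)\<close> takes \<open>x\<close> to \<open>y\<close>.\<close>

definition tree_smash_map ::
    "(edge, 'x) operad \<Rightarrow> 'a ltree \<Rightarrow> 'a ltree \<Rightarrow> edge set \<Rightarrow> (nat \<Rightarrow> nat) \<Rightarrow>
     (nat \<Rightarrow> 'x) option \<Rightarrow> (nat \<Rightarrow> 'x) option \<Rightarrow> bool" where
  "tree_smash_map P T' T F h x y \<longleftrightarrow>
     (\<exists>z. contracts P T' F x z \<and> y = to_tree_smash P T (transport P (collapse T' F) T h) z)"

text \<open>The class in \<open>wbar T \<and> P\<^sub>A(T)\<close> of a pair; both factors have basepoint \<open>None\<close>.\<close>

definition smash_pair :: "'x option \<Rightarrow> 'y option \<Rightarrow> ('x option \<times> 'y option) option" where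
  "smash_pair x y = collapse_proj {(x, y). x = None \<or> y = None} (x, y)"

type_synonym ('a, 'x) bar_point =
  "'a ltree set \<times> ((edge \<Rightarrow> real) option \<times> (nat \<Rightarrow> 'x) option) option"

definition bar_sum :: "(edge, 'x) operad \<Rightarrow> 'a set \<Rightarrow> ('a, 'x) bar_point topology" where
  "bar_sum P A = sum_topology
     (\<lambda>c. fst (smash (wbar (rep c)) (tree_smash P (rep c)))) (tree_classes A)"

text \<open>The coend is the coequalizer, in based spaces, of the two maps
  \<open>\<Or>\<^bsub>T \<R> T'\<^esub> wbar T \<and> P\<^sub>A(T') \<rightarrow> \<Or>\<^bsub>T\<^esub> wbar T \<and> P\<^sub>A(T)\<close>; the first set identifies the basepoints of
  the summands.\<close>

definition bar_rel ::
    "(edge, 'x) operad \<Rightarrow> 'a set \<Rightarrow> (('a, 'x) bar_point \<times> ('a, 'x) bar_point) set" where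
  "bar_rel P A =
     {((c, None), (c', None)) | c c'. c \<in> tree_classes A \<and> c' \<in> tree_classes A} \<union>
     {((c, smash_pair w y), (c', smash_pair (wbar_map (rep c) (rep c') F h w) x)) | c c' F h w x y.
        c \<in> tree_classes A \<and> c' \<in> tree_classes A \<and> collapses A (rep c') (rep c) F h \<and>
        w \<in> topspace (fst (wbar (rep c))) \<and> x \<in> topspace (fst (tree_smash P (rep c'))) \<and>
        tree_smash_map P (rep c') (rep c) F h x y}"

definition bar :: "(edge, 'x) operad \<Rightarrow> 'a set \<Rightarrow> ('a, 'x) bar_point set based_space" where
  "bar P A =
     (quotient_space (bar_sum P A) (bar_rel P A),
      gen_equiv (topspace (bar_sum P A)) (bar_rel P A) `` {(c, None) | c. c \<in> tree_classes A})"

end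

theory Submission
  imports Defs
begin

text \<open>
  Both spaces are quotients of a compactly covered disjoint union, and both are identified with the
  same Hausdorff space of weights \<open>W\<close> on the subsets of \<open>A\<close>. A chain of partitions
  \<open>\<lambda>\<^sub>0 \<le> \<dots> \<le> \<lambda>\<^sub>n\<close> with barycentric coordinates \<open>t\<close> gives \<open>W(C) = \<Sum>{t\<^sub>i. C is a block of \<lambda>\<^sub>i}\<close>. A
  weighted tree gives \<open>W(C)\<close>, the length of the edge such that the leaves above it are those labelled by \<open>C\<close>. In
  both cases \<open>W\<close> is nonnegative, has laminar support, and satisfies \<open>\<Sum>{W(C). a \<in> C} = 1\<close> for all
  \<open>a\<close>; the point is the basepoint if \<open>W(A) = 0\<close> or \<open>W({a}) = 0\<close> for some \<open>a\<close>, and is otherwise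
  determined by \<open>W\<close>. Multiplying \<open>W\<close> by \<open>W(A) \<cdot> \<Prod>{W({a}). a \<in> A}\<close> collapses exactly the basepoint.
\<close>

section \<open>Based spaces and quotients\<close>

text \<open>The two cell structures do not match: a weighted tree does not say in advance which of
  two vertices on different branches is higher, whereas a chain of partitions lists its levels in
  order. One tree cell is thus cut into several simplices. The weight \<open>W\<close> sees neither
  structure and serves as common coordinates. Each side then needs only four facts: the coordinate
  map is continuous, respects the gluing, is onto from a compact part, and has gluing classes as
  fibres. Continuity of an inverse comes for free from the Hausdorff target. The factor in front of
  \<open>W\<close> is needed because \<open>W\<close> itself is not constant on the points to be
  collapsed. A factor has to vanish exactly there and still be recoverable from the product
  elsewhere. It is recoverable because all masses of \<open>W\<close> are 1, so the masses of the
  scaled function equal the factor. On the tree side the factor is the length of the root edge times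
  the lengths of the leaf edges.\<close>

lemma based_homeomorphic_sym:
  assumes "based_homeomorphic X Y" "snd X \<in> topspace (fst X)"
  shows "based_homeomorphic Y X"
proof -
  obtain f where f: "homeomorphic_map (fst X) (fst Y) f" "f (snd X) = snd Y"
    using assms(1) by (auto simp: based_homeomorphic_def)
  then obtain g where g: "homeomorphic_maps (fst X) (fst Y) f g"
    using homeomorphic_map_maps by blast
  then have "homeomorphic_map (fst Y) (fst X) g"
    using homeomorphic_maps_map homeomorphic_maps_sym by blast
  moreover have "g (snd Y) = snd X"
    using f(2) g assms(2) by (metis homeomorphic_maps_def)
  ultimately show ?thesis
    by (auto simp: based_homeomorphic_def)
qed

lemma based_homeomorphic_trans:
  assumes "based_homeomorphic X Y" "based_homeomorphic Y Z"
  shows "based_homeomorphic X Z"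
proof -
  obtain f g where "homeomorphic_map (fst X) (fst Y) f" "f (snd X) = snd Y"
    "homeomorphic_map (fst Y) (fst Z) g" "g (snd Y) = snd Z"
    using assms by (auto simp: based_homeomorphic_def)
  then have "homeomorphic_map (fst X) (fst Z) (g \<circ> f) \<and> (g \<circ> f) (snd X) = snd Z"
    using homeomorphic_map_compose by force
  then show ?thesis
    unfolding based_homeomorphic_def by blast
qed

lemma topspace_final_topology:
  assumes "q ` topspace X \<subseteq> Y"
  shows "topspace (final_topology X q Y) = Y"
proof
  show "topspace (final_topology X q Y) \<subseteq> Y"
    using openin_final_topology[of X q Y "topspace (final_topology X q Y)"] by simp
  have "{x \<in> topspace X. q x \<in> Y} = topspace X"
    using assms by auto
  then show "Y \<subseteq> topspace (final_topology X q Y)"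
    by (intro openin_subset) (simp add: openin_final_topology)
qed

lemma continuous_map_final_topology:
  assumes "q ` topspace X \<subseteq> Y"
  shows "continuous_map (final_topology X q Y) Z f \<longleftrightarrow>
    f ` Y \<subseteq> topspace Z \<and> (\<forall>U. openin Z U \<longrightarrow> openin X {x \<in> topspace X. f (q x) \<in> U})"
proof -
  have "{x \<in> topspace X. q x \<in> {y \<in> Y. f y \<in> U}} = {x \<in> topspace X. f (q x) \<in> U}" for U
    using assms by auto
  then show ?thesis
    by (auto simp: continuous_map_def topspace_final_topology[OF assms] openin_final_topology)
qed

lemma continuous_map_into_final_topology:
  assumes "q ` topspace X \<subseteq> Y"
  shows "continuous_map X (final_topology X q Y) q"
  using assms by (auto simp: continuous_map_def topspace_final_topology openin_final_topology)

text \<open>Restricted to \<open>K\<close>, the map goes from a compact space onto a Hausdorff space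
  and is therefore a quotient map; a map whose composite with the inclusion of \<open>K\<close> is a
  quotient map is one itself. The compact part is singled out because the disjoint union of
  simplices of all dimensions is not compact.\<close>

lemma continuous_map_compactly_covered_imp_quotient_map:
  assumes p: "continuous_map X Y p" and "Hausdorff_space Y"
    and K: "compactin X K" and onto: "topspace Y \<subseteq> p ` K"
  shows "quotient_map X Y p"
proof (rule quotient_map_from_composition)
  show "continuous_map (subtopology X K) X id"
    by (simp add: continuous_map_from_subtopology)
  show "quotient_map (subtopology X K) Y (p \<circ> id)"
  proof (rule continuous_imp_quotient_map)
    show "continuous_map (subtopology X K) Y (p \<circ> id)"
      by (simp add: continuous_map_from_subtopology p)
    show "compact_space (subtopology X K)"
      using K by (rule compact_space_subtopology)
    show "(p \<circ> id) ` topspace (subtopology X K) = topspace Y"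
      using onto continuous_map_image_subset_topspace[OF p] compactin_subset_topspace[OF K]
      by (auto simp: inf.absorb2)
  qed fact
qed (rule p)

text \<open>This is \<open>gen_equiv\<close> before the restriction to a carrier, so that paths can
  be composed without tracking membership.\<close>

abbreviation sym_closure :: "('b \<times> 'b) set \<Rightarrow> ('b \<times> 'b) set" where
  "sym_closure r \<equiv> (r \<union> r\<inverse>)\<^sup>*"

lemma sym_closure_sym: "(x, y) \<in> sym_closure r \<Longrightarrow> (y, x) \<in> sym_closure r"
  by (meson sym_Un_converse sym_rtrancl symE)

text \<open>The criterion applied to both sides. Both \<open>p\<close> and the projection
  \<open>q\<close> are quotient maps, so the induced map \<open>f\<close> is one too, and it is
  injective because the fibres of \<open>p\<close> are the classes of the relation. \<open>B\<close>
  collects all representatives of the basepoint.\<close>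

lemma based_homeomorphic_quotient_space:
  assumes p: "continuous_map X Y p" and "Hausdorff_space Y"
    and K: "compactin X K" and onto: "topspace Y \<subseteq> p ` K"
    and inv: "\<And>x y. (x, y) \<in> r \<Longrightarrow> p x = p y"
    and fib: "\<And>x y. x \<in> topspace X \<Longrightarrow> y \<in> topspace X \<Longrightarrow> p x = p y \<Longrightarrow> (x, y) \<in> sym_closure r"
    and B: "B \<noteq> {}" "B \<subseteq> topspace X" "\<And>x. x \<in> B \<Longrightarrow> p x = y0"
  shows "based_homeomorphic (quotient_space X r, gen_equiv (topspace X) r `` B) (Y, y0)"
    and "based_homeomorphic (Y, y0) (quotient_space X r, gen_equiv (topspace X) r `` B)"
proof -
  define S where "S = topspace X"
  define E where "E = gen_equiv S r"
  define q where "q x = E `` {x}" for x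
  have "p x = p y" if "(x, y) \<in> (r \<union> r\<inverse>)\<^sup>*" for x y
    using that by induction (auto dest: inv)
  then have E: "(x, y) \<in> E \<longleftrightarrow> x \<in> S \<and> y \<in> S \<and> p x = p y" for x y
    using fib by (auto simp: E_def gen_equiv_def S_def)
  have qS: "q ` S = S // E"
    by (auto simp: q_def quotient_def)
  define Q where "Q = quotient_space X r"
  have Q: "Q = final_topology X q (S // E)"
    by (simp add: Q_def quotient_space_def q_def[abs_def] E_def S_def)
  have topQ: "topspace Q = S // E"
    unfolding Q using qS by (intro topspace_final_topology) (simp add: S_def)
  have contq: "continuous_map X Q q"
    unfolding Q using qS by (intro continuous_map_into_final_topology) (simp add: S_def)
  \<comment> \<open>The choice of a representative is harmless: \<open>p\<close> is constant on each
    class.\<close>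
  define f where "f z = p (SOME x. x \<in> z)" for z
  have fq: "f (q x) = p x" if "x \<in> S" for x
  proof -
    have "x \<in> q x"
      using that by (simp add: q_def E)
    then have "(SOME y. y \<in> q x) \<in> q x"
      by (rule someI)
    moreover have "p y = p x" if "y \<in> q x" for y
      using that by (simp add: q_def E)
    ultimately have "p (SOME y. y \<in> q x) = p x"
      by blast
    then show ?thesis
      unfolding f_def .
  qed
  have quot: "quotient_map X Y p"
    using continuous_map_compactly_covered_imp_quotient_map assms(2) K onto p by blast
  have "quotient_map X Q q"
    unfolding quotient_map_def using qS topQ
    by (auto simp: S_def Q openin_final_topology)
  moreover have "quotient_map X Y (f \<circ> q)"
    using quot by (rule quotient_map_eq) (simp add: fq S_def)
  ultimately have "quotient_map Q Y f"
    using quotient_map_compose_eq by blast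
  moreover have "inj_on f (topspace Q)"
  proof (rule inj_onI)
    fix y z assume "y \<in> topspace Q" "z \<in> topspace Q" and eq: "f y = f z"
    then obtain u v where "u \<in> S" "v \<in> S" "y = q u" "z = q v"
      unfolding topQ qS[symmetric] by blast
    moreover from this have "p u = p v"
      using eq fq by metis
    ultimately show "y = z"
      by (auto simp: q_def E)
  qed
  moreover obtain b where b: "b \<in> B" "b \<in> S"
    using B by (auto simp: S_def)
  \<comment> \<open>All of \<open>B\<close> lies in one class, since \<open>p\<close> is constant on
    it; this turns the basepoint, given as an image of a set, into the class of one point.\<close>
  moreover have "E `` B = q b"
    using B b by (fastforce simp: q_def E S_def)
  ultimately have "homeomorphic_map Q Y f" "f (E `` B) = y0" "E `` B \<in> topspace Q"
    using fq[OF b(2)] B(3) qS topQ by (auto simp: homeomorphic_map_def)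
  then show "based_homeomorphic (quotient_space X r, gen_equiv (topspace X) r `` B) (Y, y0)"
    and "based_homeomorphic (Y, y0) (quotient_space X r, gen_equiv (topspace X) r `` B)"
    using based_homeomorphic_sym[of "(Q, E `` B)" "(Y, y0)"]
    by (auto simp: based_homeomorphic_def Q_def E_def S_def)
qed

section \<open>Continuous maps out of sums, discrete factors and collapses\<close>

lemma continuous_map_sum_topology:
  "continuous_map (sum_topology X I) Y f \<longleftrightarrow> (\<forall>i\<in>I. continuous_map (X i) Y (\<lambda>x. f (i, x)))"
proof
  assume "continuous_map (sum_topology X I) Y f"
  then show "\<forall>i\<in>I. continuous_map (X i) Y (\<lambda>x. f (i, x))"
    using continuous_map_compose[OF continuous_map_component_injection] by (fastforce simp: o_def)
next
  assume *: "\<forall>i\<in>I. continuous_map (X i) Y (\<lambda>x. f (i, x))"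
  show "continuous_map (sum_topology X I) Y f"
    unfolding continuous_map_def openin_sum_topology
  proof (intro conjI allI impI ballI)
    show "f \<in> topspace (sum_topology X I) \<rightarrow> topspace Y"
      using * by (fastforce simp: continuous_map_def)
    fix U i assume "openin Y U" "i \<in> I"
    with * have "openin (X i) {x \<in> topspace (X i). f (i, x) \<in> U}"
      by (auto simp: continuous_map_def)
    with \<open>i \<in> I\<close> show "openin (X i) {x. (i, x) \<in> {x \<in> topspace (sum_topology X I). f x \<in> U}}"
      by simp
  qed auto
qed

lemma continuous_map_prod_discrete:
  assumes "\<And>s. s \<in> D \<Longrightarrow> continuous_map Z Y (\<lambda>z. f (s, z))"
  shows "continuous_map (prod_topology (discrete_topology D) Z) Y f"
  unfolding continuous_map_def
proof (intro conjI allI impI)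
  show "f \<in> topspace (prod_topology (discrete_topology D) Z) \<rightarrow> topspace Y"
    using assms by (auto simp: continuous_map_def)
  fix U assume U: "openin Y U"
  have "openin (prod_topology (discrete_topology D) Z) ({s} \<times> {z \<in> topspace Z. f (s, z) \<in> U})"
    if "s \<in> D" for s
    using assms[OF that] U that by (simp add: openin_prod_Times_iff continuous_map_def)
  then have "openin (prod_topology (discrete_topology D) Z)
      (\<Union>s\<in>D. {s} \<times> {z \<in> topspace Z. f (s, z) \<in> U})"
    by blast
  then show "openin (prod_topology (discrete_topology D) Z)
      {x \<in> topspace (prod_topology (discrete_topology D) Z). f x \<in> U}"
    by (rule back_subst[of "openin _"]) auto
qed

lemma continuous_map_prod_discrete_right:
  assumes "\<And>s. s \<in> D \<Longrightarrow> continuous_map Z Y (\<lambda>z. f (z, s))"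
  shows "continuous_map (prod_topology Z (discrete_topology D)) Y f"
proof -
  have "continuous_map (prod_topology (discrete_topology D) Z) Y (\<lambda>p. f (snd p, fst p))"
    by (rule continuous_map_prod_discrete) (simp add: assms)
  moreover have "continuous_map (prod_topology Z (discrete_topology D))
      (prod_topology (discrete_topology D) Z) (\<lambda>p. (snd p, fst p))"
    by (simp add: continuous_map_pairedI continuous_map_fst continuous_map_snd)
  ultimately have "continuous_map (prod_topology Z (discrete_topology D)) Y
      ((\<lambda>p. f (snd p, fst p)) \<circ> (\<lambda>p. (snd p, fst p)))"
    by (rule continuous_map_compose[rotated])
  then show ?thesis
    by (simp add: o_def)
qed

lemma product_topology_discrete_finite:
  assumes "finite I"
  shows "product_topology (\<lambda>i. discrete_topology (X i)) I = discrete_topology (PiE I X)"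
proof -
  let ?P = "product_topology (\<lambda>i. discrete_topology (X i)) I"
  have "openin ?P {x}" if "x \<in> PiE I X" for x
  proof -
    have "openin ?P (PiE I (\<lambda>i. {x i}))"
      using assms that by (auto simp: openin_PiE_gen)
    moreover have "PiE I (\<lambda>i. {x i}) = {x}"
      using that by (intro PiE_singleton) (simp add: PiE_def)
    ultimately show ?thesis
      by simp
  qed
  then show ?thesis
    by (intro discrete_topology_unique[THEN iffD2, symmetric]) simp
qed

text \<open>In a compact space the whole space is itself one of the compact test sets.\<close>

lemma kification_compact_space:
  assumes "compact_space X"
  shows "kification X = X"
proof -
  have "openin (subtopology X K) (K \<inter> U)" if "openin X U" for K U
    using that by (metis Int_commute openin_subtopology)
  moreover have "openin X U"
    if "U \<subseteq> topspace X" "\<forall>K. compactin X K \<longrightarrow> openin (subtopology X K) (K \<inter> U)" for U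
    using that assms by (metis compact_space_def inf.absorb2 subtopology_topspace)
  ultimately show ?thesis
    unfolding topology_eq openin_kification using openin_subset by blast
qed

lemma collapse_proj_image: "collapse_proj S ` topspace X \<subseteq> insert None (Some ` (topspace X - S))"
  by (auto simp: collapse_proj_def)

lemma topspace_collapse_space [simp]:
  "topspace (fst (collapse_space X S)) = insert None (Some ` (topspace X - S))"
  by (simp add: collapse_space_def topspace_final_topology collapse_proj_image)

lemma snd_collapse_space [simp]: "snd (collapse_space X S) = None"
  by (simp add: collapse_space_def)

lemma compact_space_collapse_space:
  assumes "compact_space X"
  shows "compact_space (fst (collapse_space X S))"
proof -
  let ?Y = "fst (collapse_space X S)"
  have "continuous_map X ?Y (collapse_proj S)"
    by (simp add: collapse_space_def continuous_map_into_final_topology collapse_proj_image)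
  then have "compactin ?Y (collapse_proj S ` topspace X)"
    using assms image_compactin compact_space_def by blast
  \<comment> \<open>The basepoint is added separately: if nothing is collapsed it is isolated and
    not in the image of the projection.\<close>
  then have "compactin ?Y (insert None (collapse_proj S ` topspace X))"
    using compactin_Un[of ?Y "{None}"] by simp
  moreover have "insert None (collapse_proj S ` topspace X) = topspace ?Y"
    by (auto simp: collapse_proj_def image_iff)
  ultimately show ?thesis
    by (simp add: compact_space_def)
qed

lemma continuous_map_collapse_space:
  assumes "continuous_map X Y (\<lambda>x. f (collapse_proj S x))" "f None \<in> topspace Y"
  shows "continuous_map (fst (collapse_space X S)) Y f"
proof -
  have "f (Some x) \<in> topspace Y" if "x \<in> topspace X - S" for x
    using assms(1) that by (auto simp: continuous_map_def collapse_proj_def Pi_iff split: if_splits)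
  then show ?thesis
    using assms
    by (auto simp: collapse_space_def continuous_map_final_topology[OF collapse_proj_image]
        continuous_map_def[of X])
qed

lemma compactin_sum_topology:
  assumes "finite J" "J \<subseteq> I" "\<And>i. i \<in> J \<Longrightarrow> compact_space (X i)"
  shows "compactin (sum_topology X I) (Sigma J (topspace \<circ> X))"
proof -
  have "compactin (sum_topology X I) (\<Union>((\<lambda>i. Pair i ` topspace (X i)) ` J))"
  proof (rule compactin_Union)
    fix S assume "S \<in> (\<lambda>i. Pair i ` topspace (X i)) ` J"
    with assms show "compactin (sum_topology X I) S"
      by (force simp: compact_space_def intro: image_compactin continuous_map_component_injection)
  qed (use assms in simp)
  moreover have "\<Union>((\<lambda>i. Pair i ` topspace (X i)) ` J) = Sigma J (topspace \<circ> X)"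
    by auto
  ultimately show ?thesis
    by simp
qed

section \<open>Laminar weights\<close>

text \<open>The mass \<open>s\<close> is a parameter because peeling a partition off a weight lowers
  it; the model itself uses mass 1. Weights are functions on all sets, zero off the nonempty subsets
  of \<open>A\<close>, so that they can be compared pointwise whatever chain or tree they come
  from.\<close>

definition set_weights :: "'a set \<Rightarrow> real \<Rightarrow> ('a set \<Rightarrow> real) set" where
  "set_weights A s = {W. (\<forall>C. 0 \<le> W C) \<and> (\<forall>C. W C \<noteq> 0 \<longrightarrow> C \<subseteq> A \<and> C \<noteq> {}) \<and>
     (\<forall>C D. W C \<noteq> 0 \<longrightarrow> W D \<noteq> 0 \<longrightarrow> C \<inter> D \<noteq> {} \<longrightarrow> C \<subseteq> D \<or> D \<subseteq> C) \<and>
     (\<forall>a\<in>A. (\<Sum>C | C \<subseteq> A \<and> a \<in> C. W C) = s)}"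

definition density :: "'a set \<Rightarrow> ('a set \<Rightarrow> real) \<Rightarrow> real" where
  "density A W = W A * (\<Prod>a\<in>A. W {a})"

definition scaled :: "'a set \<Rightarrow> ('a set \<Rightarrow> real) \<Rightarrow> 'a set \<Rightarrow> real" where
  "scaled A W = (\<lambda>C. density A W * W C)"

text \<open>The zero function is the basepoint. It is inserted by hand because for a one-point
  \<open>A\<close> the only weight has density 1, and the model is then \<open>S^0\<close> with an
  isolated basepoint.\<close>

definition weight_model :: "'a set \<Rightarrow> ('a set \<Rightarrow> real) topology" where
  "weight_model A = subtopology (powertop_real UNIV) (insert (\<lambda>_. 0) (scaled A ` set_weights A 1))"

lemma Hausdorff_space_weight_model: "Hausdorff_space (weight_model A)"
  unfolding weight_model_def
  by (intro Hausdorff_space_subtopology) (simp add: Hausdorff_space_product_topology)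

lemma topspace_weight_model [simp]:
  "topspace (weight_model A) = insert (\<lambda>_. 0) (scaled A ` set_weights A 1)"
  by (simp add: weight_model_def)

lemma continuous_map_scaled:
  assumes "finite A" and cont: "\<And>C. continuous_map X euclideanreal (\<lambda>x. f x C)"
    and f: "\<And>x. x \<in> topspace X \<Longrightarrow> f x \<in> set_weights A 1"
  shows "continuous_map X (weight_model A) (\<lambda>x. scaled A (f x))"
  unfolding weight_model_def continuous_map_in_subtopology
proof
  show "continuous_map X (powertop_real UNIV) (\<lambda>x. scaled A (f x))"
    unfolding continuous_map_componentwise_UNIV scaled_def density_def
    using cont \<open>finite A\<close> by (intro allI continuous_map_real_mult continuous_map_prod) auto
qed (use f in auto)

text \<open>Evaluate at \<open>A\<close>: the factor \<open>W A\<close> already occurs in the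
  density, so \<open>density A W * W A = 0\<close> forces the density to vanish.\<close>

lemma scaled_eq_0_iff:
  "scaled A W = (\<lambda>_. 0) \<longleftrightarrow> density A W = 0"
proof
  assume "scaled A W = (\<lambda>_. 0)"
  then have "density A W * W A = 0"
    by (metis scaled_def)
  then show "density A W = 0"
    by (auto simp: density_def)
qed (auto simp: scaled_def)

text \<open>Summing the scaled function over the sets through one point gives the density, because
  \<open>W\<close> has mass 1; then divide by it.\<close>

lemma scaled_inj:
  assumes "A \<noteq> {}" "W \<in> set_weights A 1" "W' \<in> set_weights A 1"
    and eq: "scaled A W = scaled A W'" and "density A W \<noteq> 0"
  shows "W = W'"
proof -
  obtain a where a: "a \<in> A"
    using \<open>A \<noteq> {}\<close> by blast
  have sum: "(\<Sum>C | C \<subseteq> A \<and> a \<in> C. scaled A V C) = density A V" if "V \<in> set_weights A 1" for V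
    using that a by (simp add: scaled_def set_weights_def flip: sum_distrib_left)
  have "density A W = density A W'"
    using sum[OF assms(2)] sum[OF assms(3)] eq by simp
  with eq \<open>density A W \<noteq> 0\<close> show ?thesis
    by (auto simp: scaled_def fun_eq_iff)
qed

section \<open>Weighted chains of partitions\<close>

lemma quotient_nested:
  assumes "equiv A r" "equiv A r'" "r \<subseteq> r'" "C \<in> A // r" "D \<in> A // r'" "C \<inter> D \<noteq> {}"
  shows "C \<subseteq> D"
proof -
  obtain a where a: "a \<in> C" "a \<in> D"
    using assms by blast
  have "a \<in> A"
    using a assms in_quotient_imp_subset by blast
  then have "C = r `` {a}" "D = r' `` {a}"
    using assms a by (metis Image_singleton_iff equiv_class_eq_iff quotientE)+
  with assms show ?thesis
    by auto
qed

lemma quotient_block_eq: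
  assumes "equiv A r" "C \<in> A // r" "a \<in> C"
  shows "C = r `` {a}"
  using assms by (metis Image_singleton_iff equiv_class_eq_iff quotientE)

definition chain_weight :: "'a set \<Rightarrow> ('a rel \<times> real) list \<Rightarrow> 'a set \<Rightarrow> real" where
  "chain_weight A L C = (\<Sum>(r, t)\<leftarrow>L. if C \<in> A // r then t else 0)"

definition weighted_chain :: "'a set \<Rightarrow> ('a rel \<times> real) list \<Rightarrow> bool" where
  "weighted_chain A L \<longleftrightarrow> (\<forall>(r, t)\<in>set L. equiv A r \<and> 0 \<le> t) \<and> sorted_wrt (\<subseteq>) (map fst L)"

text \<open>The normal form of a point of the realization: a nondegenerate simplex together with
  interior barycentric coordinates.\<close>

definition reduced_chain :: "'a set \<Rightarrow> ('a rel \<times> real) list \<Rightarrow> bool" where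
  "reduced_chain A L \<longleftrightarrow> (\<forall>(r, t)\<in>set L. equiv A r \<and> 0 < t) \<and> sorted_wrt (\<subset>) (map fst L)"

lemma chain_weight_simps [simp]:
  "chain_weight A [] C = 0"
  "chain_weight A ((r, t) # L) C = (if C \<in> A // r then t else 0) + chain_weight A L C"
  by (simp_all add: chain_weight_def)

lemma reduced_imp_weighted_chain:
  assumes "reduced_chain A L"
  shows "weighted_chain A L"
proof -
  have "sorted_wrt (\<subseteq>) (map fst L)"
    by (rule sorted_wrt_mono_rel[of _ "(\<subset>)"]) (use assms in \<open>auto simp: reduced_chain_def\<close>)
  with assms show ?thesis
    by (fastforce simp: reduced_chain_def weighted_chain_def)
qed

lemma reduced_chain_Cons:
  "reduced_chain A ((r, t) # L) \<longleftrightarrow>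
    equiv A r \<and> 0 < t \<and> (\<forall>(r', t')\<in>set L. r \<subset> r') \<and> reduced_chain A L"
  by (auto simp: reduced_chain_def case_prod_unfold)

lemma reduced_chain_ConsD:
  assumes "reduced_chain A ((r, t) # L)" "(r', t') \<in> set L"
  shows "r \<subset> r' \<and> equiv A r'"
  using assms unfolding reduced_chain_def by force

lemma weighted_chain_Cons:
  "weighted_chain A ((r, t) # L) \<longleftrightarrow>
    equiv A r \<and> 0 \<le> t \<and> (\<forall>(r', t')\<in>set L. r \<subseteq> r') \<and> weighted_chain A L"
  by (auto simp: weighted_chain_def case_prod_unfold)

lemma chain_weight_nonneg: "weighted_chain A L \<Longrightarrow> 0 \<le> chain_weight A L C"
  by (induction L) (auto simp: weighted_chain_Cons)

lemma chain_weight_nonzeroD: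
  "chain_weight A L C \<noteq> 0 \<Longrightarrow> \<exists>(r, t)\<in>set L. C \<in> A // r \<and> t \<noteq> 0"
  by (induction L) (auto split: if_splits)

lemma chain_weight_pos:
  assumes "weighted_chain A L" "(r, t) \<in> set L" "0 < t" "C \<in> A // r"
  shows "0 < chain_weight A L C"
  using assms
proof (induction L)
  case (Cons p L)
  obtain r' t' where p: "p = (r', t')"
    by fastforce
  have "weighted_chain A L" "0 \<le> t'"
    using Cons.prems(1) by (auto simp: p weighted_chain_Cons)
  then show ?case
    using Cons chain_weight_nonneg[of A L C] by (auto simp: p add_nonneg_pos add_pos_nonneg)
qed simp

text \<open>Each partition has exactly one block through \<open>a\<close>, so it contributes its
  coefficient exactly once.\<close>

lemma chain_weight_mass:
  assumes "finite A" "weighted_chain A L" "a \<in> A"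
  shows "(\<Sum>C | C \<subseteq> A \<and> a \<in> C. chain_weight A L C) = sum_list (map snd L)"
  using assms(2)
proof (induction L)
  case (Cons p L)
  obtain r t where p: "p = (r, t)"
    by fastforce
  have r: "equiv A r"
    using Cons.prems by (auto simp: p weighted_chain_Cons)
  have "C \<in> A // r \<longleftrightarrow> C = r `` {a}" if "a \<in> C" for C
    using r that \<open>a \<in> A\<close> by (metis quotient_block_eq quotientI)
  then have "(\<Sum>C | C \<subseteq> A \<and> a \<in> C. if C \<in> A // r then t else 0) =
      (\<Sum>C | C \<subseteq> A \<and> a \<in> C. if C = r `` {a} then t else 0)"
    by (intro sum.cong) auto
  moreover have "finite {C. C \<subseteq> A \<and> a \<in> C}"
    using \<open>finite A\<close> by simp
  moreover have "r `` {a} \<subseteq> A" "a \<in> r `` {a}"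
    using r \<open>a \<in> A\<close> by (auto simp: equiv_def refl_on_def)
  ultimately have "(\<Sum>C | C \<subseteq> A \<and> a \<in> C. if C \<in> A // r then t else 0) = t"
    by simp
  then show ?case
    using Cons by (simp add: p sum.distrib weighted_chain_Cons)
qed simp

lemma chain_weight_in_set_weights:
  assumes "finite A" "weighted_chain A L" "sum_list (map snd L) = s"
  shows "chain_weight A L \<in> set_weights A s"
proof -
  have block: "\<exists>r\<in>set (map fst L). equiv A r \<and> C \<in> A // r" if "chain_weight A L C \<noteq> 0" for C
    using chain_weight_nonzeroD[OF that] assms(2) unfolding weighted_chain_def by force
  \<comment> \<open>Laminarity of the support comes from here: any two blocks belong to comparable
    partitions, and overlapping blocks of comparable partitions are nested.\<close>
  have comp: "r \<subseteq> r' \<or> r' \<subseteq> r" if "r \<in> set (map fst L)" "r' \<in> set (map fst L)" for r r'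
  proof -
    obtain i j where "i < length (map fst L)" "j < length (map fst L)" "r = map fst L ! i" "r' = map fst L ! j"
      using \<open>r \<in> set (map fst L)\<close> \<open>r' \<in> set (map fst L)\<close> unfolding in_set_conv_nth by blast
    moreover have "sorted_wrt (\<subseteq>) (map fst L)"
      using assms(2) by (simp add: weighted_chain_def)
    ultimately show ?thesis
      using sorted_wrt_nth_less[of "(\<subseteq>)" "map fst L"]
      by (cases i j rule: linorder_cases) simp_all
  qed
  have "C \<subseteq> D \<or> D \<subseteq> C"
    if "chain_weight A L C \<noteq> 0" "chain_weight A L D \<noteq> 0" "C \<inter> D \<noteq> {}" for C D
    using block[OF that(1)] block[OF that(2)] comp quotient_nested that(3) by (metis Int_commute)
  moreover have "C \<subseteq> A \<and> C \<noteq> {}" if "chain_weight A L C \<noteq> 0" for C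
    using block[OF that] in_quotient_imp_subset in_quotient_imp_non_empty by blast
  ultimately show ?thesis
    unfolding set_weights_def
    using chain_weight_nonneg[OF assms(2)] chain_weight_mass[OF assms(1,2)] assms(3) by blast
qed

text \<open>The hypothesis says that \<open>b\<close> lies in every supporting set through \<open>a\<close>; as the total weight
  through \<open>a\<close> and \<open>b\<close> is the same, no other supporting set contains \<open>b\<close>.\<close>

lemma set_weights_support_sym:
  assumes "finite A" "W \<in> set_weights A s" "a \<in> A" "b \<in> A"
    and sub: "\<And>C. W C \<noteq> 0 \<Longrightarrow> a \<in> C \<Longrightarrow> b \<in> C" and "W D \<noteq> 0" "b \<in> D"
  shows "a \<in> D"
proof (rule ccontr)
  assume "a \<notin> D"
  have W: "0 \<le> W C" "W C \<noteq> 0 \<Longrightarrow> C \<subseteq> A" for C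
    using assms(2) by (auto simp: set_weights_def)
  have fin: "finite {C. C \<subseteq> A \<and> c \<in> C}" for c
    using \<open>finite A\<close> by simp
  have "s = (\<Sum>C | C \<subseteq> A \<and> a \<in> C. W C)"
    using assms by (simp add: set_weights_def)
  also have "\<dots> = (\<Sum>C | C \<subseteq> A \<and> a \<in> C \<and> b \<in> C. W C)"
    using fin sub by (intro sum.mono_neutral_right) auto
  also have "\<dots> < (\<Sum>C | C \<subseteq> A \<and> b \<in> C. W C)"
  proof (rule sum_strict_mono2[where b = D])
    show "D \<in> {C. C \<subseteq> A \<and> b \<in> C} - {C. C \<subseteq> A \<and> a \<in> C \<and> b \<in> C}"
      using W assms \<open>a \<notin> D\<close> by auto
    show "0 < W D"
      using W(1)[of D] \<open>W D \<noteq> 0\<close> by linarith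
  qed (use fin W in auto)
  also have "\<dots> = s"
    using assms by (simp add: set_weights_def)
  finally show False
    by simp
qed

text \<open>A greedy argument: the smallest supporting sets through the points of \<open>A\<close>
  form a partition, and as much of it as possible is subtracted. At least one block then leaves the
  support, so induction on the size of the support applies, and what remains is a chain of strictly
  coarser partitions. The bound on the length later confines everything to finitely many
  dimensions.\<close>

lemma set_weights_decompose:
  assumes "finite A" "A \<noteq> {}" "W \<in> set_weights A s"
  shows "\<exists>L. reduced_chain A L \<and> chain_weight A L = W \<and> sum_list (map snd L) = s \<and>
    length L \<le> card {C. W C \<noteq> 0}"
  using assms(3)
proof (induction "card {C. W C \<noteq> 0}" arbitrary: W s rule: less_induct)
  case less
  define F where "F = {C. W C \<noteq> 0}"
  have W: "0 \<le> W C" "W C \<noteq> 0 \<Longrightarrow> C \<subseteq> A \<and> C \<noteq> {}"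
    and lam: "W C \<noteq> 0 \<Longrightarrow> W D \<noteq> 0 \<Longrightarrow> C \<inter> D \<noteq> {} \<Longrightarrow> C \<subseteq> D \<or> D \<subseteq> C"
    and mass: "a \<in> A \<Longrightarrow> (\<Sum>C | C \<subseteq> A \<and> a \<in> C. W C) = s" for C D a
    using less.prems by (auto simp: set_weights_def)
  have fin: "finite {C. C \<subseteq> A \<and> c \<in> C}" for c
    using \<open>finite A\<close> by simp
  have finF: "finite F"
    using W(2) \<open>finite A\<close> by (auto simp: F_def intro: finite_subset[of _ "Pow A"])
  show ?case
  \<comment> \<open>Mass 0 forces \<open>W = 0\<close>, which is the empty chain. Otherwise every
    point of \<open>A\<close> lies in some supporting set.\<close>
  proof (cases "s = 0")
    case True
    have "W C = 0" for C
    proof (rule ccontr)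
      assume "W C \<noteq> 0"
      then obtain a where a: "a \<in> C" "C \<subseteq> A"
        using W(2) by blast
      then have "W C \<le> (\<Sum>C | C \<subseteq> A \<and> a \<in> C. W C)"
        using fin W(1) by (intro member_le_sum) auto
      with a mass True W(1)[of C] \<open>W C \<noteq> 0\<close> show False
        by force
    qed
    then show ?thesis
      using True by (intro exI[of _ "[]"]) (auto simp: reduced_chain_def)
  next
    case False
    define r where "r = {(a, b). a \<in> A \<and> b \<in> A \<and> (\<forall>C\<in>F. a \<in> C \<longleftrightarrow> b \<in> C)}"
    have r: "equiv A r"
      by (auto simp: r_def equiv_def refl_on_def sym_def trans_def)
    \<comment> \<open>Equality of the masses at \<open>a\<close> and \<open>b\<close> makes the
      one-sided condition symmetric. This is what allows the class of \<open>a\<close> to be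
      identified with a single supporting set.\<close>
    have r_iff: "(a, b) \<in> r \<longleftrightarrow> a \<in> A \<and> b \<in> A \<and> (\<forall>C\<in>F. a \<in> C \<longrightarrow> b \<in> C)" for a b
      using set_weights_support_sym[OF \<open>finite A\<close> less.prems] by (auto simp: r_def F_def)
    have block: "r `` {a} \<in> F" if "a \<in> A" for a
    proof -
      let ?G = "{C \<in> F. a \<in> C}"
      have "?G \<noteq> {}"
      proof
        assume "?G = {}"
        then have "(\<Sum>C | C \<subseteq> A \<and> a \<in> C. W C) = 0"
          by (intro sum.neutral) (auto simp: F_def)
        with mass that False show False
          by simp
      qed
      moreover have "finite ?G"
        using finF by simp
      ultimately obtain M where M: "M \<in> ?G" "\<And>D. D \<in> ?G \<Longrightarrow> D \<subseteq> M \<Longrightarrow> M = D"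
        using finite_has_minimal[of ?G] by blast
      \<comment> \<open>Sets through \<open>a\<close> overlap, hence are nested by laminarity, so a
        minimal one is least.\<close>
      have least: "M \<subseteq> D" if "D \<in> ?G" for D
        using M that lam[of M D] by (auto simp: F_def)
      have "M \<subseteq> A"
        using M W(2)[of M] by (simp add: F_def)
      then have "(a, b) \<in> r \<longleftrightarrow> b \<in> M" for b
        using M(1) least that unfolding r_iff by blast
      then have "r `` {a} = M"
        by blast
      with M show ?thesis
        by blast
    qed
    then have blocks: "C \<in> F" if "C \<in> A // r" for C
      using that by (auto elim: quotientE)
    \<comment> \<open>The largest multiple of the partition that can be removed while keeping the
      weight nonnegative; it is attained at the block \<open>C0\<close>, which therefore drops out
      of the support.\<close>
    define e where "e = Min (W ` (A // r))"
    have finq: "finite (A // r)"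
      by (rule finite_subset[OF _ finF]) (use blocks in blast)
    have neq: "A // r \<noteq> {}"
      using \<open>A \<noteq> {}\<close> by (auto simp: quotient_def)
    obtain C0 where C0: "C0 \<in> A // r" "W C0 = e"
    proof -
      have "e \<in> W ` (A // r)"
        unfolding e_def using finq neq by (intro Min_in) auto
      with that show ?thesis
        by blast
    qed
    have e_le: "e \<le> W C" if "C \<in> A // r" for C
      using finq that by (simp add: e_def)
    have "0 < e"
      using C0 blocks[of C0] W(1)[of C0] by (auto simp: F_def)
    define W' where "W' C = W C - (if C \<in> A // r then e else 0)" for C
    have W'F: "C \<in> F" if "W' C \<noteq> 0" for C
      using that blocks by (auto simp: W'_def F_def split: if_splits)
    have "(\<Sum>C | C \<subseteq> A \<and> a \<in> C. W' C) = s - e" if "a \<in> A" for a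
    proof -
      have "(\<Sum>C | C \<subseteq> A \<and> a \<in> C. chain_weight A [(r, e)] C) = e"
        using chain_weight_mass[of A "[(r, e)]" a] \<open>finite A\<close> r \<open>0 < e\<close> that
        by (simp add: weighted_chain_def)
      then show ?thesis
        using mass[OF that] by (simp add: W'_def sum_subtractf)
    qed
    moreover have "0 \<le> W' C" for C
      using e_le W(1) by (auto simp: W'_def)
    moreover have W'W: "W C \<noteq> 0" if "W' C \<noteq> 0" for C
      using W'F[OF that] by (simp add: F_def)
    ultimately have W': "W' \<in> set_weights A (s - e)"
      using W(2)[OF W'W] lam[OF W'W W'W] by (simp add: set_weights_def)
    have C0': "C0 \<in> F" "W' C0 = 0"
      using C0 blocks by (auto simp: W'_def)
    have "{C. W' C \<noteq> 0} \<subset> F"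
      using W'F C0' by blast
    with finF have less_card: "card {C. W' C \<noteq> 0} < card F"
      by (rule psubset_card_mono)
    obtain L where L: "reduced_chain A L" "chain_weight A L = W'"
      "sum_list (map snd L) = s - e" "length L \<le> card {C. W' C \<noteq> 0}"
      using less.hyps[OF _ W'] less_card unfolding F_def by blast
    \<comment> \<open>Blocks of \<open>r'\<close> support \<open>W'\<close> and hence
      \<open>W\<close>, and no supporting set of \<open>W\<close> separates points related by
      \<open>r\<close>. The inclusion is strict because \<open>C0\<close> is a block of
      \<open>r\<close> but no longer supports \<open>W'\<close>.\<close>
    have "r \<subset> r'" if "(r', t) \<in> set L" for r' t
    proof -
      have r': "equiv A r'" "0 < t"
        using L(1) that by (auto simp: reduced_chain_def)
      have pos: "W' C \<noteq> 0" if "C \<in> A // r'" for C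
        using chain_weight_pos[OF reduced_imp_weighted_chain[OF L(1)] \<open>(r', t) \<in> set L\<close>] that r' L(2)
        by (metis less_irrefl)
      have "(a, b) \<in> r'" if "(a, b) \<in> r" for a b
      proof -
        have a: "a \<in> A" "b \<in> A"
          using that by (auto simp: r_def)
        then have "r' `` {a} \<in> F" "a \<in> r' `` {a}"
          using pos W'F r' equiv_class_self[of A r' a] by (auto simp: quotientI)
        then show ?thesis
          using that by (auto simp: r_iff)
      qed
      moreover have "r \<noteq> r'"
        using pos C0 C0' by auto
      ultimately show ?thesis
        by auto
    qed
    then have "reduced_chain A ((r, e) # L)"
      using L(1) r \<open>0 < e\<close> by (auto simp: reduced_chain_Cons)
    moreover have "chain_weight A ((r, e) # L) = W"
      by (rule ext) (simp add: L(2) W'_def)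
    moreover have "length ((r, e) # L) \<le> card F"
      using L(4) less_card by simp
    ultimately show ?thesis
      using L(3) unfolding F_def by (intro exI[of _ "(r, e) # L"]) simp
  qed
qed

lemma reduced_chain_head:
  assumes "reduced_chain A ((r, t) # L)"
  shows "r = {(a, b). a \<in> A \<and> b \<in> A \<and> (\<forall>C. chain_weight A ((r, t) # L) C \<noteq> 0 \<longrightarrow> a \<in> C \<longrightarrow> b \<in> C)}"
    (is "r = ?R")
proof -
  have r: "equiv A r" "0 < t" and L: "reduced_chain A L"
    and sub: "\<And>r' t'. (r', t') \<in> set L \<Longrightarrow> r \<subset> r' \<and> equiv A r'"
    using assms(1) reduced_chain_ConsD[OF assms(1)] unfolding reduced_chain_Cons by blast+
  have "(a, b) \<in> r \<longleftrightarrow> a \<in> A \<and> b \<in> A \<and>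
      (\<forall>C. chain_weight A ((r, t) # L) C \<noteq> 0 \<longrightarrow> a \<in> C \<longrightarrow> b \<in> C)" for a b
  proof
    assume ab: "(a, b) \<in> r"
    have "b \<in> C" if nz: "chain_weight A ((r, t) # L) C \<noteq> 0" and "a \<in> C" for C
    proof -
      obtain r' t' where r': "(r', t') \<in> set ((r, t) # L)" "C \<in> A // r'"
        using chain_weight_nonzeroD[OF nz] by blast
      then have "(r', t') = (r, t) \<or> (r', t') \<in> set L"
        by simp
      then have "r \<subseteq> r' \<and> equiv A r'"
      proof
        assume "(r', t') \<in> set L"
        from sub[OF this] show ?thesis
          by (simp add: psubset_imp_subset)
      qed (use r in simp)
      moreover from this r'(2) \<open>a \<in> C\<close> have "C = r' `` {a}"
        by (metis quotient_block_eq)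
      ultimately show ?thesis
        using ab by blast
    qed
    moreover have "a \<in> A" "b \<in> A"
      using ab r(1) by (auto simp: equiv_def)
    ultimately show "a \<in> A \<and> b \<in> A \<and> (\<forall>C. chain_weight A ((r, t) # L) C \<noteq> 0 \<longrightarrow> a \<in> C \<longrightarrow> b \<in> C)"
      by blast
  next
    assume "a \<in> A \<and> b \<in> A \<and>
      (\<forall>C. chain_weight A ((r, t) # L) C \<noteq> 0 \<longrightarrow> a \<in> C \<longrightarrow> b \<in> C)"
    then have a: "a \<in> A" and *: "\<forall>C. chain_weight A ((r, t) # L) C \<noteq> 0 \<longrightarrow> a \<in> C \<longrightarrow> b \<in> C"
      by auto
    have "0 < chain_weight A ((r, t) # L) (r `` {a})"
      using reduced_imp_weighted_chain[OF assms] r a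
      by (intro chain_weight_pos[of _ _ r t]) (auto intro: quotientI)
    moreover have "a \<in> r `` {a}"
      using r a equiv_class_self by metis
    ultimately show "(a, b) \<in> r"
      using * by (metis Image_singleton_iff less_irrefl)
  qed
  then show ?thesis
    by auto
qed

text \<open>The first coefficient is the minimum of the weight over the blocks of \<open>r\<close>.
  The minimum is attained at a block that occurs in no later partition, and such a block exists
  because the next partition is strictly coarser.\<close>

lemma reduced_chain_head_weight:
  assumes "A \<noteq> {}" "reduced_chain A ((r, t) # L)"
  shows "(\<forall>C\<in>A // r. t \<le> chain_weight A ((r, t) # L) C) \<and>
    (\<exists>C\<in>A // r. chain_weight A ((r, t) # L) C = t)"
proof
  have r: "equiv A r" "0 < t" and L: "reduced_chain A L"
    and sub: "\<And>r' t'. (r', t') \<in> set L \<Longrightarrow> r \<subset> r' \<and> equiv A r'"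
    using assms(2) reduced_chain_ConsD[OF assms(2)] unfolding reduced_chain_Cons by blast+
  show "\<forall>C\<in>A // r. t \<le> chain_weight A ((r, t) # L) C"
    using chain_weight_nonneg[OF reduced_imp_weighted_chain[OF L]] by simp
  \<comment> \<open>Take a pair related by the second partition but not by \<open>r\<close>. All
    later partitions contain the second one and so relate this pair too, which makes their classes
    of \<open>a\<close> differ from the class under \<open>r\<close>.\<close>
  obtain a where a: "a \<in> A" "\<And>r' t'. (r', t') \<in> set L \<Longrightarrow> r `` {a} \<noteq> r' `` {a}"
  proof (cases L)
    case Nil
    with \<open>A \<noteq> {}\<close> that show ?thesis
      by auto
  next
    case (Cons p M)
    obtain r1 t1 where p: "p = (r1, t1)"
      by fastforce
    obtain a b where ab: "(a, b) \<in> r1" "(a, b) \<notin> r"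
      using sub[of r1 t1] by (auto simp: Cons p)
    have "r1 \<subseteq> r'" if "(r', t') \<in> set L" for r' t'
      using L that by (auto simp: Cons p reduced_chain_Cons)
    with ab sub[of r1 t1] that show ?thesis
      by (fastforce simp: Cons p equiv_def)
  qed
  have "chain_weight A L (r `` {a}) = 0"
  proof (rule ccontr)
    assume "chain_weight A L (r `` {a}) \<noteq> 0"
    then obtain r' t' where r': "(r', t') \<in> set L" "r `` {a} \<in> A // r'"
      using chain_weight_nonzeroD by blast
    then have "r `` {a} = r' `` {a}"
      using sub r a equiv_class_self quotient_block_eq by metis
    with a r' show False
      by blast
  qed
  then show "\<exists>C\<in>A // r. chain_weight A ((r, t) # L) C = t"
    using a by (intro bexI[of _ "r `` {a}"]) (simp_all add: quotientI)
qed

lemma reduced_chain_unique: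
  assumes "A \<noteq> {}" "reduced_chain A L" "reduced_chain A L'" "chain_weight A L = chain_weight A L'"
  shows "L = L'"
  using assms(2-)
proof (induction L arbitrary: L')
  \<comment> \<open>This separates the empty chain, whose weight is zero, from all others.\<close>
  have nz: "\<exists>C. chain_weight A (p # M) C \<noteq> 0" if "reduced_chain A (p # M)" for p M
  proof -
    obtain r t where p: "p = (r, t)"
      by fastforce
    then show ?thesis
      using reduced_chain_head_weight[OF \<open>A \<noteq> {}\<close> that[unfolded p]] that
      by (metis less_irrefl reduced_chain_Cons)
  qed
  {
    case Nil
    then show ?case
      using nz[of "hd L'" "tl L'"] by (cases L') (auto simp: fun_eq_iff)
  next
    case (Cons p M)
    obtain r t where p: "p = (r, t)"
      by fastforce
    obtain p' M' where L': "L' = p' # M'"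
      using nz[OF Cons.prems(1)] Cons.prems(3) by (cases L') (auto simp: fun_eq_iff)
    obtain r' t' where p': "p' = (r', t')"
      by fastforce
    note red = Cons.prems(1)[unfolded p] Cons.prems(2)[unfolded L' p']
    have eq: "chain_weight A ((r, t) # M) = chain_weight A ((r', t') # M')"
      using Cons.prems(3) by (simp only: p L' p')
    have r: "r = r'"
      using reduced_chain_head[OF red(1)] reduced_chain_head[OF red(2)] eq by simp
    have t: "t = t'"
      using reduced_chain_head_weight[OF \<open>A \<noteq> {}\<close> red(1)]
        reduced_chain_head_weight[OF \<open>A \<noteq> {}\<close> red(2)] eq r by (metis order_antisym)
    have "chain_weight A M C = chain_weight A M' C" for C
      using fun_cong[OF eq, of C] by (simp add: r t)
    then have "M = M'"
      using Cons.IH[of M'] red by (auto simp: reduced_chain_Cons)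
    then show ?case
      by (simp add: p p' L' r t)
  }
qed

section \<open>The partition poset complex\<close>

definition partition_sset :: "'a set \<Rightarrow> 'a rel list option sset" where
  "partition_sset A = sset_quotient (nerve (partitions A))
     (\<lambda>n. simplices (nerve (partitions A - {Id_on A})) n
        \<union> simplices (nerve (partitions A - {A \<times> A})) n)"

text \<open>These are the simplices that survive the quotient: a chain lacking the least or the
  greatest partition lies in one of the two collapsed nerves.\<close>

definition full_chain :: "'a set \<Rightarrow> 'a rel list \<Rightarrow> bool" where
  "full_chain A xs \<longleftrightarrow> set xs \<subseteq> partitions A \<and> sorted_wrt (\<subseteq>) xs \<and> Id_on A \<in> set xs \<and> A \<times> A \<in> set xs"

definition pull :: "nat \<Rightarrow> (nat \<Rightarrow> nat) \<Rightarrow> 'b list \<Rightarrow> 'b list" where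
  "pull m \<theta> xs = map (\<lambda>i. xs ! \<theta> i) [0..<Suc m]"

lemma length_pull [simp]: "length (pull m \<theta> xs) = Suc m"
  by (simp add: pull_def)

lemma nth_pull [simp]: "i \<le> m \<Longrightarrow> pull m \<theta> xs ! i = xs ! \<theta> i"
  by (simp add: pull_def del: upt_Suc)

lemma set_pull: "set (pull m \<theta> xs) = (\<lambda>i. xs ! \<theta> i) ` {..m}"
  by (auto simp: pull_def simp del: upt_Suc)

lemma simplices_partition_sset:
  "simplices (partition_sset A) n = insert None (Some ` {xs. length xs = Suc n \<and> full_chain A xs})"
  by (auto simp: partition_sset_def sset_quotient_def nerve_def full_chain_def)

lemma action_partition_sset:
  "action (partition_sset A) m \<theta> None = None"
  "set (pull m \<theta> xs) \<subseteq> partitions A \<Longrightarrow> sorted_wrt (\<subseteq>) (pull m \<theta> xs) \<Longrightarrow>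
    action (partition_sset A) m \<theta> (Some xs) =
      (if full_chain A (pull m \<theta> xs) then Some (pull m \<theta> xs) else None)"
  by (auto simp: partition_sset_def sset_quotient_def nerve_def full_chain_def collapse_map_def
      collapse_proj_def simp flip: pull_def simp del: upt_Suc)

lemma simplex_push_in_standard_simplex:
  assumes "t \<in> standard_simplex m" "\<theta> ` {..m} \<subseteq> {..n}"
  shows "simplex_push m \<theta> t \<in> standard_simplex n"
proof -
  have t: "0 \<le> t i" "sum t {..m} = 1" for i
    using assms by (auto simp: standard_simplex_def)
  have eq: "{i. i \<le> m \<and> \<theta> i = j} = {i \<in> {..m}. \<theta> i = j}" for j
    by auto
  have nonneg: "0 \<le> simplex_push m \<theta> t j" for j
    using t by (simp add: simplex_push_def sum_nonneg)
  moreover have "simplex_push m \<theta> t j \<le> 1" for j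
    unfolding simplex_push_def t(2)[symmetric] eq using t by (intro sum_mono2) auto
  moreover have "simplex_push m \<theta> t j = 0" if "j > n" for j
    unfolding simplex_push_def eq using that assms(2) by (intro sum.neutral) auto
  moreover have "sum (simplex_push m \<theta> t) {..n} = 1"
    unfolding simplex_push_def eq using assms(2) t(2) by (subst sum.group) auto
  ultimately show ?thesis
    by (simp add: standard_simplex_def)
qed

lemma standard_simplex_0_eq:
  "t \<in> standard_simplex 0 \<Longrightarrow> t = (\<lambda>j. if j = 0 then 1 else 0)"
  by (auto simp: standard_simplex_0)

definition weighted_list :: "'b list \<Rightarrow> (nat \<Rightarrow> real) \<Rightarrow> ('b \<times> real) list" where
  "weighted_list xs t = map (\<lambda>i. (xs ! i, t i)) [0..<length xs]"

lemma map_fst_weighted_list [simp]: "map fst (weighted_list xs t) = xs"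
  by (simp add: weighted_list_def o_def map_nth)

lemma length_weighted_list [simp]: "length (weighted_list xs t) = length xs"
  by (simp add: weighted_list_def)

lemma set_weighted_list: "set (weighted_list xs t) = (\<lambda>i. (xs ! i, t i)) ` {..<length xs}"
  by (auto simp: weighted_list_def)

lemma nth_weighted_list [simp]: "i < length xs \<Longrightarrow> weighted_list xs t ! i = (xs ! i, t i)"
  by (simp add: weighted_list_def)

lemma chain_weight_weighted_list:
  "chain_weight A (weighted_list xs t) C = (\<Sum>i<length xs. if C \<in> A // (xs ! i) then t i else 0)"
  by (simp add: chain_weight_def weighted_list_def o_def interv_sum_list_conv_sum_set_nat atLeast0LessThan)

text \<open>The compatibility behind the gluing: pushing coordinates forward along
  \<open>\<theta>\<close> and pulling partitions back along \<open>\<theta>\<close> both attach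
  \<open>t i\<close> to the blocks of \<open>xs ! \<theta> i\<close>. Only the order of summation
  differs.\<close>

lemma chain_weight_push:
  assumes "\<theta> ` {..m} \<subseteq> {..n}" "length xs = Suc n"
  shows "chain_weight A (weighted_list xs (simplex_push m \<theta> t)) =
    chain_weight A (weighted_list (pull m \<theta> xs) t)"
proof
  fix C
  let ?f = "\<lambda>i. if C \<in> A // (xs ! \<theta> i) then t i else 0"
  have "chain_weight A (weighted_list xs (simplex_push m \<theta> t)) C =
      (\<Sum>j\<le>n. \<Sum>i | i \<in> {..m} \<and> \<theta> i = j. ?f i)"
    using assms(2) by (auto simp: chain_weight_weighted_list simplex_push_def lessThan_Suc_atMost
        intro!: sum.cong)
  also have "\<dots> = (\<Sum>i\<le>m. ?f i)"
    using assms(1) by (intro sum.group) auto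
  also have "\<dots> = chain_weight A (weighted_list (pull m \<theta> xs) t) C"
    by (simp add: chain_weight_weighted_list lessThan_Suc_atMost)
  finally show "chain_weight A (weighted_list xs (simplex_push m \<theta> t)) C =
      chain_weight A (weighted_list (pull m \<theta> xs) t) C" .
qed

lemma weighted_chain_weighted_list:
  assumes "set xs \<subseteq> partitions A" "sorted_wrt (\<subseteq>) xs" "t \<in> standard_simplex n"
  shows "weighted_chain A (weighted_list xs t)"
  using assms by (force simp: weighted_chain_def set_weighted_list partitions_def standard_simplex_def)

lemma sum_list_weighted_list:
  assumes "length xs = Suc n" "t \<in> standard_simplex n"
  shows "sum_list (map snd (weighted_list xs t)) = 1"
proof -
  have "sum_list (map snd (weighted_list xs t)) = sum t {..<length xs}"
    by (simp add: weighted_list_def o_def interv_sum_list_conv_sum_set_nat atLeast0LessThan)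
  with assms show ?thesis
    by (simp add: lessThan_Suc_atMost standard_simplex_def del: sum.lessThan_Suc)
qed

text \<open>A nonzero value at \<open>A\<close> needs a partition with \<open>A\<close> as a block,
  hence the greatest one. Nonzero values at all singletons force the first, finest entry to relate
  no two distinct points. Read contrapositively: a chain that falls into the collapsed part has
  density 0.\<close>

lemma full_chain_if_density_nonzero:
  assumes "A \<noteq> {}" "finite A" "set xs \<subseteq> partitions A" "sorted_wrt (\<subseteq>) xs"
    and "density A (chain_weight A (weighted_list xs t)) \<noteq> 0"
  shows "full_chain A xs"
proof -
  let ?W = "chain_weight A (weighted_list xs t)"
  have block: "\<exists>r\<in>set xs. equiv A r \<and> C \<in> A // r" if "?W C \<noteq> 0" for C
    using chain_weight_nonzeroD[OF that] assms(3) by (force simp: set_weighted_list partitions_def)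
  have nz: "?W A \<noteq> 0" "\<And>a. a \<in> A \<Longrightarrow> ?W {a} \<noteq> 0"
    using assms(2,5) by (auto simp: density_def)
  obtain r where r: "r \<in> set xs" "equiv A r" "A \<in> A // r"
    using block[OF nz(1)] by blast
  have "A = r `` {a}" if "a \<in> A" for a
    using quotient_block_eq[OF r(2,3) that] .
  then have "r = A \<times> A"
    using r(2) by (auto simp: equiv_def)
  moreover obtain x where x: "x \<in> set xs" "\<And>r. r \<in> set xs \<Longrightarrow> x \<subseteq> r"
    using r(1) assms(4) by (cases xs) auto
  \<comment> \<open>Different points may have their singleton blocks in different partitions of the
    chain, but \<open>x\<close> refines all of these.\<close>
  have "x = Id_on A"
  proof (rule Set.set_eqI)
    fix p
    have "equiv A x"
      using x assms(3) by (auto simp: partitions_def)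
    moreover have "b = a" if "(a, b) \<in> x" "a \<in> A" for a b
    proof -
      obtain r where r: "r \<in> set xs" "equiv A r" "{a} \<in> A // r"
        using block nz(2) \<open>a \<in> A\<close> by blast
      then have "{a} = r `` {a}"
        by (intro quotient_block_eq) auto
      with x(2)[OF r(1)] that show ?thesis
        by blast
    qed
    ultimately show "p \<in> x \<longleftrightarrow> p \<in> Id_on A"
      by (cases p) (auto simp: equiv_def refl_on_def)
  qed
  ultimately show ?thesis
    using assms(3,4) r(1) x(1) by (simp add: full_chain_def)
qed

definition simplex_map ::
    "'a set \<Rightarrow> nat \<times> 'a rel list option \<times> (nat \<Rightarrow> real) \<Rightarrow> 'a set \<Rightarrow> real" where
  "simplex_map A = (\<lambda>(n, s, t).
     case s of None \<Rightarrow> \<lambda>_. 0 | Some xs \<Rightarrow> scaled A (chain_weight A (weighted_list xs t)))"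

lemma simplex_map_simps [simp]:
  "simplex_map A (n, None, t) = (\<lambda>_. 0)"
  "simplex_map A (n, Some xs, t) = scaled A (chain_weight A (weighted_list xs t))"
  by (simp_all add: simplex_map_def)

lemma topspace_simplex_sum:
  "topspace (simplex_sum X) = (SIGMA n:UNIV. simplices X n \<times> standard_simplex n)"
  by (simp add: simplex_sum_def o_def)

lemma mem_simplex_sum_partition_sset:
  "(n, s, t) \<in> topspace (simplex_sum (partition_sset A)) \<longleftrightarrow>
    (case s of None \<Rightarrow> True | Some xs \<Rightarrow> length xs = Suc n \<and> full_chain A xs) \<and> t \<in> standard_simplex n"
  by (cases s) (auto simp: topspace_simplex_sum simplices_partition_sset)

lemma sorted_pull:
  assumes "simplex_op m n \<theta>" "sorted_wrt (\<subseteq>) xs" "length xs = Suc n"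
  shows "sorted_wrt (\<subseteq>) (pull m \<theta> xs)"
  unfolding sorted_wrt_iff_nth_less
proof (intro allI impI)
  fix i j assume ij: "i < j" "j < length (pull m \<theta> xs)"
  then have "\<theta> i \<le> \<theta> j" "\<theta> j \<le> n"
    using assms(1) by (auto simp: simplex_op_def mono_on_def image_subset_iff)
  then have "xs ! \<theta> i \<subseteq> xs ! \<theta> j"
    using assms(2,3) sorted_wrt_nth_less[of "(\<subseteq>)" xs "\<theta> i" "\<theta> j"]
    by (cases "\<theta> i = \<theta> j") auto
  with ij show "pull m \<theta> xs ! i \<subseteq> pull m \<theta> xs ! j"
    by simp
qed

lemma set_pull_subset:
  assumes "simplex_op m n \<theta>" "length xs = Suc n"
  shows "set (pull m \<theta> xs) \<subseteq> set xs"
  using assms by (force simp: set_pull simplex_op_def intro!: nth_mem)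

text \<open>If the pulled-back chain stays full, both ends of the pair carry the same weight. If it
  loses an extreme partition, one end is the basepoint and the other has density 0.\<close>

lemma simplex_map_invariant:
  assumes "finite A" "A \<noteq> {}" "(x, y) \<in> realization_rel (partition_sset A)"
  shows "simplex_map A x = simplex_map A y"
proof -
  obtain m n \<theta> s t where x: "x = (m, action (partition_sset A) m \<theta> s, t)"
    and y: "y = (n, s, simplex_push m \<theta> t)" and \<theta>: "simplex_op m n \<theta>"
    and s: "s \<in> simplices (partition_sset A) n"
    using assms(3) unfolding realization_rel_def by blast
  show ?thesis
  proof (cases s)
    case None
    then show ?thesis
      by (simp add: x y action_partition_sset)
  next
    case (Some xs)
    with s have xs: "length xs = Suc n" "full_chain A xs"
      by (auto simp: simplices_partition_sset)
    have pull: "set (pull m \<theta> xs) \<subseteq> partitions A" "sorted_wrt (\<subseteq>) (pull m \<theta> xs)"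
      using xs \<theta> sorted_pull set_pull_subset unfolding full_chain_def by blast+
    have "\<theta> ` {..m} \<subseteq> {..n}"
      using \<theta> by (simp add: simplex_op_def)
    then have eq: "chain_weight A (weighted_list xs (simplex_push m \<theta> t)) =
        chain_weight A (weighted_list (pull m \<theta> xs) t)"
      using xs by (intro chain_weight_push)
    show ?thesis
    proof (cases "full_chain A (pull m \<theta> xs)")
      case True
      then show ?thesis
        by (simp add: x y Some action_partition_sset pull eq)
    next
      case False
      then have "density A (chain_weight A (weighted_list (pull m \<theta> xs) t)) = 0"
        using full_chain_if_density_nonzero[OF assms(2,1) pull] by blast
      then have "scaled A (chain_weight A (weighted_list (pull m \<theta> xs) t)) = (\<lambda>_. 0)"
        by (simp only: scaled_eq_0_iff)
      with False show ?thesis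
        by (simp add: x y Some action_partition_sset pull eq)
    qed
  qed
qed

lemma chain_weight_weighted_list_in_set_weights:
  assumes "finite A" "length xs = Suc n" "full_chain A xs" "t \<in> standard_simplex n"
  shows "chain_weight A (weighted_list xs t) \<in> set_weights A 1"
  using assms by (intro chain_weight_in_set_weights weighted_chain_weighted_list sum_list_weighted_list)
    (auto simp: full_chain_def)

lemma continuous_map_simplex_map:
  assumes "finite A"
  shows "continuous_map (simplex_sum (partition_sset A)) (weight_model A) (simplex_map A)"
  unfolding simplex_sum_def continuous_map_sum_topology
proof (intro ballI continuous_map_prod_discrete)
  fix n s assume s: "s \<in> simplices (partition_sset A) n"
  show "continuous_map (subtopology (powertop_real UNIV) (standard_simplex n)) (weight_model A)
      (\<lambda>t. simplex_map A (n, s, t))"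
  proof (cases s)
    case None
    then show ?thesis
      by simp
  next
    case (Some xs)
    with s have xs: "length xs = Suc n" "full_chain A xs"
      by (auto simp: simplices_partition_sset)
    have "continuous_map (subtopology (powertop_real UNIV) (standard_simplex n)) euclideanreal
        (\<lambda>t. if P then t i else 0)" for P i
      by (cases P) (auto intro!: continuous_map_from_subtopology continuous_map_product_projection)
    then have "continuous_map (subtopology (powertop_real UNIV) (standard_simplex n)) euclideanreal
        (\<lambda>t. chain_weight A (weighted_list xs t) C)" for C
      unfolding chain_weight_weighted_list by (intro continuous_map_sum) auto
    then show ?thesis
      unfolding Some simplex_map_simps
      by (intro continuous_map_scaled) (auto simp: assms chain_weight_weighted_list_in_set_weights xs)
  qed
qed

text \<open>The dimension is one less than the number of partitions, and the coordinates are
  continued by 0 because points of \<open>standard_simplex\<close> vanish beyond its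
  dimension.\<close>

definition chain_point :: "('a rel \<times> real) list \<Rightarrow> nat \<times> 'a rel list option \<times> (nat \<Rightarrow> real)" where
  "chain_point L = (length L - 1, Some (map fst L), \<lambda>i. if i < length L then snd (L ! i) else 0)"

lemma simplex_map_chain_point: "simplex_map A (chain_point L) = scaled A (chain_weight A L)"
proof -
  have "weighted_list (map fst L) (\<lambda>i. if i < length L then snd (L ! i) else 0) = L"
    by (rule nth_equalityI) (simp_all add: weighted_list_def)
  then show ?thesis
    by (simp add: chain_point_def)
qed

lemma chain_point_in_simplex_sum:
  assumes "reduced_chain A L" "sum_list (map snd L) = 1" "full_chain A (map fst L)"
  shows "chain_point L \<in> topspace (simplex_sum (partition_sset A))"
proof -
  let ?t = "\<lambda>i. if i < length L then snd (L ! i) else 0"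
  have L: "length L = Suc (length L - 1)"
    using assms(2) by (cases L) auto
  have nonneg: "0 \<le> ?t i" for i
    using assms(1) nth_mem[of i L] by (fastforce simp: reduced_chain_def)
  have "{..length L - 1} = {..<length L}"
    using L by (metis lessThan_Suc_atMost)
  then have "sum ?t {..length L - 1} = (\<Sum>i<length L. snd (L ! i))"
    by simp
  also have "\<dots> = 1"
    using assms(2) by (simp add: sum_list_sum_nth atLeast0LessThan)
  finally have sum: "sum ?t {..length L - 1} = 1" .
  have "?t i \<le> 1" for i
  proof (cases "i < length L")
    case True
    then have "?t i \<le> sum ?t {..length L - 1}"
      using nonneg by (intro member_le_sum) auto
    with sum show ?thesis
      by simp
  qed auto
  with sum nonneg L have "?t \<in> standard_simplex (length L - 1)"
    unfolding standard_simplex_def by auto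
  with assms(3) L show ?thesis
    by (simp add: chain_point_def mem_simplex_sum_partition_sset)
qed

lemma full_chain_reduced:
  assumes "finite A" "A \<noteq> {}" "reduced_chain A L" "density A (chain_weight A L) \<noteq> 0"
  shows "full_chain A (map fst L)"
proof -
  have L: "weighted_chain A L"
    using assms reduced_imp_weighted_chain by blast
  have "L = weighted_list (map fst L) (\<lambda>i. snd (L ! i))"
    by (rule nth_equalityI) (simp_all add: weighted_list_def)
  then have "density A (chain_weight A (weighted_list (map fst L) (\<lambda>i. snd (L ! i)))) \<noteq> 0"
    using assms(4) by simp
  moreover have "set (map fst L) \<subseteq> partitions A"
    using L by (auto simp: weighted_chain_def partitions_def)
  moreover have "sorted_wrt (\<subseteq>) (map fst L)"
    using L by (simp add: weighted_chain_def)
  ultimately show ?thesis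
    by (intro full_chain_if_density_nonzero[OF assms(2,1)])
qed

text \<open>The bound \<open>card (Pow A)\<close> comes from the decomposition: the reduced chain of
  a weight has at most as many members as the weight has supporting sets, all of which are subsets
  of \<open>A\<close>.\<close>

lemma simplex_map_onto:
  assumes "finite A" "A \<noteq> {}"
  shows "topspace (weight_model A) \<subseteq>
    simplex_map A ` (SIGMA n:{..card (Pow A)}. simplices (partition_sset A) n \<times> standard_simplex n)"
    (is "_ \<subseteq> _ ` ?K")
proof
  \<comment> \<open>The basepoint at the only point of the 0-simplex, which is reached even if no
    weight has density 0.\<close>
  let ?p0 = "(0, None, \<lambda>j. if j = 0 then 1 else 0) :: nat \<times> 'a rel list option \<times> (nat \<Rightarrow> real)"
  have p0: "?p0 \<in> ?K"
    by (auto simp: simplices_partition_sset)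
  have zero: "(\<lambda>_. 0) \<in> simplex_map A ` ?K"
    by (rule rev_image_eqI[OF p0]) simp
  fix y assume "y \<in> topspace (weight_model A)"
  then consider "y = (\<lambda>_. 0)" | W where "W \<in> set_weights A 1" "y = scaled A W"
    by auto
  then show "y \<in> simplex_map A ` ?K"
  proof cases
    case 2
    show ?thesis
    proof (cases "density A W = 0")
      case True
      with zero show ?thesis
        by (simp add: 2 scaled_eq_0_iff[symmetric])
    next
      case False
      obtain L where L: "reduced_chain A L" "chain_weight A L = W" "sum_list (map snd L) = 1"
        "length L \<le> card {C. W C \<noteq> 0}"
        using set_weights_decompose[OF assms 2(1)] by blast
      have "card {C. W C \<noteq> 0} \<le> card (Pow A)"
        using 2(1) assms(1) by (intro card_mono) (auto simp: set_weights_def)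
      moreover have "chain_point L \<in> topspace (simplex_sum (partition_sset A))"
        using L False assms by (intro chain_point_in_simplex_sum full_chain_reduced) auto
      ultimately have "chain_point L \<in> ?K"
        using L(4) unfolding topspace_simplex_sum by (auto simp: chain_point_def)
      moreover have "y = simplex_map A (chain_point L)"
        by (simp add: simplex_map_chain_point L(2) 2)
      ultimately show ?thesis
        by (simp only: imageI)
    qed
  qed (use zero in simp)
qed

text \<open>Degenerate simplices occur in every dimension, so only a truncation of the sum is
  compact. Each dimension has finitely many simplices since \<open>A\<close> has finitely many
  partitions.\<close>

lemma compactin_simplex_sum:
  assumes "finite A"
  shows "compactin (simplex_sum (partition_sset A))
    (SIGMA n:{..N}. simplices (partition_sset A) n \<times> standard_simplex n)"
proof -
  have "partitions A \<subseteq> Pow (A \<times> A)"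
    unfolding partitions_def equiv_def by blast
  then have "finite (partitions A)"
    by (rule finite_subset) (use assms in simp)
  then have "finite {xs. set xs \<subseteq> partitions A \<and> length xs = Suc n}" for n
    by (rule finite_lists_length_eq)
  then have "finite (simplices (partition_sset A) n)" for n
    unfolding simplices_partition_sset
    by (auto simp: full_chain_def intro: finite_subset[rotated])
  then have "compact_space (prod_topology (discrete_topology (simplices (partition_sset A) n))
      (subtopology (powertop_real UNIV) (standard_simplex n)))" for n
    by (simp add: compact_space_prod_topology compact_space_discrete_topology
        compact_space_subtopology compactin_standard_simplex)
  from compactin_sum_topology[of "{..N}" UNIV, OF _ _ this] show ?thesis
    by (simp add: simplex_sum_def o_def)
qed

section \<open>Normal forms of points of the realization\<close>

lemma realization_relI:
  assumes "simplex_op m n \<theta>" "s \<in> simplices X n" "t \<in> standard_simplex m"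
  shows "((m, action X m \<theta> s, t), (n, s, simplex_push m \<theta> t)) \<in> realization_rel X"
  using assms unfolding realization_rel_def by blast

lemma base_simplices_equivalent:
  assumes "t \<in> standard_simplex n"
  shows "((n, None, t), (0, None, \<lambda>j. if j = 0 then 1 else 0)) \<in>
    sym_closure (realization_rel (partition_sset A))"
proof -
  have "simplex_op n 0 (\<lambda>_. 0)"
    by (auto simp: simplex_op_def mono_on_def)
  moreover have "None \<in> simplices (partition_sset A) 0"
    by (simp add: simplices_partition_sset)
  ultimately have "((n, None, t), (0, None, simplex_push n (\<lambda>_. 0) t)) \<in> realization_rel (partition_sset A)"
    using realization_relI[of n 0 "\<lambda>_. 0" None "partition_sset A" t] assms
    by (simp add: action_partition_sset)
  moreover have "simplex_push n (\<lambda>_. 0) t = (\<lambda>j. if j = 0 then 1 else 0)"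
    using assms by (intro standard_simplex_0_eq simplex_push_in_standard_simplex) auto
  ultimately show ?thesis
    by auto
qed

text \<open>Here \<open>\<theta>\<close> is the coface map that omits \<open>i\<close>: a point with
  vanishing coordinate \<open>i\<close> lies on the corresponding face.\<close>

lemma drop_zero_coordinate:
  assumes "t \<in> standard_simplex (Suc n)" "i \<le> Suc n" "t i = 0"
  defines "\<theta> \<equiv> \<lambda>j. if j < i then j else Suc j"
  shows "t \<circ> \<theta> \<in> standard_simplex n" "simplex_push n \<theta> (t \<circ> \<theta>) = t"
proof -
  have t: "0 \<le> t j" "t j \<le> 1" "j > Suc n \<Longrightarrow> t j = 0" "sum t {..Suc n} = 1" for j
    using assms(1) by (auto simp: standard_simplex_def)
  have inj: "inj_on \<theta> {..n}"
    by (auto simp: \<theta>_def inj_on_def)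
  have "j \<in> \<theta> ` {..n}" if "j \<noteq> i" "j \<le> Suc n" for j
    using that assms(2) by (intro image_eqI[of _ _ "if j < i then j else j - 1"]) (auto simp: \<theta>_def)
  then have range: "\<theta> ` {..n} = {..Suc n} - {i}"
    by (auto simp: \<theta>_def split: if_splits)
  have "sum (t \<circ> \<theta>) {..n} = sum t ({..Suc n} - {i})"
    using sum.reindex[OF inj, of t] range by simp
  also have "\<dots> = 1"
    using assms(2,3) t(4) by (subst sum_diff1) auto
  finally have sum: "sum (t \<circ> \<theta>) {..n} = 1" .
  have "j > n \<Longrightarrow> \<theta> j > Suc n" for j
    using assms(2) by (auto simp: \<theta>_def)
  with sum show "t \<circ> \<theta> \<in> standard_simplex n"
    using t by (auto simp: standard_simplex_def)
  show "simplex_push n \<theta> (t \<circ> \<theta>) = t"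
  proof
    fix j
    show "simplex_push n \<theta> (t \<circ> \<theta>) j = t j"
    proof (cases "j \<in> \<theta> ` {..n}")
      case True
      then obtain k where k: "k \<le> n" "j = \<theta> k"
        by auto
      then have "{k'. k' \<le> n \<and> \<theta> k' = j} = {k}"
        using inj by (auto simp: inj_on_def)
      then show ?thesis
        by (simp add: simplex_push_def k)
    next
      case False
      then have "{k'. k' \<le> n \<and> \<theta> k' = j} = {}"
        by auto
      moreover have "t j = 0"
        using False range t(3) assms(3) by (cases "j = i") auto
      ultimately show ?thesis
        by (simp add: simplex_push_def)
    qed
  qed
qed

text \<open>Induction on the dimension. A zero coordinate moves the point to a face, a repeated
  partition moves it down a degeneracy, and if neither occurs the chain is already reduced. Passing
  to a face can drop an extreme partition; the point is then the basepoint, which accounts for the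
  first alternative.\<close>

lemma simplex_reduces:
  assumes "finite A" "A \<noteq> {}" "(n, s, t) \<in> topspace (simplex_sum (partition_sset A))"
  shows "((n, s, t), (0, None, \<lambda>j. if j = 0 then 1 else 0)) \<in> sym_closure (realization_rel (partition_sset A)) \<or>
    (\<exists>L. reduced_chain A L \<and> sum_list (map snd L) = 1 \<and> full_chain A (map fst L) \<and>
      ((n, s, t), chain_point L) \<in> sym_closure (realization_rel (partition_sset A)))"
    (is "?P n s t")
  using assms(3)
proof (induction n arbitrary: s t)
  have reduced: "?P n (Some xs) t"
    if xs: "length xs = Suc n" "full_chain A xs" and t: "t \<in> standard_simplex n"
      and pos: "\<And>i. i \<le> n \<Longrightarrow> t i \<noteq> 0" and strict: "\<And>i. i < n \<Longrightarrow> xs ! i \<noteq> xs ! Suc i" for n xs t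
  proof -
    let ?L = "weighted_list xs t"
    have sorted: "sorted_wrt (\<subseteq>) xs" "set xs \<subseteq> partitions A"
      using xs(2) by (auto simp: full_chain_def)
    have "xs ! i \<subset> xs ! j" if "i < j" "j < length xs" for i j
    proof -
      have "xs ! i \<subseteq> xs ! Suc i" "xs ! Suc i \<subseteq> xs ! j"
        using sorted_wrt_nth_less[OF sorted(1), of i "Suc i"] sorted_wrt_nth_less[OF sorted(1), of "Suc i" j] that
        by (cases "Suc i = j"; simp)+
      with strict[of i] that xs(1) show ?thesis
        by auto
    qed
    then have "sorted_wrt (\<subset>) xs"
      by (simp add: sorted_wrt_iff_nth_less)
    moreover have "\<forall>(r, u)\<in>set ?L. equiv A r \<and> 0 < u"
    proof
      fix p assume "p \<in> set ?L"
      then obtain i where i: "i \<le> n" "p = (xs ! i, t i)"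
        unfolding set_weighted_list xs(1) lessThan_Suc_atMost by blast
      moreover have "0 \<le> t i"
        using t by (simp add: standard_simplex_def)
      moreover have "xs ! i \<in> partitions A"
        using i(1) xs(1) sorted(2) nth_mem[of i xs] by auto
      ultimately show "case p of (r, u) \<Rightarrow> equiv A r \<and> 0 < u"
        using pos[of i] by (simp add: partitions_def)
    qed
    ultimately have "reduced_chain A ?L"
      by (simp add: reduced_chain_def)
    moreover have "chain_point ?L = (n, Some xs, t)"
      using xs(1) t by (auto simp: chain_point_def fun_eq_iff standard_simplex_def)
    ultimately show ?thesis
      using sum_list_weighted_list[OF xs(1) t] xs(2) by (intro disjI2 exI[of _ ?L]) simp
  qed
  {
    case (0 s t)
    then have t: "t \<in> standard_simplex 0"
      by (simp add: mem_simplex_sum_partition_sset)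
    show ?case
    proof (cases s)
      case None
      with t show ?thesis
        using base_simplices_equivalent by blast
    next
      case (Some xs)
      with 0 t show ?thesis
        using standard_simplex_0_eq[OF t] reduced[of xs 0 t] by (simp add: mem_simplex_sum_partition_sset)
    qed
  next
    case (Suc n s t)
    let ?X = "partition_sset A"
    have t: "t \<in> standard_simplex (Suc n)"
      using Suc.prems by (simp add: mem_simplex_sum_partition_sset)
    have step: "?P (Suc n) s t"
      if "((Suc n, s, t), (n, s', t')) \<in> sym_closure (realization_rel ?X)"
        "(n, s', t') \<in> topspace (simplex_sum ?X)" for s' t'
      using Suc.IH[OF that(2)] rtrancl_trans[OF that(1)] by blast
    show ?case
    proof (cases s)
      case None
      with t show ?thesis
        using base_simplices_equivalent by blast
    next
      case (Some xs)
      have xs: "length xs = Suc (Suc n)" "full_chain A xs"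
        using Suc.prems by (auto simp: Some mem_simplex_sum_partition_sset)
      consider (zero) i where "i \<le> Suc n" "t i = 0" | (double) i where "i < Suc n" "xs ! i = xs ! Suc i"
        | (red) "\<And>i. i \<le> Suc n \<Longrightarrow> t i \<noteq> 0" "\<And>i. i < Suc n \<Longrightarrow> xs ! i \<noteq> xs ! Suc i"
        by blast
      then show ?thesis
      proof cases
        case zero
        define \<theta> where "\<theta> = (\<lambda>j. if j < i then j else Suc j)"
        have t': "t \<circ> \<theta> \<in> standard_simplex n" "simplex_push n \<theta> (t \<circ> \<theta>) = t"
          using drop_zero_coordinate[OF t zero] by (simp_all add: \<theta>_def)
        have \<theta>: "simplex_op n (Suc n) \<theta>"
          by (auto simp: simplex_op_def mono_on_def \<theta>_def)
        have s: "s \<in> simplices ?X (Suc n)"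
          using xs by (simp add: Some simplices_partition_sset)
        have "((n, action ?X n \<theta> s, t \<circ> \<theta>), (Suc n, s, t)) \<in> realization_rel ?X"
          using realization_relI[OF \<theta> s t'(1)] by (simp add: t'(2))
        then have "((Suc n, s, t), (n, action ?X n \<theta> s, t \<circ> \<theta>)) \<in> sym_closure (realization_rel ?X)"
          by auto
        moreover have "set (pull n \<theta> xs) \<subseteq> partitions A" "sorted_wrt (\<subseteq>) (pull n \<theta> xs)"
          using xs \<theta> sorted_pull set_pull_subset unfolding full_chain_def by blast+
        then have "(n, action ?X n \<theta> s, t \<circ> \<theta>) \<in> topspace (simplex_sum ?X)"
          by (simp add: Some mem_simplex_sum_partition_sset action_partition_sset t')
        ultimately show ?thesis
          by (rule step)
      next
        case double
        \<comment> \<open>\<open>\<sigma>\<close> is the degeneracy that identifies \<open>i\<close>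
          with \<open>Suc i\<close>, and \<open>\<theta>\<close> is its section that skips
          \<open>Suc i\<close>.\<close>
        define \<sigma> where "\<sigma> = (\<lambda>j. if j \<le> i then j else j - 1)"
        define \<theta> where "\<theta> = (\<lambda>j. if j \<le> i then j else Suc j)"
        let ?ys = "pull n \<theta> xs"
        have \<sigma>: "simplex_op (Suc n) n \<sigma>" and \<theta>: "simplex_op n (Suc n) \<theta>"
          using double(1) by (auto simp: simplex_op_def mono_on_def \<sigma>_def \<theta>_def)
        \<comment> \<open>The composite moves only the index \<open>Suc i\<close>, and it moves it
          to \<open>i\<close>, where the chain has the same entry.\<close>
        have "xs ! \<theta> (\<sigma> j) = xs ! j" for j
        proof (cases "j = Suc i")
          case True
          then show ?thesis
            using double(2) by (simp add: \<sigma>_def \<theta>_def)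
        qed (auto simp: \<sigma>_def \<theta>_def)
        moreover have "\<sigma> j \<le> n" if "j \<le> Suc n" for j
          using that double(1) by (auto simp: \<sigma>_def)
        ultimately have pull: "pull (Suc n) \<sigma> ?ys = xs"
          using xs(1) by (intro nth_equalityI) auto
        have ys: "set ?ys \<subseteq> partitions A" "sorted_wrt (\<subseteq>) ?ys"
          using xs \<theta> sorted_pull set_pull_subset unfolding full_chain_def by blast+
        \<comment> \<open>Only a repetition is removed, so both extreme partitions are still present
          and the smaller simplex is not the basepoint.\<close>
        have "set xs \<subseteq> set ?ys"
          using set_pull_subset[OF \<sigma>, of ?ys] pull by simp
        with ys xs(2) have full: "full_chain A ?ys"
          by (auto simp: full_chain_def)
        then have s': "Some ?ys \<in> simplices ?X n"
          by (simp add: simplices_partition_sset)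
        have "action ?X (Suc n) \<sigma> (Some ?ys) = s"
          using xs(2) by (subst action_partition_sset) (auto simp: pull Some full_chain_def)
        then have "((Suc n, s, t), (n, Some ?ys, simplex_push (Suc n) \<sigma> t)) \<in> realization_rel ?X"
          using realization_relI[OF \<sigma> s' t] by simp
        then have "((Suc n, s, t), (n, Some ?ys, simplex_push (Suc n) \<sigma> t)) \<in> sym_closure (realization_rel ?X)"
          by auto
        moreover have "simplex_push (Suc n) \<sigma> t \<in> standard_simplex n"
          using t \<sigma> by (intro simplex_push_in_standard_simplex) (auto simp: simplex_op_def)
        then have "(n, Some ?ys, simplex_push (Suc n) \<sigma> t) \<in> topspace (simplex_sum ?X)"
          using full by (simp add: mem_simplex_sum_partition_sset)
        ultimately show ?thesis
          by (rule step)
      next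
        case red
        then show ?thesis
          using reduced[OF xs t] by (simp add: Some)
      qed
    qed
  }
qed

text \<open>In a reduced chain all coefficients are positive, so the blocks of the two extreme
  partitions supply every factor of the density.\<close>

lemma density_full_chain:
  assumes "finite A" "A \<noteq> {}" "reduced_chain A L" "full_chain A (map fst L)"
  shows "density A (chain_weight A L) \<noteq> 0"
proof -
  have pos: "0 < chain_weight A L C" if r: "r \<in> set (map fst L)" "C \<in> A // r" for r C
  proof -
    obtain t where t: "(r, t) \<in> set L"
      using r(1) by auto
    with assms(3) have "0 < t"
      by (auto simp: reduced_chain_def)
    with t r(2) show ?thesis
      by (intro chain_weight_pos[OF reduced_imp_weighted_chain[OF assms(3)]])
  qed
  have "A \<in> A // (A \<times> A)"
    using \<open>A \<noteq> {}\<close> by (auto simp: quotient_def)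
  then have "0 < chain_weight A L A"
    using assms(4) pos[of "A \<times> A"] by (simp add: full_chain_def)
  moreover have "0 < chain_weight A L {a}" if "a \<in> A" for a
  proof -
    have "{a} \<in> A // Id_on A"
      using that by (auto simp: quotient_def)
    then show ?thesis
      using assms(4) pos[of "Id_on A"] by (simp add: full_chain_def)
  qed
  then have "0 < (\<Prod>a\<in>A. chain_weight A L {a})"
    by (rule prod_pos)
  ultimately show ?thesis
    by (simp add: density_def)
qed

lemma simplex_map_fibres:
  assumes "finite A" "A \<noteq> {}" "x \<in> topspace (simplex_sum (partition_sset A))"
    "y \<in> topspace (simplex_sum (partition_sset A))" "simplex_map A x = simplex_map A y"
  shows "(x, y) \<in> sym_closure (realization_rel (partition_sset A))"
proof -
  let ?r = "sym_closure (realization_rel (partition_sset A))"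
  let ?p0 = "(0, None, \<lambda>j. if j = 0 then 1 else 0) :: nat \<times> 'a rel list option \<times> (nat \<Rightarrow> real)"
  have inv: "simplex_map A u = simplex_map A v" if "(u, v) \<in> ?r" for u v
    using that by induction (auto dest: simplex_map_invariant[OF assms(1,2)])
  have "\<exists>v. (u, v) \<in> ?r \<and> (v = ?p0 \<or>
      (\<exists>L. v = chain_point L \<and> reduced_chain A L \<and> sum_list (map snd L) = 1 \<and> full_chain A (map fst L)))"
    if "u \<in> topspace (simplex_sum (partition_sset A))" for u
    using simplex_reduces[OF assms(1,2), of "fst u" "fst (snd u)" "snd (snd u)"] that by fastforce
  then obtain x' y' where xy: "(x, x') \<in> ?r" "(y, y') \<in> ?r"
    and x': "x' = ?p0 \<or>
      (\<exists>L. x' = chain_point L \<and> reduced_chain A L \<and> sum_list (map snd L) = 1 \<and> full_chain A (map fst L))"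
    and y': "y' = ?p0 \<or>
      (\<exists>L. y' = chain_point L \<and> reduced_chain A L \<and> sum_list (map snd L) = 1 \<and> full_chain A (map fst L))"
    using assms(3,4) by metis
  have eq: "simplex_map A x' = simplex_map A y'"
    using inv xy assms(5) by metis
  \<comment> \<open>Reduced full chains never map to the basepoint of the model, so two normal forms
    with equal images are of the same kind.\<close>
  have nz: "simplex_map A (chain_point L) \<noteq> simplex_map A ?p0"
    if "reduced_chain A L" "full_chain A (map fst L)" for L
    using density_full_chain[OF assms(1,2) that] by (simp add: simplex_map_chain_point scaled_eq_0_iff)
  have "L = M" if L: "reduced_chain A L" "sum_list (map snd L) = 1" "full_chain A (map fst L)"
    and M: "reduced_chain A M" "sum_list (map snd M) = 1"
    and "simplex_map A (chain_point L) = simplex_map A (chain_point M)" for L M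
  proof -
    have "chain_weight A L = chain_weight A M"
    proof (rule scaled_inj[OF assms(2)])
      show "chain_weight A L \<in> set_weights A 1" "chain_weight A M \<in> set_weights A 1"
        using L M assms(1) by (simp_all add: chain_weight_in_set_weights reduced_imp_weighted_chain)
      show "scaled A (chain_weight A L) = scaled A (chain_weight A M)"
        using that(6) by (simp only: simplex_map_chain_point)
      show "density A (chain_weight A L) \<noteq> 0"
        using density_full_chain[OF assms(1,2) L(1,3)] .
    qed
    then show ?thesis
      by (rule reduced_chain_unique[OF assms(2) L(1) M(1)])
  qed
  then have "x' = y'"
    using x' y' eq nz by (elim disjE exE conjE) (simp_all, metis+)
  with xy show ?thesis
    by (blast intro: sym_closure_sym rtrancl_trans)
qed

lemma partition_complex_homeomorphic_weight_model:
  assumes "finite A" "A \<noteq> {}"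
  shows "based_homeomorphic (partition_complex A) (weight_model A, \<lambda>_. 0)"
proof -
  have B: "{(n, None, t) | n t. t \<in> standard_simplex n} \<subseteq> topspace (simplex_sum (partition_sset A))"
    by (auto simp: mem_simplex_sum_partition_sset)
  have ne: "{(n, None :: 'a rel list option, t) | n t. t \<in> standard_simplex n} \<noteq> {}"
    using nonempty_standard_simplex by fastforce
  show ?thesis
    unfolding partition_complex_def pointed_realization_def partition_sset_def[symmetric]
    by (rule based_homeomorphic_quotient_space(1)[OF continuous_map_simplex_map[OF assms(1)]
          Hausdorff_space_weight_model compactin_simplex_sum[OF assms(1)] simplex_map_onto[OF assms]
          simplex_map_invariant[OF assms] simplex_map_fibres[OF assms] ne B]) auto
qed

section \<open>Trees and hierarchies\<close>

text \<open>The combinatorial counterpart of an isomorphism class of trees: such a family is the set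
  of label sets lying above the elements other than the root.\<close>

definition hierarchy :: "'a set \<Rightarrow> 'a set set \<Rightarrow> bool" where
  "hierarchy A H \<longleftrightarrow> H \<subseteq> Pow A \<and> {} \<notin> H \<and> A \<in> H \<and> (\<forall>a\<in>A. {a} \<in> H) \<and>
     (\<forall>C\<in>H. \<forall>D\<in>H. C \<inter> D \<noteq> {} \<longrightarrow> C \<subseteq> D \<or> D \<subseteq> C)"

lemma hierarchy_subset:
  assumes "hierarchy A H" "H' \<subseteq> H" "A \<in> H'" "\<And>a. a \<in> A \<Longrightarrow> {a} \<in> H'"
  shows "hierarchy A H'"
  unfolding hierarchy_def
proof (intro conjI ballI impI)
  fix C D assume "C \<in> H'" "D \<in> H'" "C \<inter> D \<noteq> {}"
  with assms(1,2) show "C \<subseteq> D \<or> D \<subseteq> C"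
    by (simp add: hierarchy_def subset_iff)
qed (use assms in \<open>auto simp: hierarchy_def\<close>)

definition cluster :: "'a set \<Rightarrow> 'a ltree \<Rightarrow> nat \<Rightarrow> 'a set" where
  "cluster A T v = {a \<in> A. (v, label T a) \<in> tree_le T}"

text \<open>The root is left out because it has the same cluster \<open>A\<close> as the element
  just above it; off the root the clusters are distinct.\<close>

definition nonroot :: "'a ltree \<Rightarrow> nat set" where
  "nonroot T = elems T - {tree_root T}"

definition clusters :: "'a set \<Rightarrow> 'a ltree \<Rightarrow> 'a set set" where
  "clusters A T = cluster A T ` nonroot T"

locale labelled_tree =
  fixes A :: "'a set" and T :: "'a ltree"
  assumes tree: "T \<in> labelled_trees A"
begin

abbreviation le (infix "\<sqsubseteq>" 50) where "u \<sqsubseteq> v \<equiv> (u, v) \<in> tree_le T"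
abbreviation less (infix "\<sqsubset>" 50) where "u \<sqsubset> v \<equiv> strict_in (tree_le T) u v"

lemma finite_elems: "finite (elems T)"
  using tree by (simp add: labelled_trees_def tree_poset_def)

lemma bij_label: "bij_betw (label T) A (leaves T)"
  using tree by (simp add: labelled_trees_def)

lemma le_refl: "v \<in> elems T \<Longrightarrow> v \<sqsubseteq> v"
  and le_trans: "u \<sqsubseteq> v \<Longrightarrow> v \<sqsubseteq> w \<Longrightarrow> u \<sqsubseteq> w"
  and le_antisym: "u \<sqsubseteq> v \<Longrightarrow> v \<sqsubseteq> u \<Longrightarrow> u = v"
  and le_elems: "u \<sqsubseteq> v \<Longrightarrow> u \<in> elems T \<and> v \<in> elems T"
proof -
  have *: "partial_order_on (elems T) (tree_le T)"
    using tree by (simp add: labelled_trees_def tree_poset_def)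
  show "v \<in> elems T \<Longrightarrow> v \<sqsubseteq> v"
    using partial_order_onD(1)[OF *] by (simp add: refl_on_def)
  show "u \<sqsubseteq> v \<Longrightarrow> v \<sqsubseteq> w \<Longrightarrow> u \<sqsubseteq> w"
    using partial_order_onD(2)[OF *] by (rule transD)
  show "u \<sqsubseteq> v \<Longrightarrow> v \<sqsubseteq> u \<Longrightarrow> u = v"
    using partial_order_onD(3)[OF *] by (rule antisymD)
  show "u \<sqsubseteq> v \<Longrightarrow> u \<in> elems T \<and> v \<in> elems T"
    using partial_order_onD(4)[OF *] by blast
qed

lemma less_le: "u \<sqsubset> v \<Longrightarrow> u \<sqsubseteq> v"
  by (simp add: strict_in_def)

lemma less_irrefl: "\<not> u \<sqsubset> u"
  by (simp add: strict_in_def)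

lemma less_trans: "u \<sqsubset> v \<Longrightarrow> v \<sqsubset> w \<Longrightarrow> u \<sqsubset> w"
  unfolding strict_in_def using le_trans le_antisym by blast

lemma is_root_iff: "is_root (elems T) (tree_le T) r \<longleftrightarrow> r = tree_root T"
proof -
  obtain r0 where r0: "is_root (elems T) (tree_le T) r0"
    using tree by (auto simp: labelled_trees_def tree_poset_def)
  have "r = r'" if "is_root (elems T) (tree_le T) r" "is_root (elems T) (tree_le T) r'" for r r'
    using that le_antisym by (auto simp: is_root_def)
  with r0 show ?thesis
    unfolding tree_root_def by (metis (mono_tags, lifting) theI)
qed

lemma root_le: "v \<in> elems T \<Longrightarrow> tree_root T \<sqsubseteq> v"
  and root_in_elems: "tree_root T \<in> elems T"
  using is_root_iff[of "tree_root T"] by (auto simp: is_root_def)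

lemma
  shows bottom: "\<exists>b\<in>nonroot T. \<forall>t\<in>nonroot T. b \<sqsubseteq> t"
    and comparable: "u \<sqsubseteq> t \<Longrightarrow> v \<sqsubseteq> t \<Longrightarrow> u \<sqsubseteq> v \<or> v \<sqsubseteq> u"
    and branching: "t \<sqsubset> u \<Longrightarrow> t \<noteq> tree_root T \<Longrightarrow> \<exists>v. t \<sqsubset> v \<and> \<not> u \<sqsubseteq> v"
proof -
  obtain r where r: "is_root (elems T) (tree_le T) r"
    "\<exists>b\<in>elems T. b \<noteq> r \<and> (\<forall>t\<in>elems T. t \<noteq> r \<longrightarrow> b \<sqsubseteq> t)"
    "\<forall>t u v. u \<sqsubseteq> t \<and> v \<sqsubseteq> t \<longrightarrow> u \<sqsubseteq> v \<or> v \<sqsubseteq> u"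
    "\<forall>t u. t \<sqsubset> u \<and> t \<noteq> r \<longrightarrow> (\<exists>v. t \<sqsubset> v \<and> \<not> u \<sqsubseteq> v)"
    using tree unfolding labelled_trees_def tree_poset_def by blast
  have "r = tree_root T"
    using r(1) is_root_iff by blast
  then show "\<exists>b\<in>nonroot T. \<forall>t\<in>nonroot T. b \<sqsubseteq> t"
    "u \<sqsubseteq> t \<Longrightarrow> v \<sqsubseteq> t \<Longrightarrow> u \<sqsubseteq> v \<or> v \<sqsubseteq> u"
    "t \<sqsubset> u \<Longrightarrow> t \<noteq> tree_root T \<Longrightarrow> \<exists>v. t \<sqsubset> v \<and> \<not> u \<sqsubseteq> v"
    using r(2-4) by (auto simp: nonroot_def)
qed

lemma less_elems: "u \<sqsubset> v \<Longrightarrow> u \<in> elems T \<and> v \<in> elems T"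
  unfolding strict_in_def using le_elems by blast

lemma leaf_above:
  assumes "v \<in> elems T"
  shows "\<exists>l\<in>leaves T. v \<sqsubseteq> l"
  using assms
proof (induction "card {w. v \<sqsubset> w}" arbitrary: v rule: less_induct)
  case less
  show ?case
  proof (cases "v \<in> leaves T")
    case True
    then show ?thesis
      using le_refl less.prems by blast
  next
    case False
    then obtain u where u: "v \<sqsubset> u"
      using less.prems by (auto simp: leaves_def)
    have "finite {w. v \<sqsubset> w}"
      by (rule finite_subset[OF _ finite_elems]) (use less_elems in blast)
    moreover have "{w. u \<sqsubset> w} \<subset> {w. v \<sqsubset> w}"
      using u less_trans[OF u] less_irrefl by blast
    ultimately have "card {w. u \<sqsubset> w} < card {w. v \<sqsubset> w}"
      by (rule psubset_card_mono)
    then obtain l where "l \<in> leaves T" "u \<sqsubseteq> l"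
      using less.hyps[of u] less_elems[OF u] by blast
    then show ?thesis
      using le_trans[OF less_le[OF u]] by blast
  qed
qed

lemma edge_iff: "(t, u) \<in> edges T \<longleftrightarrow> t \<sqsubset> u \<and> \<not> (\<exists>s. t \<sqsubset> s \<and> s \<sqsubset> u)"
  by (simp add: edges_def)

text \<open>In a finite order the open interval between \<open>t\<close> and \<open>u\<close> can be
  shrunk from either end until it is empty.\<close>

lemma covers:
  assumes "t \<sqsubset> u"
  shows "\<exists>c. (t, c) \<in> edges T \<and> c \<sqsubseteq> u" "\<exists>c. (c, u) \<in> edges T \<and> t \<sqsubseteq> c"
proof -
  have fin: "finite {s. t \<sqsubset> s \<and> s \<sqsubset> u}" for t u
    by (rule finite_subset[OF _ finite_elems]) (use less_elems in blast)
  show "\<exists>c. (t, c) \<in> edges T \<and> c \<sqsubseteq> u"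
    using assms
  proof (induction "card {s. t \<sqsubset> s \<and> s \<sqsubset> u}" arbitrary: u rule: less_induct)
    case less
    show ?case
    proof (cases "\<exists>s. t \<sqsubset> s \<and> s \<sqsubset> u")
      case True
      then obtain s where s: "t \<sqsubset> s" "s \<sqsubset> u"
        by blast
      have "{s'. t \<sqsubset> s' \<and> s' \<sqsubset> s} \<subset> {s. t \<sqsubset> s \<and> s \<sqsubset> u}"
        using s less_trans[OF _ s(2)] less_irrefl by blast
      then have "card {s'. t \<sqsubset> s' \<and> s' \<sqsubset> s} < card {s. t \<sqsubset> s \<and> s \<sqsubset> u}"
        by (rule psubset_card_mono[OF fin])
      then obtain c where "(t, c) \<in> edges T" "c \<sqsubseteq> s"
        using less.hyps s(1) by blast
      then show ?thesis
        using le_trans[OF _ less_le[OF s(2)]] by blast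
    next
      case False
      with less.prems show ?thesis
        using le_refl less_elems edge_iff by blast
    qed
  qed
  show "\<exists>c. (c, u) \<in> edges T \<and> t \<sqsubseteq> c"
    using assms
  proof (induction "card {s. t \<sqsubset> s \<and> s \<sqsubset> u}" arbitrary: t rule: less_induct)
    case less
    show ?case
    proof (cases "\<exists>s. t \<sqsubset> s \<and> s \<sqsubset> u")
      case True
      then obtain s where s: "t \<sqsubset> s" "s \<sqsubset> u"
        by blast
      have "{s'. s \<sqsubset> s' \<and> s' \<sqsubset> u} \<subset> {s. t \<sqsubset> s \<and> s \<sqsubset> u}"
        using s less_trans[OF s(1)] less_irrefl by blast
      then have "card {s'. s \<sqsubset> s' \<and> s' \<sqsubset> u} < card {s. t \<sqsubset> s \<and> s \<sqsubset> u}"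
        by (rule psubset_card_mono[OF fin])
      then obtain c where "(c, u) \<in> edges T" "s \<sqsubseteq> c"
        using less.hyps s(2) by blast
      then show ?thesis
        using le_trans[OF less_le[OF s(1)]] by blast
    next
      case False
      with less.prems show ?thesis
        using le_refl less_elems edge_iff by blast
    qed
  qed
qed

lemma label_in_leaves: "a \<in> A \<Longrightarrow> label T a \<in> leaves T"
  using bij_label by (auto simp: bij_betw_def)

lemma leaf_label: "l \<in> leaves T \<Longrightarrow> \<exists>a\<in>A. l = label T a"
  using bij_label by (auto simp: bij_betw_def)

lemma leaf_maximal: "l \<in> leaves T \<Longrightarrow> l \<sqsubseteq> u \<Longrightarrow> u = l"
  by (auto simp: leaves_def strict_in_def)

lemma root_not_leaf: "tree_root T \<notin> leaves T"
proof
  assume "tree_root T \<in> leaves T"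
  obtain b where "b \<in> nonroot T"
    using bottom by blast
  then have "tree_root T \<sqsubset> b"
    using root_le by (auto simp: nonroot_def strict_in_def)
  with \<open>tree_root T \<in> leaves T\<close> show False
    by (auto simp: leaves_def)
qed

lemma label_nonroot: "a \<in> A \<Longrightarrow> label T a \<in> nonroot T"
proof -
  assume a: "a \<in> A"
  have "label T a \<noteq> tree_root T"
    using label_in_leaves[OF a] root_not_leaf by metis
  moreover have "label T a \<in> elems T"
    using label_in_leaves[OF a] by (simp add: leaves_def)
  ultimately show ?thesis
    by (simp add: nonroot_def)
qed

lemma cluster_nonempty: "v \<in> elems T \<Longrightarrow> cluster A T v \<noteq> {}"
  using leaf_above leaf_label by (fastforce simp: cluster_def)

lemma cluster_mono: "v \<sqsubseteq> u \<Longrightarrow> cluster A T u \<subseteq> cluster A T v"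
  using le_trans by (auto simp: cluster_def)

lemma cluster_label: "a \<in> A \<Longrightarrow> cluster A T (label T a) = {a}"
proof -
  assume a: "a \<in> A"
  have "b = a" if "b \<in> A" "label T a \<sqsubseteq> label T b" for b
    using leaf_maximal[OF label_in_leaves[OF a] that(2)] bij_label a that(1)
    by (auto simp: bij_betw_def inj_on_def)
  moreover have "label T a \<sqsubseteq> label T a"
    using label_nonroot[OF a] le_refl by (simp add: nonroot_def)
  ultimately show ?thesis
    using a by (auto simp: cluster_def)
qed

text \<open>The branching axiom enters here: it excludes elements with a single incoming edge, which
  would repeat a cluster. If \<open>u\<close> were strictly below \<open>v\<close>, a cover
  \<open>c\<close> of \<open>u\<close> with \<open>c\<close> below \<open>v\<close> would have a
  competitor \<open>z\<close> above \<open>u\<close> but not above \<open>c\<close>. A leaf above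
  \<open>z\<close> lies above \<open>v\<close>, hence above \<open>c\<close>, so \<open>z\<close>
  would lie strictly between \<open>u\<close> and \<open>c\<close>.\<close>

lemma cluster_reflects_le:
  assumes "u \<in> nonroot T" "v \<in> nonroot T" "cluster A T u \<subseteq> cluster A T v"
  shows "v \<sqsubseteq> u"
proof -
  obtain a where a: "a \<in> cluster A T u" "a \<in> cluster A T v"
    using cluster_nonempty[of u] assms by (auto simp: nonroot_def)
  then consider "v \<sqsubseteq> u" | "u \<sqsubset> v"
    using comparable[of u "label T a" v] le_refl assms(2) by (auto simp: cluster_def strict_in_def)
  then show ?thesis
  proof cases
    case 2
    then obtain c where c: "(u, c) \<in> edges T" "c \<sqsubseteq> v"
      using covers(1) by blast
    then have "u \<sqsubset> c"
      by (simp add: edge_iff)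
    then obtain z where z: "u \<sqsubset> z" "\<not> c \<sqsubseteq> z"
      using branching assms(1) by (auto simp: nonroot_def)
    obtain b where b: "b \<in> cluster A T z"
      using cluster_nonempty less_elems[OF z(1)] by blast
    have "cluster A T z \<subseteq> cluster A T u" "cluster A T v \<subseteq> cluster A T c"
      using z c cluster_mono by (auto simp: strict_in_def)
    with b assms(3) have "c \<sqsubseteq> label T b" "z \<sqsubseteq> label T b"
      by (auto simp: cluster_def)
    then have "z \<sqsubseteq> c"
      using comparable z(2) by blast
    moreover have "z \<noteq> c"
      using z(2) le_refl less_elems[OF z(1)] by blast
    ultimately have "z \<sqsubset> c"
      by (simp add: strict_in_def)
    with z(1) c(1) show ?thesis
      by (auto simp: edge_iff)
  qed
qed

lemma le_iff_cluster:
  assumes "u \<in> elems T" "v \<in> elems T"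
  shows "u \<sqsubseteq> v \<longleftrightarrow> u = tree_root T \<or> v \<noteq> tree_root T \<and> cluster A T v \<subseteq> cluster A T u"
proof
  assume "u \<sqsubseteq> v"
  then show "u = tree_root T \<or> v \<noteq> tree_root T \<and> cluster A T v \<subseteq> cluster A T u"
    using cluster_mono le_antisym root_le assms by blast
next
  assume "u = tree_root T \<or> v \<noteq> tree_root T \<and> cluster A T v \<subseteq> cluster A T u"
  then show "u \<sqsubseteq> v"
    using assms root_le cluster_reflects_le[of v u] by (auto simp: nonroot_def)
qed

lemma inj_on_cluster: "inj_on (cluster A T) (nonroot T)"
  by (intro inj_onI le_antisym cluster_reflects_le) auto

lemma cluster_bottom:
  assumes "b \<in> nonroot T" "\<forall>t\<in>nonroot T. b \<sqsubseteq> t"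
  shows "cluster A T b = A"
  using assms label_nonroot by (auto simp: cluster_def)

lemma hierarchy_clusters: "hierarchy A (clusters A T)"
proof -
  have "A \<in> clusters A T"
    using bottom cluster_bottom unfolding clusters_def by (metis imageI)
  moreover have "{a} \<in> clusters A T" if "a \<in> A" for a
    using that cluster_label label_nonroot unfolding clusters_def by (metis imageI)
  moreover have "C \<subseteq> D \<or> D \<subseteq> C" if CD: "C \<in> clusters A T" "D \<in> clusters A T" "C \<inter> D \<noteq> {}" for C D
  proof -
    obtain u v a where "C = cluster A T u" "D = cluster A T v" "a \<in> C" "a \<in> D"
      using CD unfolding clusters_def by blast
    then show ?thesis
      using comparable[of u "label T a" v] cluster_mono by (auto simp: cluster_def)
  qed
  moreover have "clusters A T \<subseteq> Pow A"
    by (auto simp: clusters_def cluster_def)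
  moreover have "{} \<notin> clusters A T"
    using cluster_nonempty by (force simp: clusters_def nonroot_def)
  ultimately show ?thesis
    by (simp add: hierarchy_def)
qed

lemma edge_snd_nonroot: "e \<in> edges T \<Longrightarrow> snd e \<in> nonroot T"
proof -
  assume "e \<in> edges T"
  then have less: "fst e \<sqsubset> snd e"
    by (cases e) (simp add: edge_iff)
  then have "snd e \<in> elems T" "fst e \<in> elems T" "fst e \<sqsubseteq> snd e" "fst e \<noteq> snd e"
    using less_elems[OF less] less by (auto simp: strict_in_def)
  moreover from this have "snd e \<noteq> tree_root T"
    using root_le[of "fst e"] le_antisym[of "fst e" "snd e"] by metis
  ultimately show ?thesis
    by (simp add: nonroot_def)
qed

lemma inj_on_snd_edges: "inj_on snd (edges T)"
proof (rule inj_onI)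
  fix e e' assume e: "e \<in> edges T" "e' \<in> edges T" "snd e = snd e'"
  obtain t u t' where eq: "e = (t, u)" "e' = (t', u)"
    using e(3) by (metis prod.collapse)
  then have "t \<sqsubseteq> u" "t' \<sqsubseteq> u"
    using e by (auto simp: edge_iff strict_in_def)
  then have "t \<sqsubseteq> t' \<or> t' \<sqsubseteq> t"
    by (rule comparable)
  then have "t = t'"
    using e eq by (auto simp: edge_iff strict_in_def)
  then show "e = e'"
    by (simp add: eq)
qed

text \<open>Together with injectivity, this identifies edges with non-root elements through their
  upper ends, so that an edge is determined by its cluster.\<close>

lemma snd_edges: "snd ` edges T = nonroot T"
proof
  show "nonroot T \<subseteq> snd ` edges T"
  proof
    fix u assume u: "u \<in> nonroot T"
    then have "tree_root T \<sqsubset> u"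
      using root_le by (auto simp: nonroot_def strict_in_def)
    then obtain c where "(c, u) \<in> edges T"
      using covers(2) by blast
    then show "u \<in> snd ` edges T"
      by force
  qed
qed (use edge_snd_nonroot in blast)

lemma finite_edges: "finite (edges T)"
  by (rule finite_imageD[OF _ inj_on_snd_edges])
    (use finite_elems in \<open>simp add: snd_edges nonroot_def\<close>)

lemma edge_below_snd: "e \<in> edges T \<Longrightarrow> edge_below T (snd e) = e"
  unfolding edge_below_def using inj_on_snd_edges by (intro the_equality) (auto simp: inj_on_def)

lemma edge_below: "u \<in> nonroot T \<Longrightarrow> edge_below T u \<in> edges T \<and> snd (edge_below T u) = u"
  using edge_below_snd unfolding snd_edges[symmetric] by auto

lemma inj_on_edge_cluster: "inj_on (\<lambda>e. cluster A T (snd e)) (edges T)"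
  using comp_inj_on[OF inj_on_snd_edges] inj_on_cluster by (simp add: o_def snd_edges)

lemma edge_cluster_image: "(\<lambda>e. cluster A T (snd e)) ` edges T = clusters A T"
  by (simp add: clusters_def flip: snd_edges image_image)

text \<open>Both conditions say that the upper end is the least element above the root.\<close>

lemma root_edge_iff:
  assumes "e \<in> edges T"
  shows "fst e = tree_root T \<longleftrightarrow> cluster A T (snd e) = A"
proof -
  obtain t u where e: "e = (t, u)"
    by fastforce
  obtain b where b: "b \<in> nonroot T" "\<And>t. t \<in> nonroot T \<Longrightarrow> b \<sqsubseteq> t"
    using bottom by blast
  have u: "u \<in> nonroot T" "t \<sqsubset> u" "\<And>s. \<not> (t \<sqsubset> s \<and> s \<sqsubset> u)"
    using edge_snd_nonroot[OF assms] assms by (auto simp: e edge_iff)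
  have "t = tree_root T \<longleftrightarrow> u = b"
  proof
    assume "t = tree_root T"
    then have "t \<sqsubset> b"
      using b(1) root_le by (auto simp: nonroot_def strict_in_def)
    with b(2)[OF u(1)] u(3)[of b] show "u = b"
      by (auto simp: strict_in_def)
  next
    assume "u = b"
    show "t = tree_root T"
    proof (rule ccontr)
      assume "t \<noteq> tree_root T"
      then have "b \<sqsubseteq> t"
        using b(2) less_elems[OF u(2)] by (simp add: nonroot_def)
      with u(2) \<open>u = b\<close> le_antisym show False
        by (auto simp: strict_in_def)
    qed
  qed
  also have "\<dots> \<longleftrightarrow> cluster A T u = A"
    using cluster_bottom b u(1) inj_on_cluster by (auto simp: inj_on_def)
  finally show ?thesis
    by (simp add: e)
qed

lemma leaf_iff:
  assumes "u \<in> nonroot T"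
  shows "u \<in> leaves T \<longleftrightarrow> (\<exists>a\<in>A. cluster A T u = {a})"
proof
  assume "u \<in> leaves T"
  then show "\<exists>a\<in>A. cluster A T u = {a}"
    using leaf_label cluster_label by metis
next
  assume "\<exists>a\<in>A. cluster A T u = {a}"
  then obtain a where a: "a \<in> A" "cluster A T u = cluster A T (label T a)"
    using cluster_label by auto
  then have "u = label T a"
    using inj_on_cluster assms label_nonroot by (auto simp: inj_on_def)
  then show "u \<in> leaves T"
    using a label_in_leaves by simp
qed

lemma outer_edge_iff:
  assumes "e \<in> edges T"
  shows "e \<in> outer_edges T \<longleftrightarrow> cluster A T (snd e) = A \<or> (\<exists>a\<in>A. cluster A T (snd e) = {a})"
  using assms root_edge_iff[OF assms] leaf_iff[OF edge_snd_nonroot[OF assms]]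
  by (simp add: outer_edges_def)

lemma internal_edge_iff:
  "e \<in> internal_edges T \<longleftrightarrow>
    e \<in> edges T \<and> cluster A T (snd e) \<noteq> A \<and> (\<forall>a\<in>A. cluster A T (snd e) \<noteq> {a})"
  using outer_edge_iff[of e] by (auto simp: internal_edges_def)

lemma verts_iff: "v \<in> verts T \<longleftrightarrow> v \<in> nonroot T \<and> (\<forall>a\<in>A. cluster A T v \<noteq> {a})"
  using leaf_iff[of v] by (auto simp: verts_def nonroot_def)

lemma elems_eq: "elems T = insert (tree_root T) (nonroot T)"
  using root_in_elems by (auto simp: nonroot_def)

end

text \<open>Converse to the passage from trees to clusters: order by reverse inclusion and put
  \<open>r\<close> below everything. It is stated for an arbitrary carrier and indexing so that it
  covers both trees built from a hierarchy and collapsed trees.\<close>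

lemma labelled_tree_of_clusters:
  assumes "finite V" "r \<in> V" and inj: "inj_on c (V - {r})" and H: "hierarchy A (c ` (V - {r}))"
    and le: "\<And>u v. (u, v) \<in> tree_le T \<longleftrightarrow> u \<in> V \<and> v \<in> V \<and> (u = r \<or> v \<noteq> r \<and> c v \<subseteq> c u)"
    and lab: "\<And>a. a \<in> A \<Longrightarrow> label T a \<in> V - {r} \<and> c (label T a) = {a}"
    and elems: "elems T = V"
  shows "T \<in> labelled_trees A" "tree_root T = r" "\<And>v. v \<in> V - {r} \<Longrightarrow> cluster A T v = c v"
proof -
  have Hc: "c v \<noteq> {}" "c v \<subseteq> A" if "v \<in> V - {r}" for v
    using H that by (auto simp: hierarchy_def)
  have lam: "c u \<subseteq> c v \<or> c v \<subseteq> c u" if "u \<in> V - {r}" "v \<in> V - {r}" "c u \<inter> c v \<noteq> {}" for u v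
  proof -
    have "\<forall>C\<in>c ` (V - {r}). \<forall>D\<in>c ` (V - {r}). C \<inter> D \<noteq> {} \<longrightarrow> C \<subseteq> D \<or> D \<subseteq> C"
      using H unfolding hierarchy_def by (elim conjE)
    from this[rule_format, OF imageI[OF that(1)] imageI[OF that(2)] that(3)] show ?thesis .
  qed
  obtain b where b: "b \<in> V - {r}" "c b = A"
    using H by (auto simp: hierarchy_def)
  have po: "partial_order_on V (tree_le T)"
    unfolding partial_order_on_def preorder_on_def
  proof (intro conjI)
    show "antisym (tree_le T)"
      using inj by (auto simp: antisym_def le inj_on_def)
    show "trans (tree_le T)"
      by (auto simp: trans_def le)
  qed (auto simp: le refl_on_def)
  have root: "is_root V (tree_le T) r"
    using \<open>r \<in> V\<close> by (auto simp: is_root_def le)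
  have strict: "strict_in (tree_le T) u v \<longleftrightarrow> u \<in> V \<and> v \<in> V - {r} \<and> (u = r \<or> c v \<subset> c u)" for u v
    using inj by (auto simp: strict_in_def le inj_on_def)
  have bottom: "\<exists>b\<in>V. b \<noteq> r \<and> (\<forall>t\<in>V. t \<noteq> r \<longrightarrow> (b, t) \<in> tree_le T)"
    using b Hc by (auto simp: le)
  \<comment> \<open>Two elements below \<open>t\<close> have overlapping clusters, both containing
    the nonempty cluster of \<open>t\<close>, so they are nested.\<close>
  have chain: "(u, v) \<in> tree_le T \<or> (v, u) \<in> tree_le T"
    if "(u, t) \<in> tree_le T" "(v, t) \<in> tree_le T" for t u v
    using that lam[of u v] Hc[of t] by (fastforce simp: le)
  \<comment> \<open>The witness is a leaf: a label of \<open>t\<close> that is not a label of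
    \<open>u\<close> gives an element above \<open>t\<close> that is not above
    \<open>u\<close>.\<close>
  have branch: "\<exists>v. strict_in (tree_le T) t v \<and> (u, v) \<notin> tree_le T"
    if "strict_in (tree_le T) t u" "t \<noteq> r" for t u
  proof -
    have tu: "c u \<subset> c t" "t \<in> V - {r}" "u \<in> V - {r}"
      using that by (auto simp: strict)
    then obtain a where a: "a \<in> c t" "a \<notin> c u"
      using psubset_imp_ex_mem by blast
    then have "a \<in> A"
      using Hc(2)[OF tu(2)] by blast
    note l = lab[OF this]
    have "c t \<noteq> {a}"
      using a tu Hc(1)[of u] by auto
    with a tu l have "strict_in (tree_le T) t (label T a) \<and> (u, label T a) \<notin> tree_le T"
      by (auto simp: strict le)
    then show ?thesis
      by blast
  qed
  have leaf: "v \<in> leaves T \<longleftrightarrow> v \<in> V - {r} \<and> (\<exists>a\<in>A. c v = {a})" for v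
  proof
    assume v: "v \<in> leaves T"
    have "v \<noteq> r"
      using v b \<open>r \<in> V\<close> by (auto simp: leaves_def strict)
    moreover have "v \<in> V"
      using v by (simp add: leaves_def elems)
    ultimately obtain a where a: "a \<in> c v" "a \<in> A"
      using Hc[of v] by blast
    have "\<not> c (label T a) \<subset> c v"
      using v lab[OF a(2)] by (auto simp: leaves_def strict elems)
    with a lab[OF a(2)] have "c v = {a}"
      by auto
    with a \<open>v \<noteq> r\<close> \<open>v \<in> V\<close> show "v \<in> V - {r} \<and> (\<exists>a\<in>A. c v = {a})"
      by auto
  next
    assume "v \<in> V - {r} \<and> (\<exists>a\<in>A. c v = {a})"
    then show "v \<in> leaves T"
      using Hc(1) by (fastforce simp: leaves_def strict elems)
  qed
  have bij: "bij_betw (label T) A (leaves T)"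
    unfolding bij_betw_def
  proof
    show "inj_on (label T) A"
      using lab by (metis inj_onI singleton_inject)
    show "label T ` A = leaves T"
    proof
      show "leaves T \<subseteq> label T ` A"
      proof
        fix v assume "v \<in> leaves T"
        then obtain a where a: "a \<in> A" "c v = {a}" "v \<in> V - {r}"
          unfolding leaf by blast
        then have "v = label T a"
          using lab[OF a(1)] by (intro inj_onD[OF inj]) auto
        with a(1) show "v \<in> label T ` A"
          by blast
      qed
      show "label T ` A \<subseteq> leaves T"
      proof (rule image_subsetI)
        fix a assume a: "a \<in> A"
        show "label T a \<in> leaves T"
          unfolding leaf using lab[OF a] a by blast
      qed
    qed
  qed
  have "tree_poset V (tree_le T)"
    unfolding tree_poset_def
  proof (intro conjI)
    show "\<exists>r. is_root V (tree_le T) r \<and>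
      (\<exists>b\<in>V. b \<noteq> r \<and> (\<forall>t\<in>V. t \<noteq> r \<longrightarrow> (b, t) \<in> tree_le T)) \<and>
      (\<forall>t u v. (u, t) \<in> tree_le T \<and> (v, t) \<in> tree_le T \<longrightarrow> (u, v) \<in> tree_le T \<or> (v, u) \<in> tree_le T) \<and>
      (\<forall>t u. strict_in (tree_le T) t u \<and> t \<noteq> r \<longrightarrow> (\<exists>v. strict_in (tree_le T) t v \<and> (u, v) \<notin> tree_le T))"
      using root bottom chain branch by blast
  qed (use assms po in auto)
  with bij show lab_tree: "T \<in> labelled_trees A"
    by (simp add: labelled_trees_def elems)
  interpret labelled_tree A T
    by standard (rule lab_tree)
  show "tree_root T = r"
    using root is_root_iff by (simp add: elems)
  show "cluster A T v = c v" if "v \<in> V - {r}" for v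
  proof -
    have "(v, label T a) \<in> tree_le T \<longleftrightarrow> a \<in> c v" if a: "a \<in> A" for a
      using lab[OF a] \<open>v \<in> V - {r}\<close> by (simp add: le)
    then show ?thesis
      using Hc(2)[OF that] by (auto simp: cluster_def)
  qed
qed

text \<open>The members of \<open>H\<close> are numbered from 0, and the next free number
  \<open>card H\<close> serves as the root.\<close>

lemma hierarchy_realized:
  assumes "finite A" "hierarchy A H"
  shows "\<exists>T\<in>labelled_trees A. clusters A T = H"
proof -
  have "finite H"
    using assms by (auto simp: hierarchy_def intro: finite_subset[of _ "Pow A"])
  then obtain f :: "nat \<Rightarrow> 'a set" where f: "bij_betw f {0..<card H} H"
    using ex_bij_betw_nat_finite by blast
  let ?V = "{..card H}" and ?r = "card H"
  have V: "?V - {?r} = {0..<card H}"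
    by auto
  define T where "T = \<lparr>elems = ?V,
    tree_le = {(u, v). u \<in> ?V \<and> v \<in> ?V \<and> (u = ?r \<or> v \<noteq> ?r \<and> f v \<subseteq> f u)},
    label = (\<lambda>a. inv_into {0..<card H} f {a})\<rparr>"
  have H: "f ` (?V - {?r}) = H"
    using f by (simp add: V bij_betw_def)
  have lab: "label T a \<in> ?V - {?r} \<and> f (label T a) = {a}" if "a \<in> A" for a
  proof -
    have "{a} \<in> f ` {0..<card H}"
      using assms(2) that H V by (simp add: hierarchy_def)
    then show ?thesis
      unfolding V T_def ltree.simps by (intro conjI inv_into_into f_inv_into_f)
  qed
  have T: "T \<in> labelled_trees A" "tree_root T = ?r" "\<And>v. v \<in> ?V - {?r} \<Longrightarrow> cluster A T v = f v"
  proof -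
    have le: "(u, v) \<in> tree_le T \<longleftrightarrow> u \<in> ?V \<and> v \<in> ?V \<and> (u = ?r \<or> v \<noteq> ?r \<and> f v \<subseteq> f u)" for u v
      by (simp add: T_def)
    have inj: "inj_on f (?V - {?r})"
      using f by (simp add: V bij_betw_def)
    have hier: "hierarchy A (f ` (?V - {?r}))"
      using assms(2) H by (simp only:)
    have *: "finite ?V" "?r \<in> ?V" "elems T = ?V"
      by (simp_all add: T_def)
    note T = labelled_tree_of_clusters[OF *(1,2) inj hier le lab *(3)]
    show "T \<in> labelled_trees A" "tree_root T = ?r" "\<And>v. v \<in> ?V - {?r} \<Longrightarrow> cluster A T v = f v"
      using T by blast+
  qed
  have "elems T = ?V"
    by (simp add: T_def)
  then have "nonroot T = ?V - {?r}"
    by (simp only: nonroot_def T(2))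
  moreover have "cluster A T ` (?V - {?r}) = f ` (?V - {?r})"
    by (rule image_cong[OF refl T(3)])
  ultimately have "clusters A T = f ` (?V - {?r})"
    by (simp only: clusters_def)
  then have "clusters A T = H"
    by (simp only: H)
  with T(1) show ?thesis
    by (rule bexI[rotated])
qed

context labelled_tree
begin

text \<open>Collapsing deletes the upper ends of the edges in \<open>F\<close>. These edges are
  internal, so \<open>A\<close> and the singletons keep their elements and the remaining clusters
  still form a hierarchy.\<close>

lemma
  assumes "F \<subseteq> internal_edges T"
  shows collapse_labelled: "collapse T F \<in> labelled_trees A"
    and cluster_collapse: "\<And>v. v \<in> nonroot T - snd ` F \<Longrightarrow> cluster A (collapse T F) v = cluster A T v"
    and nonroot_collapse: "nonroot (collapse T F) = nonroot T - snd ` F"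
proof -
  let ?V = "elems T - snd ` F" and ?r = "tree_root T"
  have F: "cluster A T u \<noteq> A" "a \<in> A \<Longrightarrow> cluster A T u \<noteq> {a}" "u \<in> nonroot T" if "u \<in> snd ` F" for u a
    using that assms internal_edge_iff edge_snd_nonroot by blast+
  have V: "?V - {?r} = nonroot T - snd ` F"
    by (auto simp: nonroot_def)
  have rV: "?r \<in> ?V"
    using F(3) root_in_elems by (auto simp: nonroot_def)
  have lab: "label T a \<in> nonroot T - snd ` F" if "a \<in> A" for a
    using F(2)[OF _ that] cluster_label[OF that] label_nonroot[OF that] by blast
  obtain b where b: "b \<in> nonroot T" "cluster A T b = A"
    using bottom cluster_bottom by blast
  then have "b \<in> nonroot T - snd ` F"
    using F(1) by blast
  then have A: "A \<in> cluster A T ` (nonroot T - snd ` F)"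
    using b(2) by (metis imageI)
  have sing: "{a} \<in> cluster A T ` (nonroot T - snd ` F)" if "a \<in> A" for a
    using lab[OF that] cluster_label[OF that] by (metis imageI)
  have "cluster A T ` (nonroot T - snd ` F) \<subseteq> clusters A T"
    by (auto simp: clusters_def)
  then have H: "hierarchy A (cluster A T ` (?V - {?r}))"
    unfolding V by (rule hierarchy_subset[OF hierarchy_clusters _ A sing])
  have inj: "inj_on (cluster A T) (?V - {?r})"
    unfolding V by (rule inj_on_subset[OF inj_on_cluster]) blast
  have le: "(u, v) \<in> tree_le (collapse T F) \<longleftrightarrow>
      u \<in> ?V \<and> v \<in> ?V \<and> (u = ?r \<or> v \<noteq> ?r \<and> cluster A T v \<subseteq> cluster A T u)" for u v
    using le_iff_cluster[of u v] by (auto simp: collapse_def)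
  have l: "label (collapse T F) a \<in> ?V - {?r} \<and> cluster A T (label (collapse T F) a) = {a}"
    if "a \<in> A" for a
    using lab[OF that] cluster_label[OF that] unfolding V by (simp add: collapse_def)
  have elems: "elems (collapse T F) = ?V"
    by (simp add: collapse_def)
  have fin: "finite ?V"
    using finite_elems by simp
  note * = labelled_tree_of_clusters[OF fin rV inj H le l elems]
  have "tree_root (collapse T F) = ?r"
    using * by blast
  with V elems show "nonroot (collapse T F) = nonroot T - snd ` F"
    by (auto simp: nonroot_def)
  show "collapse T F \<in> labelled_trees A"
    "\<And>v. v \<in> nonroot T - snd ` F \<Longrightarrow> cluster A (collapse T F) v = cluster A T v"
    using * V by blast+
qed

lemma clusters_collapse:
  "F \<subseteq> internal_edges T \<Longrightarrow> clusters A (collapse T F) = cluster A T ` (nonroot T - snd ` F)"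
  by (auto simp: clusters_def nonroot_collapse cluster_collapse intro!: image_cong)

end

section \<open>Isomorphism classes of trees as hierarchies\<close>

lemma tree_isoD:
  assumes "T \<in> labelled_trees A" "T' \<in> labelled_trees A" "tree_iso A T T' h"
  shows "h (tree_root T) = tree_root T'" "\<And>v. v \<in> elems T \<Longrightarrow> cluster A T' (h v) = cluster A T v"
    "bij_betw h (nonroot T) (nonroot T')"
proof -
  interpret T: labelled_tree A T by standard (rule assms)
  interpret T': labelled_tree A T' by standard (rule assms)
  have h: "bij_betw h (elems T) (elems T')" "\<And>a. a \<in> A \<Longrightarrow> h (label T a) = label T' a"
    "\<And>s t. s \<in> elems T \<Longrightarrow> t \<in> elems T \<Longrightarrow> (s, t) \<in> tree_le T \<longleftrightarrow> (h s, h t) \<in> tree_le T'"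
    using assms(3) by (auto simp: tree_iso_def)
  have "is_root (elems T') (tree_le T') (h (tree_root T))"
    using h(1,3) T.root_le T.root_in_elems by (force simp: is_root_def bij_betw_def)
  then show root: "h (tree_root T) = tree_root T'"
    using T'.is_root_iff by blast
  show "cluster A T' (h v) = cluster A T v" if "v \<in> elems T" for v
    using h(2)[symmetric] h(3)[OF that] T.label_nonroot by (auto simp: cluster_def nonroot_def)
  show "bij_betw h (nonroot T) (nonroot T')"
    unfolding nonroot_def root[symmetric]
    using bij_betw_DiffI[OF h(1), of "{tree_root T}" "{h (tree_root T)}"] T.root_in_elems T'.root_in_elems
      h(1) by (auto simp: bij_betw_def inj_on_def)
qed

text \<open>Conversely, matching elements with equal clusters is the only possible isomorphism off
  the root; it respects the order because the order is inclusion of clusters, and the labels because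
  a labelled leaf has a singleton cluster.\<close>

lemma tree_iso_iff_clusters:
  assumes "T \<in> labelled_trees A" "T' \<in> labelled_trees A"
  shows "(\<exists>h. tree_iso A T T' h) \<longleftrightarrow> clusters A T = clusters A T'"
proof
  interpret T: labelled_tree A T by standard (rule assms)
  interpret T': labelled_tree A T' by standard (rule assms)
  {
    assume "\<exists>h. tree_iso A T T' h"
    then obtain h where h: "tree_iso A T T' h" ..
    note * = tree_isoD[OF assms h]
    have "clusters A T' = (\<lambda>v. cluster A T' (h v)) ` nonroot T"
      using *(3) by (simp add: clusters_def bij_betw_def flip: image_image)
    also have "\<dots> = clusters A T"
      unfolding clusters_def by (rule image_cong[OF refl *(2)]) (simp add: nonroot_def)
    finally show "clusters A T = clusters A T'" ..
  next
    assume eq: "clusters A T = clusters A T'"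
    define g where "g = inv_into (nonroot T') (cluster A T') \<circ> cluster A T"
    have g: "bij_betw g (nonroot T) (nonroot T')"
      unfolding g_def
    proof (rule bij_betw_trans)
      show "bij_betw (cluster A T) (nonroot T) (clusters A T)"
        using T.inj_on_cluster by (simp add: bij_betw_def clusters_def)
      show "bij_betw (inv_into (nonroot T') (cluster A T')) (clusters A T) (nonroot T')"
        unfolding eq using T'.inj_on_cluster by (intro bij_betw_inv_into) (simp add: bij_betw_def clusters_def)
    qed
    have cl: "cluster A T' (g v) = cluster A T v" if "v \<in> nonroot T" for v
      using that eq unfolding g_def o_def clusters_def by (intro f_inv_into_f) blast
    define h where "h v = (if v = tree_root T then tree_root T' else g v)" for v
    have hg: "h v = g v" "g v \<in> nonroot T'" if "v \<in> nonroot T" for v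
      using that g by (auto simp: h_def nonroot_def bij_betw_def)
    have hr: "h (tree_root T) = tree_root T'"
      by (simp add: h_def)
    have "bij_betw h (nonroot T) (nonroot T')"
      using g hg(1) by (simp cong: bij_betw_cong)
    then have bij: "bij_betw h (elems T) (elems T')"
      unfolding T.elems_eq T'.elems_eq
      using hr notIn_Un_bij_betw[of "tree_root T" "nonroot T" h "nonroot T'"] by (simp add: nonroot_def)
    have le: "(s, t) \<in> tree_le T \<longleftrightarrow> (h s, h t) \<in> tree_le T'" if "s \<in> elems T" "t \<in> elems T" for s t
    proof -
      have "h v = tree_root T' \<longleftrightarrow> v = tree_root T" if "v \<in> elems T" for v
      proof (cases "v = tree_root T")
        case False
        then have "v \<in> nonroot T"
          using that by (simp add: nonroot_def)
        from hg[OF this] False show ?thesis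
          by (simp add: nonroot_def)
      qed (simp add: hr)
      moreover have "h s \<in> elems T'" "h t \<in> elems T'"
        using bij that by (auto simp: bij_betw_def)
      moreover have "cluster A T' (h v) = cluster A T v" if "v \<in> elems T" "v \<noteq> tree_root T" for v
        using that hg[of v] cl[of v] by (simp add: nonroot_def)
      ultimately show ?thesis
        using T.le_iff_cluster[OF that] T'.le_iff_cluster[of "h s" "h t"] that by auto
    qed
    have "h (label T a) = label T' a" if a: "a \<in> A" for a
    proof -
      have "cluster A T' (h (label T a)) = cluster A T' (label T' a)"
        using hg cl T.label_nonroot[OF a] T.cluster_label[OF a] T'.cluster_label[OF a] by simp
      then show ?thesis
        using T'.inj_on_cluster hg T.label_nonroot[OF a] T'.label_nonroot[OF a] by (auto simp: inj_on_def)
    qed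
    with bij le show "\<exists>h. tree_iso A T T' h"
      unfolding tree_iso_def by blast
  }
qed

definition same_clusters :: "'a set \<Rightarrow> ('a ltree \<times> 'a ltree) set" where
  "same_clusters A =
     {(T, T'). T \<in> labelled_trees A \<and> T' \<in> labelled_trees A \<and> clusters A T = clusters A T'}"

lemma tree_classes_eq: "tree_classes A = labelled_trees A // same_clusters A"
proof -
  have "{(T, T'). T \<in> labelled_trees A \<and> T' \<in> labelled_trees A \<and> (\<exists>h. tree_iso A T T' h)} =
      same_clusters A"
    using tree_iso_iff_clusters unfolding same_clusters_def by blast
  then show ?thesis
    by (simp only: tree_classes_def)
qed

text \<open>The arbitrary choice in \<open>rep\<close> is controlled only through clusters, which
  are constant on a class.\<close>

lemma rep_of_class:
  assumes "T \<in> labelled_trees A"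
  shows "\<exists>c\<in>tree_classes A. clusters A (rep c) = clusters A T"
proof
  let ?c = "same_clusters A `` {T}"
  show "?c \<in> tree_classes A"
    unfolding tree_classes_eq using assms by (rule quotientI)
  have "T \<in> ?c"
    using assms by (simp add: same_clusters_def)
  then have "rep ?c \<in> ?c"
    unfolding rep_def by (rule someI)
  then have "(T, rep ?c) \<in> same_clusters A"
    by (rule ImageE) simp
  then show "clusters A (rep ?c) = clusters A T"
    unfolding same_clusters_def by blast
qed

lemma tree_class_eq:
  assumes "c \<in> tree_classes A"
  shows "rep c \<in> labelled_trees A"
    and "c = {T \<in> labelled_trees A. clusters A T = clusters A (rep c)}"
proof -
  obtain T where T: "T \<in> labelled_trees A" "c = same_clusters A `` {T}"
    using assms unfolding tree_classes_eq by (rule quotientE)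
  then have "T \<in> c"
    by (simp add: same_clusters_def)
  then have "rep c \<in> c"
    unfolding rep_def by (rule someI)
  then show "rep c \<in> labelled_trees A"
    "c = {T \<in> labelled_trees A. clusters A T = clusters A (rep c)}"
    using T by (auto simp: same_clusters_def)
qed

lemma inj_on_clusters_rep: "inj_on (\<lambda>c. clusters A (rep c)) (tree_classes A)"
  by (rule inj_onI) (metis tree_class_eq(2))

lemma finite_tree_classes:
  assumes "finite A"
  shows "finite (tree_classes A)"
proof (rule inj_on_finite[OF inj_on_clusters_rep])
  show "(\<lambda>c. clusters A (rep c)) ` tree_classes A \<subseteq> Pow (Pow A)"
    by (auto simp: clusters_def cluster_def)
qed (use assms in simp)

section \<open>The bar construction\<close>

text \<open>In a labelled tree the sum has at most one term; writing it as a sum gives the value 0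
  at sets that are no cluster, without choosing an edge.\<close>

definition tree_weight :: "'a set \<Rightarrow> 'a ltree \<Rightarrow> (edge \<Rightarrow> real) \<Rightarrow> 'a set \<Rightarrow> real" where
  "tree_weight A T w = (\<lambda>C. \<Sum>e | e \<in> edges T \<and> cluster A T (snd e) = C. w e)"

text \<open>The unique tuple off the fat wedge, that is, the non-basepoint of the smash product of
  copies of \<open>S^0\<close>.\<close>

definition all_true :: "'a ltree \<Rightarrow> nat \<Rightarrow> bool" where
  "all_true T = (\<lambda>v\<in>verts T. True)"

definition weighting_of :: "'a set \<Rightarrow> 'a ltree \<Rightarrow> ('a set \<Rightarrow> real) \<Rightarrow> edge \<Rightarrow> real" where
  "weighting_of A T W = (\<lambda>e\<in>edges T. W (cluster A T (snd e)))"

context labelled_tree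
begin

lemma finite_labels: "finite A"
  using finite_elems bij_betw_finite[OF bij_label] by (simp add: leaves_def)

lemma tree_weight_cluster:
  assumes "e \<in> edges T"
  shows "tree_weight A T w (cluster A T (snd e)) = w e"
proof -
  have "{e' \<in> edges T. cluster A T (snd e') = cluster A T (snd e)} = {e}"
    using assms inj_on_edge_cluster by (auto simp: inj_on_def)
  then show ?thesis
    by (simp add: tree_weight_def)
qed

lemma tree_weight_outside: "C \<notin> clusters A T \<Longrightarrow> tree_weight A T w C = 0"
  unfolding tree_weight_def edge_cluster_image[symmetric] by (intro sum.neutral) blast

lemma edge_of_cluster: "C \<in> clusters A T \<Longrightarrow> \<exists>e\<in>edges T. C = cluster A T (snd e)"
  unfolding edge_cluster_image[symmetric] by auto

text \<open>The edges on the path from the root to the leaf of \<open>a\<close> are those whose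
  cluster contains \<open>a\<close>, so mass 1 is the same condition as distance 1.\<close>

lemma tree_weight_mass:
  assumes "a \<in> A"
  shows "(\<Sum>C | C \<subseteq> A \<and> a \<in> C. tree_weight A T w C) =
    (\<Sum>e | e \<in> edges T \<and> (snd e, label T a) \<in> tree_le T. w e)"
proof -
  let ?E = "{e \<in> edges T. (snd e, label T a) \<in> tree_le T}"
  have E: "e \<in> ?E \<longleftrightarrow> e \<in> edges T \<and> a \<in> cluster A T (snd e)" for e
    using assms by (simp add: cluster_def)
  have "(\<Sum>C | C \<subseteq> A \<and> a \<in> C. tree_weight A T w C) =
      (\<Sum>C | C \<subseteq> A \<and> a \<in> C. \<Sum>e | e \<in> ?E \<and> cluster A T (snd e) = C. w e)"
  proof (rule sum.cong[OF refl])
    fix C assume "C \<in> {C. C \<subseteq> A \<and> a \<in> C}"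
    then have "{e. e \<in> edges T \<and> cluster A T (snd e) = C} = {e. e \<in> ?E \<and> cluster A T (snd e) = C}"
      unfolding E by auto
    then show "tree_weight A T w C = (\<Sum>e | e \<in> ?E \<and> cluster A T (snd e) = C. w e)"
      by (simp only: tree_weight_def)
  qed
  also have "\<dots> = sum w ?E"
  proof (rule sum.group)
    show "(\<lambda>e. cluster A T (snd e)) ` ?E \<subseteq> {C. C \<subseteq> A \<and> a \<in> C}"
      using assms by (auto simp: cluster_def)
  qed (use finite_edges finite_labels in auto)
  finally show ?thesis .
qed

lemma tree_weight_in_set_weights:
  assumes "w \<in> weightings T"
  shows "tree_weight A T w \<in> set_weights A 1"
  unfolding set_weights_def
proof (intro CollectI conjI allI impI ballI)
  have w: "0 \<le> w e" if "e \<in> edges T" for e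
    using assms that by (auto simp: weightings_def PiE_iff)
  show "0 \<le> tree_weight A T w C" for C
    unfolding tree_weight_def using w by (intro sum_nonneg) auto
  have cl: "C \<in> clusters A T" if "tree_weight A T w C \<noteq> 0" for C
    using that tree_weight_outside by blast
  show "C \<subseteq> A" "C \<noteq> {}" if "tree_weight A T w C \<noteq> 0" for C
    using cl[OF that] hierarchy_clusters by (auto simp: hierarchy_def)
  show "C \<subseteq> D \<or> D \<subseteq> C"
    if "tree_weight A T w C \<noteq> 0" "tree_weight A T w D \<noteq> 0" "C \<inter> D \<noteq> {}" for C D
    using cl[OF that(1)] cl[OF that(2)] that(3) hierarchy_clusters by (simp add: hierarchy_def)
  fix a assume a: "a \<in> A"
  show "(\<Sum>C | C \<subseteq> A \<and> a \<in> C. tree_weight A T w C) = 1"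
    using assms label_in_leaves[OF a] by (simp add: tree_weight_mass[OF a] weightings_def)
qed

text \<open>The clusters of outer edges are \<open>A\<close> and the singletons, which are exactly
  the sets that enter the density.\<close>

lemma density_tree_weight_eq_0_iff:
  "density A (tree_weight A T w) = 0 \<longleftrightarrow> w \<in> degenerate T"
proof
  assume "density A (tree_weight A T w) = 0"
  then obtain C where C: "C = A \<or> (\<exists>a\<in>A. C = {a})" "tree_weight A T w C = 0"
    using finite_labels by (auto simp: density_def)
  then have "C \<in> clusters A T"
    using hierarchy_clusters by (auto simp: hierarchy_def)
  then obtain e where e: "e \<in> edges T" "C = cluster A T (snd e)"
    using edge_of_cluster by blast
  with C have "e \<in> outer_edges T" "w e = 0"
    using outer_edge_iff[OF e(1)] tree_weight_cluster[OF e(1)] by auto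
  then show "w \<in> degenerate T"
    by (auto simp: degenerate_def)
next
  assume "w \<in> degenerate T"
  then obtain e where e: "e \<in> outer_edges T" "w e = 0"
    by (auto simp: degenerate_def)
  then have "e \<in> edges T"
    by (simp add: outer_edges_def)
  with e have "tree_weight A T w (cluster A T (snd e)) = 0"
    "cluster A T (snd e) = A \<or> (\<exists>a\<in>A. cluster A T (snd e) = {a})"
    using outer_edge_iff tree_weight_cluster by auto
  then show "density A (tree_weight A T w) = 0"
    using finite_labels by (auto simp: density_def)
qed

lemma
  assumes "W \<in> set_weights A 1" "\<And>C. W C \<noteq> 0 \<Longrightarrow> C \<in> clusters A T"
  shows tree_weight_weighting_of: "tree_weight A T (weighting_of A T W) = W"
    and weighting_of_in_weightings: "weighting_of A T W \<in> weightings T"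
proof -
  show eq: "tree_weight A T (weighting_of A T W) = W"
  proof
    fix C
    show "tree_weight A T (weighting_of A T W) C = W C"
    proof (cases "C \<in> clusters A T")
      case True
      then obtain e where "e \<in> edges T" "C = cluster A T (snd e)"
        using edge_of_cluster by blast
      then show ?thesis
        by (simp add: tree_weight_cluster weighting_of_def)
    next
      case False
      then show ?thesis
        using assms(2) tree_weight_outside by metis
    qed
  qed
  have "(\<Sum>e | e \<in> edges T \<and> (snd e, label T a) \<in> tree_le T. weighting_of A T W e) = 1"
    if "a \<in> A" for a
    using tree_weight_mass[OF that, of "weighting_of A T W"] assms(1) that
    by (simp add: eq set_weights_def)
  moreover have "weighting_of A T W \<in> edges T \<rightarrow>\<^sub>E {0..}"
    using assms(1) by (auto simp: weighting_of_def set_weights_def)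
  ultimately show "weighting_of A T W \<in> weightings T"
    unfolding weightings_def using leaf_label by blast
qed

lemma weighting_le_1:
  assumes "w \<in> weightings T" "e \<in> edges T"
  shows "w e \<le> 1"
proof -
  have w: "0 \<le> w e" if "e \<in> edges T" for e
    using assms(1) that by (auto simp: weightings_def PiE_iff)
  obtain l where l: "l \<in> leaves T" "snd e \<sqsubseteq> l"
    using leaf_above[of "snd e"] edge_snd_nonroot[OF assms(2)] by (auto simp: nonroot_def)
  have "w e \<le> (\<Sum>e | e \<in> edges T \<and> (snd e, l) \<in> tree_le T. w e)"
    using assms(2) l finite_edges w by (intro member_le_sum) auto
  also have "\<dots> = 1"
    using assms(1) l(1) by (simp add: weightings_def)
  finally show ?thesis .
qed

lemma compact_space_weight_space: "compact_space (weight_space T)"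
  unfolding weight_space_def
proof (rule compact_space_subtopology[OF closed_compactin])
  let ?X = "powertop_real (edges T)"
  show "compactin ?X (edges T \<rightarrow>\<^sub>E {0..1})"
    by (simp add: compactin_PiE)
  show "weightings T \<subseteq> edges T \<rightarrow>\<^sub>E {0..1}"
  proof
    fix w assume w: "w \<in> weightings T"
    then show "w \<in> edges T \<rightarrow>\<^sub>E {0..1}"
      using weighting_le_1[OF w] by (auto simp: weightings_def PiE_iff)
  qed
  have "closedin ?X {w \<in> topspace ?X. w e \<in> {0..}}" if "e \<in> edges T" for e
    using that by (intro closedin_continuous_map_preimage[of _ euclideanreal]
        continuous_map_product_projection) auto
  moreover have "continuous_map ?X euclideanreal
      (\<lambda>w. \<Sum>e | e \<in> edges T \<and> (snd e, l) \<in> tree_le T. w e)" for l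
    using finite_edges by (intro continuous_map_sum) (auto intro: continuous_map_product_projection)
  then have "closedin ?X {w \<in> topspace ?X.
      (\<Sum>e | e \<in> edges T \<and> (snd e, l) \<in> tree_le T. w e) \<in> {1}}" for l
    by (rule closedin_continuous_map_preimage) simp
  \<comment> \<open>The constraints are closed conditions indexed by edges and leaves; adding the
    whole space makes the family visibly nonempty.\<close>
  ultimately have "closedin ?X (\<Inter> (insert (topspace ?X) (
      (\<lambda>e. {w \<in> topspace ?X. w e \<in> {0..}}) ` edges T \<union>
      (\<lambda>l. {w \<in> topspace ?X. (\<Sum>e | e \<in> edges T \<and> (snd e, l) \<in> tree_le T. w e) \<in> {1}}) ` leaves T)))"
    using closedin_topspace[of ?X] by (intro closedin_Inter) auto
  moreover have "\<Inter> (insert (topspace ?X) (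
      (\<lambda>e. {w \<in> topspace ?X. w e \<in> {0..}}) ` edges T \<union>
      (\<lambda>l. {w \<in> topspace ?X. (\<Sum>e | e \<in> edges T \<and> (snd e, l) \<in> tree_le T. w e) \<in> {1}}) ` leaves T))
    = weightings T" (is "?I = _")
  proof (rule Set.set_eqI)
    fix w
    have "w \<in> ?I \<longleftrightarrow> w \<in> topspace ?X \<and> (\<forall>e\<in>edges T. 0 \<le> w e) \<and>
        (\<forall>l\<in>leaves T. (\<Sum>e | e \<in> edges T \<and> (snd e, l) \<in> tree_le T. w e) = 1)"
      by blast
    then show "w \<in> ?I \<longleftrightarrow> w \<in> weightings T"
      by (simp add: weightings_def PiE_iff) blast
  qed
  ultimately show "closedin ?X (weightings T)"
    by simp
qed

lemma finite_verts: "finite (verts T)"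
  using finite_elems by (simp add: verts_def)

end

section \<open>The summands of the bar construction for \<open>S0_operad\<close>\<close>

lemma fat_wedge_S0: "fat_wedge I (\<lambda>v. space_of S0_operad (B v)) = {x. \<exists>v\<in>I. \<not> x v}"
  by (simp add: fat_wedge_def S0_operad_def sphere0_def)

lemma all_true_not_in_fat_wedge [simp]:
  "all_true T \<notin> fat_wedge (verts T) (\<lambda>v. space_of S0_operad (B v))"
  by (simp add: fat_wedge_S0 all_true_def)

lemma tree_smash_S0:
  assumes "finite (verts T)"
  shows "tree_smash S0_operad T = (discrete_topology {None, Some (all_true T)}, None)"
proof -
  let ?X = "discrete_topology (verts T \<rightarrow>\<^sub>E (UNIV :: bool set))"
  let ?S = "fat_wedge (verts T) (\<lambda>v. space_of S0_operad (incoming T v))"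
  have "product_topology (\<lambda>v. fst (space_of (S0_operad :: (edge, bool) operad) (incoming T v))) (verts T) = ?X"
    using product_topology_discrete_finite[OF assms, of "\<lambda>_. UNIV :: bool set"]
    by (simp add: S0_operad_def sphere0_def)
  then have eq: "tree_smash S0_operad T = collapse_space ?X ?S"
    by (simp add: tree_smash_def Smash_def kification_discrete)
  have pts: "(verts T \<rightarrow>\<^sub>E UNIV) - ?S = {all_true T}"
  proof
    show "(verts T \<rightarrow>\<^sub>E UNIV) - ?S \<subseteq> {all_true T}"
    proof
      fix x assume "x \<in> (verts T \<rightarrow>\<^sub>E UNIV) - ?S"
      then have "x v = all_true T v" for v
        by (cases "v \<in> verts T") (auto simp: fat_wedge_S0 all_true_def PiE_iff extensional_def)
      then show "x \<in> {all_true T}"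
        by auto
    qed
    show "{all_true T} \<subseteq> (verts T \<rightarrow>\<^sub>E UNIV) - ?S"
      using all_true_not_in_fat_wedge by (auto simp: all_true_def)
  qed
  have "openin (fst (collapse_space ?X ?S)) U \<longleftrightarrow> U \<subseteq> {None, Some (all_true T)}" for U
    by (auto simp: collapse_space_def openin_final_topology pts)
  then have "fst (collapse_space ?X ?S) = discrete_topology {None, Some (all_true T)}"
    by (simp add: topology_eq)
  then show ?thesis
    unfolding eq by (metis prod.collapse snd_collapse_space)
qed

definition tree_map :: "'a set \<Rightarrow> ('a, bool) bar_point \<Rightarrow> 'a set \<Rightarrow> real" where
  "tree_map A = (\<lambda>(c, z). case z of
     Some (Some w, Some _) \<Rightarrow> scaled A (tree_weight A (rep c) w) | _ \<Rightarrow> \<lambda>_. 0)"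

lemma tree_map_simps [simp]:
  "tree_map A (c, None) = (\<lambda>_. 0)"
  "tree_map A (c, Some (None, y)) = (\<lambda>_. 0)"
  "tree_map A (c, Some (z, None)) = (\<lambda>_. 0)"
  "tree_map A (c, Some (Some w, Some x)) = scaled A (tree_weight A (rep c) w)"
  by (auto simp: tree_map_def split: option.splits)

abbreviation wedge_axes :: "('x option \<times> 'y option) set" where
  "wedge_axes \<equiv> {(x, y). x = None \<or> y = None}"

lemma rep_labelled_tree: "c \<in> tree_classes A \<Longrightarrow> labelled_tree A (rep c)"
  by standard (rule tree_class_eq)

lemma compact_space_wbar:
  assumes "c \<in> tree_classes A"
  shows "compact_space (fst (wbar (rep c)))"
  unfolding wbar_def
  using labelled_tree.compact_space_weight_space[OF rep_labelled_tree[OF assms]]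
  by (rule compact_space_collapse_space)

text \<open>Both factors are compact, so k-ification changes nothing and the summand is an ordinary
  collapse of a product with two points.\<close>

lemma bar_summand:
  assumes "c \<in> tree_classes A"
  shows "smash (wbar (rep c)) (tree_smash S0_operad (rep c)) =
      collapse_space (prod_topology (fst (wbar (rep c))) (discrete_topology {None, Some (all_true (rep c))}))
        wedge_axes"
proof -
  interpret labelled_tree A "rep c"
    by (rule rep_labelled_tree[OF assms])
  have "compact_space (prod_topology (fst (wbar (rep c))) (discrete_topology {None, Some (all_true (rep c))}))"
    using compact_space_wbar[OF assms]
    by (simp add: compact_space_prod_topology compact_space_discrete_topology)
  moreover have "snd (wbar (rep c)) = None"
    by (simp add: wbar_def)
  ultimately show ?thesis
    by (simp add: smash_def tree_smash_S0[OF finite_verts] kification_compact_space)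
qed

lemma topspace_weight_space: "topspace (weight_space T) = weightings T"
  unfolding weight_space_def weightings_def by (auto simp: PiE_iff extensional_def)

lemma mem_bar_sum:
  "(c, z) \<in> topspace (bar_sum S0_operad A) \<longleftrightarrow> c \<in> tree_classes A \<and>
    (z = None \<or> (\<exists>w. z = Some (Some w, Some (all_true (rep c))) \<and>
      w \<in> weightings (rep c) \<and> w \<notin> degenerate (rep c)))"
proof (cases "c \<in> tree_classes A")
  case True
  then show ?thesis
    by (auto simp: bar_sum_def bar_summand[OF True]) (auto simp: wbar_def topspace_weight_space)
qed (simp add: bar_sum_def)

lemma compact_space_bar_summand:
  assumes "c \<in> tree_classes A"
  shows "compact_space (fst (smash (wbar (rep c)) (tree_smash S0_operad (rep c))))"
  unfolding bar_summand[OF assms] using compact_space_wbar[OF assms]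
  by (intro compact_space_collapse_space)
    (simp add: compact_space_prod_topology compact_space_discrete_topology)

lemma compactin_bar_sum:
  assumes "finite A"
  shows "compactin (bar_sum S0_operad A) (topspace (bar_sum S0_operad A))"
  unfolding bar_sum_def topspace_sum_topology
  using finite_tree_classes[OF assms] by (intro compactin_sum_topology compact_space_bar_summand) auto

lemma continuous_map_tree_weight:
  assumes "c \<in> tree_classes A"
  shows "continuous_map (weight_space (rep c)) (weight_model A) (\<lambda>w. scaled A (tree_weight A (rep c) w))"
proof -
  interpret labelled_tree A "rep c"
    by (rule rep_labelled_tree[OF assms])
  show ?thesis
  proof (rule continuous_map_scaled[OF finite_labels])
    show "continuous_map (weight_space (rep c)) euclideanreal (\<lambda>w. tree_weight A (rep c) w C)" for C
      unfolding weight_space_def tree_weight_def using finite_edges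
      by (intro continuous_map_from_subtopology continuous_map_sum)
        (auto intro: continuous_map_product_projection)
  qed (simp add: topspace_weight_space tree_weight_in_set_weights)
qed

text \<open>Continuity is checked by undoing the constructions from outside in: the smash product,
  the discrete factor \<open>S^0\<close>, and the collapse of degenerate weightings.\<close>

lemma continuous_map_tree_map:
  "continuous_map (bar_sum S0_operad A) (weight_model A) (tree_map A)"
  unfolding bar_sum_def continuous_map_sum_topology
proof
  fix c assume c: "c \<in> tree_classes A"
  interpret labelled_tree A "rep c"
    by (rule rep_labelled_tree[OF c])
  let ?Y = "weight_model A"
  have "continuous_map (fst (wbar (rep c))) ?Y (\<lambda>z. tree_map A (c, collapse_proj wedge_axes (z, s)))"
    if s: "s \<in> {None, Some (all_true (rep c))}" for s
  proof (cases s)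
    case None
    then have "(\<lambda>z. tree_map A (c, collapse_proj wedge_axes (z, s))) = (\<lambda>_ _. 0)"
      by (simp add: collapse_proj_def)
    then show ?thesis
      by simp
  next
    case (Some x)
    \<comment> \<open>One formula serves on both sides of the collapse, since the density vanishes
      on degenerate weightings.\<close>
    have "tree_map A (c, collapse_proj wedge_axes (collapse_proj (degenerate (rep c)) w, s)) =
        scaled A (tree_weight A (rep c) w)" for w
      using density_tree_weight_eq_0_iff[of w] scaled_eq_0_iff[of A "tree_weight A (rep c) w"]
      by (cases "w \<in> degenerate (rep c)") (simp_all add: Some collapse_proj_def)
    then show ?thesis
      unfolding wbar_def using continuous_map_tree_weight[OF c]
      by (intro continuous_map_collapse_space) (simp_all add: collapse_proj_def)
  qed
  then have "continuous_map (prod_topology (fst (wbar (rep c))) (discrete_topology {None, Some (all_true (rep c))}))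
      ?Y (\<lambda>p. tree_map A (c, collapse_proj wedge_axes p))"
    by (rule continuous_map_prod_discrete_right)
  then show "continuous_map (fst (smash (wbar (rep c)) (tree_smash S0_operad (rep c)))) ?Y
      (\<lambda>z. tree_map A (c, z))"
    unfolding bar_summand[OF c] by (rule continuous_map_collapse_space) simp
qed

lemma class_of_hierarchy:
  assumes "finite A" "hierarchy A H"
  shows "\<exists>c\<in>tree_classes A. clusters A (rep c) = H"
proof -
  obtain T where T: "T \<in> labelled_trees A" "clusters A T = H"
    using hierarchy_realized[OF assms] by blast
  from rep_of_class[OF T(1)] T(2) show ?thesis
    by simp
qed

lemma hierarchy_trivial: "A \<noteq> {} \<Longrightarrow> hierarchy A (insert A ((\<lambda>a. {a}) ` A))"
  by (auto simp: hierarchy_def)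

lemma tree_classes_nonempty:
  assumes "finite A" "A \<noteq> {}"
  shows "tree_classes A \<noteq> {}"
  using class_of_hierarchy[OF assms(1) hierarchy_trivial[OF assms(2)]] by blast

text \<open>Nonzero density is what puts \<open>A\<close> and all singletons into the support; the
  other conditions are those of a weight.\<close>

lemma hierarchy_support:
  assumes "finite A" "W \<in> set_weights A 1" "density A W \<noteq> 0"
  shows "hierarchy A {C. W C \<noteq> 0}"
  using assms by (auto simp: hierarchy_def set_weights_def density_def)

lemma tree_map_onto:
  assumes "finite A" "A \<noteq> {}"
  shows "topspace (weight_model A) \<subseteq> tree_map A ` topspace (bar_sum S0_operad A)"
proof
  obtain c where "c \<in> tree_classes A"
    using tree_classes_nonempty[OF assms] by blast
  then have "(c, None) \<in> topspace (bar_sum S0_operad A)"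
    by (simp add: mem_bar_sum)
  then have zero: "(\<lambda>_. 0) \<in> tree_map A ` topspace (bar_sum S0_operad A)"
    by (rule rev_image_eqI) simp
  fix y assume "y \<in> topspace (weight_model A)"
  then consider "y = (\<lambda>_. 0)" | W where "W \<in> set_weights A 1" "y = scaled A W"
    by auto
  then show "y \<in> tree_map A ` topspace (bar_sum S0_operad A)"
  proof cases
    case 2
    show ?thesis
    proof (cases "density A W = 0")
      case True
      then have "y = (\<lambda>_. 0)"
        unfolding 2 by (simp only: scaled_eq_0_iff)
      with zero show ?thesis
        by simp
    next
      case False
      \<comment> \<open>The tree is taken with the support itself as its set of clusters, so all its
        edges get positive length.\<close>
      obtain c where c: "c \<in> tree_classes A" "clusters A (rep c) = {C. W C \<noteq> 0}"
        using class_of_hierarchy[OF assms(1) hierarchy_support[OF assms(1) 2(1) False]] by blast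
      interpret labelled_tree A "rep c"
        by (rule rep_labelled_tree[OF c(1)])
      let ?w = "weighting_of A (rep c) W"
      have w: "tree_weight A (rep c) ?w = W" "?w \<in> weightings (rep c)"
        using 2(1) c(2) by (auto intro: tree_weight_weighting_of weighting_of_in_weightings)
      moreover have "?w \<notin> degenerate (rep c)"
        using False w(1) density_tree_weight_eq_0_iff[of ?w] by simp
      ultimately have "(c, Some (Some ?w, Some (all_true (rep c)))) \<in> topspace (bar_sum S0_operad A)"
        using c(1) by (simp add: mem_bar_sum)
      then show ?thesis
        by (rule rev_image_eqI) (simp add: 2 w(1))
    qed
  qed (use zero in simp)
qed

section \<open>Edge contraction for \<open>S0_operad\<close>\<close>

context labelled_tree
begin

lemma collapse_empty: "collapse T {} = T"
proof -
  have "tree_le T \<inter> elems T \<times> elems T = tree_le T"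
    using le_elems by auto
  then show ?thesis
    by (simp add: collapse_def)
qed

lemma collapse_collapse: "collapse (collapse T F) G = collapse T (F \<union> G)"
proof -
  have "Restr (Restr (tree_le T) (elems T - snd ` F)) (elems T - snd ` F - snd ` G) =
      Restr (tree_le T) (elems T - snd ` (F \<union> G))"
    by blast
  moreover have "elems T - snd ` F - snd ` G = elems T - snd ` (F \<union> G)"
    by blast
  ultimately show ?thesis
    by (simp add: collapse_def)
qed

lemma snd_in_image_iff:
  assumes "e \<in> edges T" "F \<subseteq> edges T"
  shows "snd e \<in> snd ` F \<longleftrightarrow> e \<in> F"
  using assms inj_on_snd_edges by (simp add: inj_on_image_mem_iff)

lemma internal_edges_subset: "internal_edges T \<subseteq> edges T"
  by (auto simp: internal_edges_def)

lemma verts_collapse: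
  assumes "F \<subseteq> internal_edges T"
  shows "v \<in> verts (collapse T F) \<longleftrightarrow> v \<in> verts T \<and> v \<notin> snd ` F"
proof -
  interpret C: labelled_tree A "collapse T F"
    by standard (rule collapse_labelled[OF assms])
  show ?thesis
    unfolding C.verts_iff verts_iff nonroot_collapse[OF assms]
    using cluster_collapse[OF assms, of v] by (cases "v \<in> nonroot T - snd ` F") (simp_all, blast+)
qed

lemma contract_edge_all_true:
  assumes "F \<subseteq> internal_edges T" "e \<in> internal_edges T - F"
  shows "contract_edge S0_operad (collapse T F) (edge_below (collapse T F) (snd e)) (all_true (collapse T F)) =
    all_true (collapse T (insert e F))"
proof -
  let ?C = "collapse T F"
  interpret C: labelled_tree A ?C
    by standard (rule collapse_labelled[OF assms(1)])
  have e: "e \<in> edges T" "cluster A T (snd e) \<noteq> A" "\<And>a. a \<in> A \<Longrightarrow> cluster A T (snd e) \<noteq> {a}"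
    using assms(2) internal_edge_iff[of e] by auto
  have "snd e \<notin> snd ` F"
    using snd_in_image_iff[OF e(1)] assms internal_edges_subset by auto
  then have v: "snd e \<in> nonroot T - snd ` F"
    using edge_snd_nonroot[OF e(1)] by simp
  then have vC: "snd e \<in> nonroot ?C" "cluster A ?C (snd e) = cluster A T (snd e)"
    by (simp_all add: nonroot_collapse[OF assms(1)] cluster_collapse[OF assms(1)])
  obtain u where u: "edge_below ?C (snd e) = (u, snd e)" "(u, snd e) \<in> edges ?C"
    using C.edge_below[OF vC(1)] by (metis prod.collapse)
  \<comment> \<open>\<open>all_true\<close> has the value \<open>True\<close> only at vertices, so
    both ends of the contracted edge must be shown to be vertices. The lower end is looked up in the
    partly collapsed tree, where it may have moved down.\<close>
  have "u \<in> verts ?C"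
  proof -
    have less: "strict_in (tree_le ?C) u (snd e)"
      using u(2) C.edge_iff by blast
    have "u \<noteq> tree_root ?C"
      using C.root_edge_iff[OF u(2)] vC(2) e(2) by simp
    moreover have "u \<in> elems ?C"
      using C.less_elems[OF less] by blast
    moreover have "u \<notin> leaves ?C"
      using less by (auto simp: leaves_def)
    ultimately show ?thesis
      by (simp add: verts_def)
  qed
  moreover have "snd e \<in> verts ?C"
    using vC e(3) by (simp add: C.verts_iff)
  moreover have "collapse ?C {(u, snd e)} = collapse T (insert e F)"
    unfolding collapse_collapse by (simp add: collapse_def)
  moreover have "v \<in> verts ?C" if "v \<in> verts (collapse T (insert e F))" for v
    using that assms by (simp add: verts_collapse)
  ultimately show ?thesis
    by (auto simp: contract_edge_def u(1) all_true_def S0_operad_def restrict_def fun_eq_iff)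
qed

lemma contracts_S0:
  assumes "contracts S0_operad T F x y"
  shows "F \<subseteq> internal_edges T \<and>
    (x = None \<longrightarrow> y = None) \<and> (x = Some (all_true T) \<longrightarrow> y = Some (all_true (collapse T F)))"
  using assms
proof induction
  case (none x)
  then show ?case
    by (simp add: collapse_empty)
next
  case (step F x y e)
  then have "contract_edge S0_operad (collapse T F) (edge_below (collapse T F) (snd e)) (all_true (collapse T F)) =
      all_true (collapse T (insert e F))"
    by (intro contract_edge_all_true) auto
  with step show ?case
    by (auto simp: to_tree_smash_def collapse_map_def collapse_proj_def)
qed

text \<open>Contraction is a relation, so a value has to be produced: add the edges of the finite
  set \<open>F\<close> one at a time.\<close>

lemma contracts_exists:
  assumes "F \<subseteq> internal_edges T"
  shows "\<exists>y. contracts P T F x y"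
proof -
  have "finite F"
    using assms internal_edges_subset finite_edges finite_subset by metis
  then show ?thesis
    using assms
  proof (induction F)
    case (insert e F)
    then show ?case
      using contracts.step[of P T F x _ e] by blast
  qed (blast intro: contracts.none)
qed

end

lemma transport_all_true:
  assumes "T \<in> labelled_trees A" "T' \<in> labelled_trees A" "tree_iso A T T' h"
  shows "transport S0_operad T T' h (all_true T) = all_true T'"
proof -
  interpret T: labelled_tree A T by standard (rule assms)
  interpret T': labelled_tree A T' by standard (rule assms)
  note iso = tree_isoD[OF assms]
  have "inv_into (elems T) h v \<in> verts T" if v: "v \<in> verts T'" for v
  proof -
    have bij: "bij_betw h (elems T) (elems T')"
      using assms(3) by (simp add: tree_iso_def)
    have v': "v \<in> elems T'" "v \<noteq> tree_root T'"
      using v by (auto simp: verts_def)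
    let ?u = "inv_into (elems T) h v"
    have u: "?u \<in> elems T" "h ?u = v"
      using bij v'(1) by (auto simp: bij_betw_def inv_into_into f_inv_into_f)
    then have "cluster A T ?u = cluster A T' v"
      using iso(2) by metis
    moreover have "?u \<noteq> tree_root T"
      using u(2) v'(2) iso(1) by metis
    ultimately show ?thesis
      using v u(1) unfolding T.verts_iff T'.verts_iff by (simp add: nonroot_def)
  qed
  then show ?thesis
    by (auto simp: transport_def all_true_def S0_operad_def restrict_def fun_eq_iff Let_def)
qed

text \<open>Under the identification of each tree smash with \<open>S^0\<close>, the structure map
  exists and is the identity. The coend for this operad is thus a gluing of the weight spaces
  alone.\<close>

lemma tree_smash_map_S0:
  assumes "T \<in> labelled_trees A" "T' \<in> labelled_trees A" "collapses A T' T F h"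
  shows "\<exists>y. tree_smash_map S0_operad T' T F h x y"
    and "tree_smash_map S0_operad T' T F h None y \<Longrightarrow> y = None"
    and "tree_smash_map S0_operad T' T F h (Some (all_true T')) y \<Longrightarrow> y = Some (all_true T)"
proof -
  interpret T': labelled_tree A T' by standard (rule assms)
  have F: "F \<subseteq> internal_edges T'" and iso: "tree_iso A (collapse T' F) T h"
    using assms(3) by (auto simp: collapses_def)
  show "\<exists>y. tree_smash_map S0_operad T' T F h x y"
    using T'.contracts_exists[OF F, of S0_operad x] by (auto simp: tree_smash_map_def)
  show "y = None" if "tree_smash_map S0_operad T' T F h None y"
  proof -
    obtain z where z: "contracts S0_operad T' F None z"
      "y = to_tree_smash S0_operad T (transport S0_operad (collapse T' F) T h) z"
      using \<open>tree_smash_map S0_operad T' T F h None y\<close> by (auto simp: tree_smash_map_def)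
    then show ?thesis
      using T'.contracts_S0[OF z(1)] by (simp add: to_tree_smash_def collapse_map_def)
  qed
  show "y = Some (all_true T)" if "tree_smash_map S0_operad T' T F h (Some (all_true T')) y"
  proof -
    obtain z where z: "contracts S0_operad T' F (Some (all_true T')) z"
      "y = to_tree_smash S0_operad T (transport S0_operad (collapse T' F) T h) z"
      using \<open>tree_smash_map S0_operad T' T F h (Some (all_true T')) y\<close> by (auto simp: tree_smash_map_def)
    then show ?thesis
      using T'.contracts_S0[OF z(1)] transport_all_true[OF T'.collapse_labelled[OF F] assms(1) iso]
      by (simp add: to_tree_smash_def collapse_map_def collapse_proj_def)
  qed
qed

text \<open>A surviving edge keeps its cluster and its length. A collapsed edge has length 0, and
  its cluster does not occur in the smaller tree, so both sides vanish there.\<close>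

lemma tree_weight_weight_map:
  assumes "T \<in> labelled_trees A" "T' \<in> labelled_trees A" "collapses A T' T F h"
  shows "tree_weight A T' (weight_map T T' F h w) = tree_weight A T w"
proof
  interpret T: labelled_tree A T by standard (rule assms)
  interpret T': labelled_tree A T' by standard (rule assms)
  have F: "F \<subseteq> internal_edges T'" and iso: "tree_iso A (collapse T' F) T h"
    using assms(3) by (auto simp: collapses_def)
  note C = T'.collapse_labelled[OF F]
  note isoD = tree_isoD[OF C assms(1) iso]
  have FE: "F \<subseteq> edges T'"
    using F T'.internal_edges_subset by blast
  have cl: "clusters A T = cluster A T' ` (nonroot T' - snd ` F)"
    using tree_iso_iff_clusters[OF C assms(1)] iso T'.clusters_collapse[OF F] by blast
  fix C
  show "tree_weight A T' (weight_map T T' F h w) C = tree_weight A T w C"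
  proof (cases "C \<in> clusters A T'")
    case False
    moreover have "clusters A T \<subseteq> clusters A T'"
      unfolding cl by (auto simp: clusters_def)
    ultimately show ?thesis
      using T.tree_weight_outside T'.tree_weight_outside by (metis subsetD)
  next
    case True
    then obtain e where e: "e \<in> edges T'" "C = cluster A T' (snd e)"
      using T'.edge_of_cluster by blast
    have sndF: "snd e \<in> snd ` F \<longleftrightarrow> e \<in> F"
      by (rule T'.snd_in_image_iff[OF e(1) FE])
    show ?thesis
    proof (cases "e \<in> F")
      case True
      have "C \<notin> clusters A T"
      proof
        assume "C \<in> clusters A T"
        then obtain v where v: "v \<in> nonroot T'" "v \<notin> snd ` F" "cluster A T' (snd e) = cluster A T' v"
          unfolding cl e(2) by blast
        then have "snd e = v"
          using inj_onD[OF T'.inj_on_cluster v(3) T'.edge_snd_nonroot[OF e(1)] v(1)] by simp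
        with v(2) sndF True show False
          by simp
      qed
      then show ?thesis
        using True e(1) T.tree_weight_outside T'.tree_weight_cluster[OF e(1)]
        by (simp add: e(2) weight_map_def)
    next
      case False
      then have v: "snd e \<in> nonroot T' - snd ` F"
        using sndF T'.edge_snd_nonroot[OF e(1)] by simp
      then have vC: "snd e \<in> nonroot (collapse T' F)"
        by (simp add: T'.nonroot_collapse[OF F])
      then have hv: "h (snd e) \<in> nonroot T"
        using isoD(3) by (auto simp: bij_betw_def)
      have "cluster A T (h (snd e)) = C"
        using isoD(2)[of "snd e"] vC T'.cluster_collapse[OF F v] by (simp add: e(2) nonroot_def)
      moreover have "tree_weight A T w (cluster A T (h (snd e))) = w (edge_below T (h (snd e)))"
        using T.edge_below[OF hv] T.tree_weight_cluster[of "edge_below T (h (snd e))" w] by simp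
      ultimately show ?thesis
        using False e T'.tree_weight_cluster[OF e(1), of "weight_map T T' F h w"]
        by (simp add: weight_map_def)
    qed
  qed
qed

lemma tree_map_invariant:
  assumes "(x, y) \<in> bar_rel S0_operad A"
  shows "tree_map A x = tree_map A y"
proof -
  consider c c' where "x = (c, None)" "y = (c', None)"
    | c c' F h w s t where "x = (c, smash_pair w t)"
      "y = (c', smash_pair (wbar_map (rep c) (rep c') F h w) s)"
      "c \<in> tree_classes A" "c' \<in> tree_classes A" "collapses A (rep c') (rep c) F h"
      "s \<in> topspace (fst (tree_smash S0_operad (rep c')))"
      "tree_smash_map S0_operad (rep c') (rep c) F h s t"
    using assms unfolding bar_rel_def Un_iff mem_Collect_eq prod.inject
  proof (elim disjE exE conjE, goal_cases)
    case (1 c c')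
    then show ?case
      by (intro that(1))
  next
    case (2 c c' F h w s t)
    then show ?case
      by (intro that(2))
  qed
  then show ?thesis
  proof cases
    case 2
    interpret T: labelled_tree A "rep c" by (rule rep_labelled_tree[OF 2(3)])
    interpret T': labelled_tree A "rep c'" by (rule rep_labelled_tree[OF 2(4)])
    note smash = tree_smash_map_S0[OF T.tree T'.tree 2(5)]
    \<comment> \<open>Since the structure map is the identity of \<open>S^0\<close>,
      \<open>s\<close> and \<open>t\<close> are basepoints together; only the last case carries
      weights.\<close>
    consider "w = None" | "s = None" "t = None"
      | w0 where "w = Some w0" "s = Some (all_true (rep c'))" "t = Some (all_true (rep c))"
      using 2(6,7) smash(2,3) tree_smash_S0[OF T'.finite_verts] by (cases w) auto
    then show ?thesis
    proof cases
      case 3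
      let ?w = "weight_map (rep c) (rep c') F h w0"
      have "tree_map A y = scaled A (tree_weight A (rep c') ?w)"
        using T'.density_tree_weight_eq_0_iff[of ?w] scaled_eq_0_iff[of A "tree_weight A (rep c') ?w"]
        by (cases "?w \<in> degenerate (rep c')")
          (simp_all add: 2(2) 3 smash_pair_def collapse_proj_def wbar_map_def collapse_map_def)
      also have "\<dots> = scaled A (tree_weight A (rep c) w0)"
        by (simp only: tree_weight_weight_map[OF T.tree T'.tree 2(5)])
      finally show ?thesis
        by (simp add: 2(1) 3 smash_pair_def collapse_proj_def)
    qed (simp_all add: 2(1,2) smash_pair_def collapse_proj_def wbar_map_def collapse_map_def)
  qed simp
qed

section \<open>Fibres of the comparison map on the bar construction\<close>

lemma bar_relI:
  assumes "c \<in> tree_classes A" "c' \<in> tree_classes A" "collapses A (rep c') (rep c) F h"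
    "w \<in> topspace (fst (wbar (rep c)))" "x \<in> topspace (fst (tree_smash P (rep c')))"
    "tree_smash_map P (rep c') (rep c) F h x y"
  shows "((c, smash_pair w y), (c', smash_pair (wbar_map (rep c) (rep c') F h w) x)) \<in> bar_rel P A"
  unfolding bar_rel_def using assms by blast

text \<open>\<open>c0\<close> is the class of the tree obtained by collapsing the internal edges of length zero.\<close>

lemma bar_point_reduces:
  assumes c: "c \<in> tree_classes A" and w: "w \<in> weightings (rep c)" "w \<notin> degenerate (rep c)"
  defines "W \<equiv> tree_weight A (rep c) w"
  shows "\<exists>c0\<in>tree_classes A. clusters A (rep c0) = {C. W C \<noteq> 0} \<and>
    ((c0, Some (Some (weighting_of A (rep c0) W), Some (all_true (rep c0)))),
      (c, Some (Some w, Some (all_true (rep c))))) \<in> bar_rel S0_operad A"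
proof -
  let ?T = "rep c"
  interpret T: labelled_tree A ?T by (rule rep_labelled_tree[OF c])
  have W: "W \<in> set_weights A 1"
    unfolding W_def by (rule T.tree_weight_in_set_weights[OF w(1)])
  define F where "F = {e \<in> internal_edges ?T. w e = 0}"
  have F: "F \<subseteq> internal_edges ?T"
    by (auto simp: F_def)
  have FE: "F \<subseteq> edges ?T"
    using F T.internal_edges_subset by blast
  \<comment> \<open>Nondegeneracy says that no outer edge has length 0, so the edges of length 0 are
    precisely those collapsed.\<close>
  have Fiff: "e \<in> F \<longleftrightarrow> w e = 0" if "e \<in> edges ?T" for e
    using that w(2) by (auto simp: F_def internal_edges_def degenerate_def)
  have supp: "clusters A (collapse ?T F) = {C. W C \<noteq> 0}"
    unfolding T.clusters_collapse[OF F]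
  proof (intro equalityI subsetI)
    fix C assume "C \<in> cluster A ?T ` (nonroot ?T - snd ` F)"
    then obtain v where v: "v \<in> nonroot ?T" "v \<notin> snd ` F" "C = cluster A ?T v"
      by blast
    then obtain e where e: "e \<in> edges ?T" "v = snd e"
      unfolding T.snd_edges[symmetric] by blast
    then show "C \<in> {C. W C \<noteq> 0}"
      using v Fiff[OF e(1)] T.snd_in_image_iff[OF e(1) FE] by (simp add: W_def T.tree_weight_cluster)
  next
    fix C assume "C \<in> {C. W C \<noteq> 0}"
    then have "W C \<noteq> 0"
      by simp
    then have "C \<in> clusters A ?T"
      unfolding W_def using T.tree_weight_outside by blast
    then obtain e where e: "e \<in> edges ?T" "C = cluster A ?T (snd e)"
      using T.edge_of_cluster by blast
    then have "e \<notin> F"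
      using \<open>W C \<noteq> 0\<close> Fiff[OF e(1)] by (simp add: W_def T.tree_weight_cluster)
    then have "snd e \<in> nonroot ?T - snd ` F"
      using T.snd_in_image_iff[OF e(1) FE] T.edge_snd_nonroot[OF e(1)] by simp
    then show "C \<in> cluster A ?T ` (nonroot ?T - snd ` F)"
      unfolding e(2) by (rule imageI)
  qed
  obtain c0 where c0: "c0 \<in> tree_classes A" "clusters A (rep c0) = {C. W C \<noteq> 0}"
    using rep_of_class[OF T.collapse_labelled[OF F]] unfolding supp by blast
  let ?U = "rep c0"
  interpret T0: labelled_tree A ?U by (rule rep_labelled_tree[OF c0(1)])
  obtain h where "tree_iso A (collapse ?T F) ?U h"
    using tree_iso_iff_clusters[OF T.collapse_labelled[OF F] T0.tree] c0(2) supp by blast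
  with F have col: "collapses A ?T ?U F h"
    by (simp add: collapses_def)
  let ?u = "weighting_of A ?U W"
  have w0: "tree_weight A ?U ?u = W" "?u \<in> weightings ?U"
    using T0.tree_weight_weighting_of[OF W] T0.weighting_of_in_weightings[OF W] c0(2) by auto
  have "density A W \<noteq> 0"
    using T.density_tree_weight_eq_0_iff[of w] w(2) by (simp add: W_def)
  then have nd: "?u \<notin> degenerate ?U"
    using T0.density_tree_weight_eq_0_iff[of ?u] w0(1) by simp
  \<comment> \<open>Both weightings induce the same function on clusters, and an edge is determined
    by its cluster; off the edges both are \<open>undefined\<close>.\<close>
  have eqw: "weight_map ?U ?T F h ?u = w"
  proof
    fix e
    show "weight_map ?U ?T F h ?u e = w e"
    proof (cases "e \<in> edges ?T")
      case True
      have "tree_weight A ?T (weight_map ?U ?T F h ?u) = tree_weight A ?T w"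
        using tree_weight_weight_map[OF T0.tree T.tree col, of ?u] w0(1) by (simp add: W_def)
      then show ?thesis
        using T.tree_weight_cluster[OF True] by metis
    next
      case False
      have "w \<in> extensional (edges ?T)"
        using w(1) by (simp add: weightings_def PiE_iff)
      from extensional_arb[OF this False] False show ?thesis
        by (simp add: weight_map_def)
    qed
  qed
  obtain y where y: "tree_smash_map S0_operad ?T ?U F h (Some (all_true ?T)) y"
    using tree_smash_map_S0(1)[OF T0.tree T.tree col] ..
  then have y': "y = Some (all_true ?U)"
    by (rule tree_smash_map_S0(3)[OF T0.tree T.tree col])
  have w0b: "Some ?u \<in> topspace (fst (wbar ?U))"
    using w0(2) nd by (simp add: wbar_def topspace_weight_space image_iff)
  have xb: "Some (all_true ?T) \<in> topspace (fst (tree_smash S0_operad ?T))"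
    by (simp add: tree_smash_S0[OF T.finite_verts])
  have "((c0, smash_pair (Some ?u) y),
      (c, smash_pair (wbar_map ?U ?T F h (Some ?u)) (Some (all_true ?T)))) \<in> bar_rel S0_operad A"
    by (rule bar_relI[OF c0(1) c col w0b xb y])
  moreover have "wbar_map ?U ?T F h (Some ?u) = Some w"
    using w(2) by (simp add: wbar_map_def collapse_map_def collapse_proj_def eqw)
  ultimately have "((c0, Some (Some ?u, Some (all_true ?U))), (c, Some (Some w, Some (all_true ?T))))
      \<in> bar_rel S0_operad A"
    by (simp add: smash_pair_def collapse_proj_def y')
  with c0 show ?thesis
    by blast
qed

text \<open>Equal nonzero images give equal weights \<open>W\<close>. Each point is related to one
  on a tree whose clusters are the support of \<open>W\<close>, and this tree and its lengths depend
  on \<open>W\<close> only. The mixed cases are excluded because nondegenerate weightings do not map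
  to zero.\<close>

lemma tree_map_fibres:
  assumes "A \<noteq> {}" "x \<in> topspace (bar_sum S0_operad A)" "y \<in> topspace (bar_sum S0_operad A)"
    "tree_map A x = tree_map A y"
  shows "(x, y) \<in> sym_closure (bar_rel S0_operad A)"
proof -
  obtain c z c' z' where xy: "x = (c, z)" "y = (c', z')"
    by (cases x, cases y) blast
  have c: "c \<in> tree_classes A" "c' \<in> tree_classes A"
    using assms(2,3) by (auto simp: xy mem_bar_sum)
  interpret T: labelled_tree A "rep c" by (rule rep_labelled_tree[OF c(1)])
  interpret T': labelled_tree A "rep c'" by (rule rep_labelled_tree[OF c(2)])
  consider "z = None" "z' = None"
    | w where "z = None" "z' = Some (Some w, Some (all_true (rep c')))" "w \<notin> degenerate (rep c')"
    | w where "z' = None" "z = Some (Some w, Some (all_true (rep c)))" "w \<notin> degenerate (rep c)"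
    | w w' where "z = Some (Some w, Some (all_true (rep c)))" "w \<in> weightings (rep c)" "w \<notin> degenerate (rep c)"
      "z' = Some (Some w', Some (all_true (rep c')))" "w' \<in> weightings (rep c')" "w' \<notin> degenerate (rep c')"
    using assms(2,3) unfolding xy mem_bar_sum by blast
  then show ?thesis
  proof cases
    case 1
    then have "(x, y) \<in> bar_rel S0_operad A"
      using c by (auto simp: bar_rel_def xy)
    then show ?thesis
      by auto
  next
    case (2 w)
    then have "scaled A (tree_weight A (rep c') w) = (\<lambda>_. 0)"
      using assms(4) by (simp add: xy)
    then show ?thesis
      using 2(3) by (simp add: scaled_eq_0_iff T'.density_tree_weight_eq_0_iff)
  next
    case (3 w)
    then have "scaled A (tree_weight A (rep c) w) = (\<lambda>_. 0)"
      using assms(4) by (simp add: xy)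
    then show ?thesis
      using 3(3) by (simp add: scaled_eq_0_iff T.density_tree_weight_eq_0_iff)
  next
    case (4 w w')
    define W where "W = tree_weight A (rep c) w"
    have eq: "tree_weight A (rep c') w' = W"
      unfolding W_def
    proof (rule scaled_inj[OF assms(1), symmetric])
      show "scaled A (tree_weight A (rep c) w) = scaled A (tree_weight A (rep c') w')"
        using assms(4) by (simp add: xy 4)
      show "density A (tree_weight A (rep c) w) \<noteq> 0"
        using 4(3) by (simp add: T.density_tree_weight_eq_0_iff)
    qed (simp_all add: 4 T.tree_weight_in_set_weights T'.tree_weight_in_set_weights)
    let ?p = "\<lambda>c0. (c0, Some (Some (weighting_of A (rep c0) W), Some (all_true (rep c0))))"
    obtain c0 where c0: "c0 \<in> tree_classes A" "clusters A (rep c0) = {C. W C \<noteq> 0}"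
      "(?p c0, x) \<in> bar_rel S0_operad A"
      using bar_point_reduces[OF c(1) 4(2,3)] unfolding W_def[symmetric] xy 4(1) by blast
    obtain c1 where c1: "c1 \<in> tree_classes A" "clusters A (rep c1) = {C. W C \<noteq> 0}"
      "(?p c1, y) \<in> bar_rel S0_operad A"
      using bar_point_reduces[OF c(2) 4(5,6)] unfolding eq xy 4(4) by blast
    \<comment> \<open>Both classes have the support of \<open>W\<close> as their hierarchy, and a
      class is determined by its hierarchy.\<close>
    have "c0 = c1"
      by (rule inj_onD[OF inj_on_clusters_rep _ c0(1) c1(1)]) (simp add: c0(2) c1(2))
    with c0(3) c1(3) show ?thesis
      by (meson UnCI converse_iff converse_rtrancl_into_rtrancl r_into_rtrancl)
  qed
qed

lemma weight_model_homeomorphic_bar: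
  assumes "finite A" "A \<noteq> {}"
  shows "based_homeomorphic (weight_model A, \<lambda>_. 0) (bar S0_operad A)"
proof -
  have B: "{(c, None) | c. c \<in> tree_classes A} \<subseteq> topspace (bar_sum S0_operad A)"
    by (auto simp: mem_bar_sum)
  have ne: "{(c, None) | c. c \<in> tree_classes A} \<noteq> {}"
    using tree_classes_nonempty[OF assms] by blast
  show ?thesis
    unfolding bar_def
    by (rule based_homeomorphic_quotient_space(2)[OF continuous_map_tree_map Hausdorff_space_weight_model
          compactin_bar_sum[OF assms(1)] tree_map_onto[OF assms] tree_map_invariant
          tree_map_fibres[OF assms(2)] ne B]) auto
qed

theorem lemma8p6:
  fixes A :: "'a set"
  assumes "finite A" and "A \<noteq> {}"
  shows "based_homeomorphic (partition_complex A) (bar S0_operad A)"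
  using partition_complex_homeomorphic_weight_model[OF assms] weight_model_homeomorphic_bar[OF assms]
  by (rule based_homeomorphic_trans)

end
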